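(* Let $\mathbf d$ be any degree sequence such that $\delta_a^{\mathrm t}=1$ and $\delta_a^{\mathrm h}=2$ for all hyperarcs $a\in A$, and $|\{v\in V: d_v^{\mathrm{out}}>0\}|=2$. Then for $k\to\infty$ the double hyperarc shuffling method with $k$ steps on the space $\mathcal H^{\mathrm{stub}}_{s}(\mathbf d)$ samples uniformly from that space; that is, for every initial directed hypergraph $H_0\in\mathcal H^{\mathrm{stub}}_{s}(\mathbf d)$, the outcome $H_k$ of the method converges in distribution, as $k\to\infty$, to the uniform distribution on $\mathcal H^{\mathrm{stub}}_{s}(\mathbf d)$.
   Context: **Directed hypergraphs.** A directed hypergraph $H=(V,A)$ consists of a finite vertex set $V$ and a finite multiset $A=A(H)$ of hyperarcs; a hyperarc is a pair $a=(a^{\mathrm t},a^{\mathrm h})$ of multisets of elements of $V$ (its tail and head). $m_s(v)$ denotes the multiplicity of $v$ in a multiset $s$, and $\uplus$ is multiset union with multiplicities added. A hyperarc $a$ is a self-loop if $a^{\mathrm t}=a^{\mathrm h}$; it is degenerate if some vertex has multiplicity at least $2$ in $a^{\mathrm t}$ or in $a^{\mathrm h}$. Two hyperarcs $a_1,a_2$ of $H$ are multi-hyperarcs if $a_1^{\mathrm t}=a_2^{\mathrm t}$ and $a_1^{\mathrm h}=a_2^{\mathrm h}$. **Degrees.** $d_v^{\mathrm{in}}=\sum_{a\in A}m_{a^{\mathrm h}}(v)$, $d_v^{\mathrm{out}}=\sum_{a\in A}m_{a^{\mathrm t}}(v)$, $\delta_a^{\mathrm t}=|a^{\mathrm t}|$,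 $\delta_a^{\mathrm h}=|a^{\mathrm h}|$ (cardinalities with multiplicity). The degree sequence is $\mathbf d=(\mathbf d_V,\boldsymbol\delta_A)$ with $\mathbf d_V=((d_v^{\mathrm{in}},d_v^{\mathrm{out}}))_{v\in V}$ and $\boldsymbol\delta_A=((\delta_a^{\mathrm t},\delta_a^{\mathrm h}))_{a\in A}$ (considered up to reordering). A degree sequence includes the vertex set $V$. **Stub-labeled hypergraphs.** Each vertex $v$ has $d_v^{\mathrm{out}}$ distinct out-stubs and $d_v^{\mathrm{in}}$ distinct in-stubs. In a stub-labeled directed hypergraph the tail (head) of every hyperarc is a set of out-stubs (in-stubs), every out-stub lies in exactly one tail and every in-stub in exactly one head; two stub-labeled directed hypergraphs are the same iff their collections of linked stubs are the same. Self-loops, degenerate hyperarcs and multi-hyperarcs are determined using only the underlying vertices (each stub replaced by its vertex). **Space.** $\mathcal H^{\mathrm{stub}}_s(\mathbf d)$ is the set of all stub-labeled directed hypergraphs with degree sequence $\mathbf d$ that contain no degenerate hyperarcs and no multi-hyperarcs (self-loops are allowed). **Double hyperarc shuffle.** For two distinct hyperarcs $a,b$ of $H$ (distinct elements of the multiset $A(H)$), $S(a,b)$ is the set of pairs $(\hat a,\hat b)$ with $a^{\mathrm t}\uplus b^{\mathrm t}=\hat a^{\mathrm t}\uplus\hat b^{\mathrm t}$, $a^{\mathrm h}\uplus b^{\mathrm h}=\hat a^{\mathrm h}\uplus\hat b^{\mathrm h}$, $(\delta_a^{\mathrm t},\delta_a^{\mathrm h})=(\delta_{\hat a}^{\mathrm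 t},\delta_{\hat a}^{\mathrm h})$, $(\delta_b^{\mathrm t},\delta_b^{\mathrm h})=(\delta_{\hat b}^{\mathrm t},\delta_{\hat b}^{\mathrm h})$; for stub-labeled hypergraphs tails and heads here are sets of stubs. The shuffle $s(a,b|H)$ picks $(\hat a,\hat b)\in S(a,b)$ uniformly at random and outputs $H'$ with $A(H')=(A(H)\setminus\{a,b\})\uplus\{\hat a,\hat b\}$. **Double hyperarc shuffling method with $k$ steps** on a space $\mathcal H$, from $H_0\in\mathcal H$: for $i=0,1,\dots,k-1$, pick an unordered pair of distinct hyperarcs $a_i,b_i$ of $H_i$ uniformly at random, perform $s(a_i,b_i|H_i)$ (all choices independent), and let $H_{i+1}$ be the result if it lies in $\mathcal H$, and $H_{i+1}=H_i$ otherwise. The outcome is $H_k$. *)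

theory Defs
  imports "HOL-Probability.Probability"
begin

type_synonym 'v hyperarc = "'v multiset \<times> 'v multiset"

abbreviation tail :: "'v hyperarc \<Rightarrow> 'v multiset" where "tail \<equiv> fst"
abbreviation head :: "'v hyperarc \<Rightarrow> 'v multiset" where "head \<equiv> snd"

record 'v dihypergraph =
  verts :: "'v set"
  arcs :: "'v hyperarc multiset"

definition wf_dihypergraph :: "'v dihypergraph \<Rightarrow> bool" where
  "wf_dihypergraph H \<longleftrightarrow> finite (verts H) \<and>
     (\<forall>a \<in># arcs H. set_mset (tail a) \<subseteq> verts H \<and> set_mset (head a) \<subseteq> verts H)"

definition degenerate :: "'v hyperarc \<Rightarrow> bool" where
  "degenerate a \<longleftrightarrow> (\<exists>v. count (tail a) v \<ge> 2 \<or> count (head a) v \<ge> 2)"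

definition has_multi_hyperarcs :: "'v dihypergraph \<Rightarrow> bool" where
  "has_multi_hyperarcs H \<longleftrightarrow> (\<exists>a. count (arcs H) a \<ge> 2)"

definition in_degree :: "'v dihypergraph \<Rightarrow> 'v \<Rightarrow> nat" where
  "in_degree H v = (\<Sum>a \<in># arcs H. count (head a) v)"

definition out_degree :: "'v dihypergraph \<Rightarrow> 'v \<Rightarrow> nat" where
  "out_degree H v = (\<Sum>a \<in># arcs H. count (tail a) v)"

definition arc_degree :: "'v hyperarc \<Rightarrow> nat \<times> nat" where
  "arc_degree a = (size (tail a), size (head a))"

text \<open>The hyperarc degrees form a multiset because they are considered up to reordering.
  The degree functions of a hypergraph vanish outside its vertex set.\<close>

record 'v degree_seq =
  vset :: "'v set"
  din :: "'v \<Rightarrow> nat"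
  dout :: "'v \<Rightarrow> nat"
  arc_degs :: "(nat \<times> nat) multiset"

definition degree_seq_of :: "'v dihypergraph \<Rightarrow> 'v degree_seq" where
  "degree_seq_of H = \<lparr>vset = verts H, din = in_degree H, dout = out_degree H,
     arc_degs = image_mset arc_degree (arcs H)\<rparr>"

definition is_degree_seq :: "'v degree_seq \<Rightarrow> bool" where
  "is_degree_seq d \<longleftrightarrow> (\<exists>H. wf_dihypergraph H \<and> degree_seq_of H = d)"


text \<open>The pair \<open>(v, i)\<close> is the \<open>i\<close>-th stub of \<open>v\<close>. Out-stubs and in-stubs share this
  representation but stay apart, since tails contain only out-stubs and heads only in-stubs.
  The sets of stubs forming a tail or a head are multisets without repetition, so that
  the notions for hyperarcs apply to them unchanged.\<close>

type_synonym 'v stub = "'v \<times> nat"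

definition out_stubs :: "'v degree_seq \<Rightarrow> 'v stub set" where
  "out_stubs d = {(v, i). v \<in> vset d \<and> i < dout d v}"

definition in_stubs :: "'v degree_seq \<Rightarrow> 'v stub set" where
  "in_stubs d = {(v, i). v \<in> vset d \<and> i < din d v}"

definition is_set_mset :: "'a multiset \<Rightarrow> bool" where
  "is_set_mset M \<longleftrightarrow> (\<forall>x. count M x \<le> 1)"

definition stub_labeled :: "'v degree_seq \<Rightarrow> 'v stub hyperarc multiset \<Rightarrow> bool" where
  "stub_labeled d G \<longleftrightarrow>
     (\<forall>a \<in># G. is_set_mset (tail a) \<and> set_mset (tail a) \<subseteq> out_stubs d \<and>
               is_set_mset (head a) \<and> set_mset (head a) \<subseteq> in_stubs d) \<and>
     (\<forall>s \<in> out_stubs d. size (filter_mset (\<lambda>a. s \<in># tail a) G) = 1) \<and>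
     (\<forall>s \<in> in_stubs d. size (filter_mset (\<lambda>a. s \<in># head a) G) = 1)"

definition unlabel_arc :: "'v stub hyperarc \<Rightarrow> 'v hyperarc" where
  "unlabel_arc a = (image_mset fst (tail a), image_mset fst (head a))"

definition unlabel :: "'v degree_seq \<Rightarrow> 'v stub hyperarc multiset \<Rightarrow> 'v dihypergraph" where
  "unlabel d G = \<lparr>verts = vset d, arcs = image_mset unlabel_arc G\<rparr>"

definition H_stub_s :: "'v degree_seq \<Rightarrow> 'v stub hyperarc multiset set" where
  "H_stub_s d = {G. stub_labeled d G \<and> degree_seq_of (unlabel d G) = d \<and>
     (\<forall>a \<in># arcs (unlabel d G). \<not> degenerate a) \<and> \<not> has_multi_hyperarcs (unlabel d G)}"


definition shuffle_set :: "'a hyperarc \<Rightarrow> 'a hyperarc \<Rightarrow> ('a hyperarc \<times> 'a hyperarc) set" where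
  "shuffle_set a b = {(a', b').
     tail a + tail b = tail a' + tail b' \<and> head a + head b = head a' + head b' \<and>
     arc_degree a = arc_degree a' \<and> arc_degree b = arc_degree b'}"

definition shuffle ::
  "'a hyperarc \<Rightarrow> 'a hyperarc \<Rightarrow> 'a hyperarc multiset \<Rightarrow> 'a hyperarc multiset pmf" where
  "shuffle a b G = map_pmf (\<lambda>(a', b'). G - {#a, b#} + {#a', b'#}) (pmf_of_set (shuffle_set a b))"

text \<open>The uniform distribution on \<^term>\<open>shuffle_set a b\<close> is well defined, and the order of
  \<open>a\<close> and \<open>b\<close> does not matter for the outcome of a shuffle.\<close>

lemma finite_shuffle_set: "finite (shuffle_set a b)"
proof -
  have fin: "finite {M. M \<subseteq># N}" for N :: "'b multiset"
  proof (rule finite_subset)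
    show "{M. M \<subseteq># N} \<subseteq> (\<Union>k \<le> size N. multisets_of_size (set_mset N) k)"
      by (auto simp: multisets_of_size_def size_mset_mono dest: mset_subset_eqD)
    show "finite (\<Union>k \<le> size N. multisets_of_size (set_mset N) k)"
      by (intro finite_UN_I finite_multisets_of_size) auto
  qed
  let ?X = "{M. M \<subseteq># tail a + tail b} \<times> {M. M \<subseteq># head a + head b}"
  show ?thesis
  proof (rule finite_subset)
    show "shuffle_set a b \<subseteq> ?X \<times> ?X"
      by (auto simp: shuffle_set_def)
    show "finite (?X \<times> ?X)"
      by (intro finite_cartesian_product fin)
  qed
qed

lemma shuffle_set_nonempty: "shuffle_set a b \<noteq> {}"
proof -
  have "(a, b) \<in> shuffle_set a b" by (simp add: shuffle_set_def)
  then show ?thesis by blast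
qed

lemma shuffle_commute: "shuffle a b G = shuffle b a G"
proof -
  have "bij_betw prod.swap (shuffle_set a b) (shuffle_set b a)"
    by (rule bij_betwI[where g = prod.swap]) (auto simp: shuffle_set_def add.commute)
  then have swap: "map_pmf prod.swap (pmf_of_set (shuffle_set a b)) = pmf_of_set (shuffle_set b a)"
    using shuffle_set_nonempty finite_shuffle_set by (rule map_pmf_of_set_bij_betw)
  then show ?thesis
    by (simp add: shuffle_def map_pmf_comp case_prod_unfold add_mset_commute flip: swap)
qed

text \<open>Unordered pairs of distinct hyperarcs are two-element subsets of \<^term>\<open>set_mset G\<close>: this
  agrees with pairs of distinct elements of the multiset \<open>G\<close> whenever \<open>G\<close> has no repeated
  element, as is the case in \<^const>\<open>H_stub_s\<close>. The \<open>SOME\<close> below picks one of the two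
  orders, which is immaterial by the commutation lemma above. If \<open>G\<close> has fewer than two
  hyperarcs, there is no pair to pick and the step is unspecified.\<close>

definition arc_pairs :: "'a hyperarc multiset \<Rightarrow> 'a hyperarc set set" where
  "arc_pairs G = {P. P \<subseteq> set_mset G \<and> card P = 2}"

definition shuffle_step ::
  "'a hyperarc multiset set \<Rightarrow> 'a hyperarc multiset \<Rightarrow> 'a hyperarc multiset pmf" where
  "shuffle_step S G = do {
     P \<leftarrow> pmf_of_set (arc_pairs G);
     let (a, b) = (SOME (a, b). P = {a, b});
     G' \<leftarrow> shuffle a b G;
     return_pmf (if G' \<in> S then G' else G)
   }"

primrec shuffling_method ::
  "'a hyperarc multiset set \<Rightarrow> nat \<Rightarrow> 'a hyperarc multiset \<Rightarrow> 'a hyperarc multiset pmf" where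
  "shuffling_method S 0 G = return_pmf G"
| "shuffling_method S (Suc k) G = bind_pmf (shuffling_method S k G) (shuffle_step S)"

lemma no_repeated_hyperarcs:
  assumes "G \<in> H_stub_s d"
  shows "count G a \<le> 1"
proof -
  have "count G a \<le> count (image_mset unlabel_arc G) (unlabel_arc a)"
  proof -
    have "image_mset unlabel_arc (replicate_mset (count G a) a) \<subseteq># image_mset unlabel_arc G"
      by (intro image_mset_subseteq_mono) (simp flip: count_le_replicate_mset_subset_eq)
    then show ?thesis by (simp flip: count_le_replicate_mset_subset_eq)
  qed
  also have "\<dots> \<le> 1"
  proof -
    have "\<not> count (arcs (unlabel d G)) (unlabel_arc a) \<ge> 2"
      using assms unfolding H_stub_s_def has_multi_hyperarcs_def by blast
    then show ?thesis by (simp add: unlabel_def)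
  qed
  finally show ?thesis .
qed

lemma finite_H_stub_s:
  assumes "is_degree_seq d"
  shows "finite (H_stub_s d)"
proof -
  have fin: "finite (out_stubs d)" "finite (in_stubs d)"
  proof -
    have "finite (vset d)"
      using assms by (auto simp: is_degree_seq_def wf_dihypergraph_def degree_seq_of_def)
    moreover have "out_stubs d = Sigma (vset d) (\<lambda>v. {..<dout d v})"
      and "in_stubs d = Sigma (vset d) (\<lambda>v. {..<din d v})"
      by (auto simp: out_stubs_def in_stubs_def)
    ultimately show "finite (out_stubs d)" "finite (in_stubs d)" by auto
  qed
  have simple_eq: "mset_set (set_mset M) = M" if "\<forall>x. count M x \<le> 1" for M :: "'b multiset"
  proof (rule multiset_eqI)
    fix x show "count (mset_set (set_mset M)) x = count M x"
      using that[rule_format, of x]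
      by (cases "x \<in># M") (auto simp: count_mset_set' not_in_iff order_antisym Suc_le_eq)
  qed
  let ?X = "(mset_set ` Pow (out_stubs d)) \<times> (mset_set ` Pow (in_stubs d))"
  have "H_stub_s d \<subseteq> mset_set ` Pow ?X"
  proof
    fix G assume G: "G \<in> H_stub_s d"
    have "a \<in> ?X" if "a \<in># G" for a
    proof -
      have t: "is_set_mset (tail a)" "set_mset (tail a) \<subseteq> out_stubs d"
        and h: "is_set_mset (head a)" "set_mset (head a) \<subseteq> in_stubs d"
        using G that by (auto simp: H_stub_s_def stub_labeled_def)
      have "tail a \<in> mset_set ` Pow (out_stubs d)"
        using t simple_eq[of "tail a"] by (intro image_eqI[of _ _ "set_mset (tail a)"]) (auto simp: is_set_mset_def)
      moreover have "head a \<in> mset_set ` Pow (in_stubs d)"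
        using h simple_eq[of "head a"] by (intro image_eqI[of _ _ "set_mset (head a)"]) (auto simp: is_set_mset_def)
      ultimately show ?thesis by (cases a) auto
    qed
    then have "set_mset G \<subseteq> ?X" by blast
    moreover have "G = mset_set (set_mset G)"
      using simple_eq[of G] no_repeated_hyperarcs[OF G] by simp
    ultimately show "G \<in> mset_set ` Pow ?X" by blast
  qed
  then show ?thesis using fin by (auto intro: finite_subset)
qed

text \<open>Convergence in distribution on a discrete space, where every test function is continuous.\<close>

definition converges_in_distribution :: "(nat \<Rightarrow> 'a pmf) \<Rightarrow> 'a pmf \<Rightarrow> bool" where
  "converges_in_distribution p q \<longleftrightarrow>
     (\<forall>f :: 'a \<Rightarrow> real. bounded (range f) \<longrightarrow>
        (\<lambda>k. measure_pmf.expectation (p k) f) \<longlonglongrightarrow> measure_pmf.expectation q f)"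

end

theory Submission
  imports Defs "HOL-Combinatorics.Permutations"
begin

text \<open>Shuffling two hyperarcs is symmetric, since the outcomes allowed depend only on the stubs involved,
  and may change nothing; so everything rests on irreducibility. With two tail vertices, a
  hypergraph is a loopless multigraph (the heads) whose edges are coloured by their tails, with
  different colours on parallel edges. Recolouring single edges and permuting the stubs of a vertex
  can be done by shuffles, which leaves the multigraphs with given degrees, multiplicities at most
  two, and at most \<open>q\<close> double edges, where \<open>q\<close> is the size of the smaller colour class: these must
  be connected by edge swaps. Take a closest unconnected pair \<open>G\<close>, \<open>H\<close>. As the number of double edges
  is a separable convex function of the multiplicities, \<open>G - H\<close> is a single closed alternating trail
  without closed alternating subtrails, and hence visits two consecutive vertices only once. A chord
  from such a vertex splits the trail into two closed ones; that neither of them leads from \<open>G\<close> to an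
  intermediate multigraph fixes the multiplicities in \<open>G\<close> of the edges next to the vertex, up to two
  cases. For two adjacent vertices this is contradictory, unless the trail has length four, that is,
  \<open>G\<close> and \<open>H\<close> differ by one swap.\<close>

section \<open>Loopless multigraphs with edge multiplicities at most two\<close>

text \<open>A double edge lies in both colour classes, which is the origin of the bound
  \<open>q\<close>. This bound is the obstacle: a swap that is legal otherwise may create one double
  edge too many. If \<open>G - H\<close> is split into two pieces, the numbers of double edges
  gained by removing the one or the other piece from \<open>G\<close> add up to at most zero,
  provided \<open>G\<close> has at least as many double edges as \<open>H\<close>. Hence two
  balanced pieces cannot both be forbidden; it follows that revisits of a vertex happen at odd
  distance and never interlace. For a chord, two patterns survive: its multiplicity in
  \<open>G\<close> is 0 or 2. Passing from one to the other would need a jump by three, while moving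
  the far end by two edges changes the count by at most one. So all chords at a vertex visited once
  show the same pattern, and the first and last of them give the multiplicities next to it. In the
  lift to colours, the bound \<open>q\<close> after the swap guarantees enough edges of a single
  colour for recolouring.\<close>

definition chi :: "'a \<Rightarrow> 'a \<Rightarrow> int" where
  "chi e e' = (if e' = e then 1 else 0)"

text \<open>Multiplicities are integers, so that the degree also applies to differences of
  multigraphs, where balanced means degree zero everywhere.\<close>

definition edeg :: "'v multiset set \<Rightarrow> ('v multiset \<Rightarrow> int) \<Rightarrow> 'v \<Rightarrow> int" where
  "edeg P m v = (\<Sum>e\<in>P. m e * int (count e v))"

text \<open>On values from 0 to 2 this is the number of double edges; the form with
  \<open>max\<close> is convex in each multiplicity.\<close>

definition cost :: "'e set \<Rightarrow> ('e \<Rightarrow> int) \<Rightarrow> int" where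
  "cost P m = (\<Sum>e\<in>P. max 0 (m e - 1))"

definition l1dist :: "'e set \<Rightarrow> ('e \<Rightarrow> int) \<Rightarrow> ('e \<Rightarrow> int) \<Rightarrow> int" where
  "l1dist P m m' = (\<Sum>e\<in>P. \<bar>m e - m' e\<bar>)"

text \<open>For \<open>D = G - H\<close>, subtracting a conformal \<open>p\<close> from
  \<open>G\<close> stays pointwise between \<open>G\<close> and \<open>H\<close>, so the bounds on
  multiplicities hold automatically.\<close>

definition conformal :: "('e \<Rightarrow> int) \<Rightarrow> ('e \<Rightarrow> int) \<Rightarrow> bool" where
  "conformal p D \<longleftrightarrow> (\<forall>e. 0 \<le> p e \<and> p e \<le> D e \<or> D e \<le> p e \<and> p e \<le> 0)"

definition loopless :: "'v multiset set \<Rightarrow> bool" where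
  "loopless P \<longleftrightarrow> (\<forall>e\<in>P. \<exists>x y. e = {#x, y#} \<and> x \<noteq> y)"

definition gspace :: "'v multiset set \<Rightarrow> ('v \<Rightarrow> int) \<Rightarrow> int \<Rightarrow> ('v multiset \<Rightarrow> int) set" where
  "gspace P d q = {m. (\<forall>e. 0 \<le> m e \<and> m e \<le> 2) \<and> (\<forall>e. e \<notin> P \<longrightarrow> m e = 0) \<and>
     (\<forall>v. edeg P m v = d v) \<and> cost P m \<le> q}"

abbreviation trail_edge :: "(nat \<Rightarrow> 'v) \<Rightarrow> nat \<Rightarrow> 'v multiset" where
  "trail_edge z k \<equiv> {#z k, z (Suc k)#}"

text \<open>The sign is tied to the absolute index, not to the position within \<open>K\<close>, so
  pieces of one trail can be added and complemented freely.\<close>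

definition part :: "(nat \<Rightarrow> 'v) \<Rightarrow> nat set \<Rightarrow> 'v multiset \<Rightarrow> int" where
  "part z K e = (\<Sum>k\<in>K. (-1) ^ k * chi (trail_edge z k) e)"

section \<open>Degrees of signed pieces of a trail\<close>

lemma edeg_diff: "edeg P (\<lambda>e. m e - m' e) v = edeg P m v - edeg P m' v"
  by (simp add: edeg_def left_diff_distrib sum_subtractf)

lemma edeg_add: "edeg P (\<lambda>e. m e + m' e) v = edeg P m v + edeg P m' v"
  by (simp add: edeg_def distrib_right sum.distrib)

lemma edeg_scale: "edeg P (\<lambda>e. t * m e) v = t * edeg P m v"
  by (simp add: edeg_def sum_distrib_left mult.assoc)

lemma edeg_chi: "finite P \<Longrightarrow> e \<in> P \<Longrightarrow> edeg P (chi e) v = int (count e v)"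
  by (simp add: edeg_def chi_def if_distrib[of "\<lambda>x. x * _"] cong: if_cong)

lemma edeg_part:
  assumes "finite P" "finite K" "\<And>k. k \<in> K \<Longrightarrow> trail_edge z k \<in> P"
  shows "edeg P (part z K) v =
    (\<Sum>k\<in>K. (-1) ^ k * (of_bool (z k = v) + of_bool (z (Suc k) = v)))"
proof -
  have "edeg P (part z K) v
      = (\<Sum>e\<in>P. \<Sum>k\<in>K. (-1) ^ k * (chi (trail_edge z k) e * int (count e v)))"
    by (simp add: edeg_def part_def sum_distrib_right mult.assoc)
  also have "\<dots> = (\<Sum>k\<in>K. (-1) ^ k * edeg P (chi (trail_edge z k)) v)"
    by (subst sum.swap) (simp add: edeg_def sum_distrib_left)
  also have "\<dots> = (\<Sum>k\<in>K. (-1) ^ k * (of_bool (z k = v) + of_bool (z (Suc k) = v)))"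
    using assms by (intro sum.cong) (auto simp: edeg_chi)
  finally show ?thesis .
qed

lemma alternating_telescope:
  fixes a :: "nat \<Rightarrow> int"
  assumes "i \<le> j"
  shows "(\<Sum>k\<in>{i..<j}. (-1) ^ k * (a k + a (Suc k))) = (-1) ^ i * a i - (-1) ^ j * a j"
  using assms by (induction j rule: dec_induct) (auto simp: algebra_simps)

text \<open>An inner vertex receives opposite signs from the two edges around it, so only the ends
  of the stretch contribute.\<close>

lemma edeg_part_interval:
  assumes "finite P" "i \<le> j" "\<And>k. trail_edge z k \<in> P"
  shows "edeg P (part z {i..<j}) v = (-1) ^ i * of_bool (z i = v) - (-1) ^ j * of_bool (z j = v)"
  using edeg_part[of P "{i..<j}" z v] assms alternating_telescope[OF assms(2), of "\<lambda>k. of_bool (z k = v)"]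
  by simp

lemma part_union:
  assumes "finite K" "finite L" "K \<inter> L = {}"
  shows "part z (K \<union> L) e = part z K e + part z L e"
  using assms by (simp add: part_def sum.union_disjoint)

lemma conformal_abs_sum:
  assumes "conformal p D"
  shows "\<bar>p e\<bar> + \<bar>D e - p e\<bar> = \<bar>D e\<bar>"
  using assms[unfolded conformal_def, rule_format, of e] by auto

text \<open>The factor \<open>s\<close> treats both signs at once: a trail goes on with positive
  edges at even positions and negative ones at odd positions.\<close>

lemma edeg_sign_edge:
  assumes "s * edeg P m v > 0" "loopless P"
  obtains y where "{#v, y#} \<in> P" "s * m {#v, y#} > 0"
proof -
  have "s * edeg P m v = (\<Sum>e\<in>P. s * (m e * int (count e v)))"
    unfolding edeg_def by (rule sum_distrib_left)
  with assms(1) have "\<not> (\<Sum>e\<in>P. s * (m e * int (count e v))) \<le> 0" by linarith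
  then obtain e where e: "e \<in> P" "\<not> s * (m e * int (count e v)) \<le> 0"
    using sum_nonpos[of P "\<lambda>e. s * (m e * int (count e v))"] by blast
  then have pos: "0 < (s * m e) * int (count e v)" by (simp only: mult.assoc not_le)
  have v: "v \<in># e"
  proof (rule ccontr)
    assume "v \<notin># e"
    then have "count e v = 0" by (simp add: not_in_iff)
    then show False using pos by simp
  qed
  have "s * m e > 0" using zero_less_mult_pos2[OF pos] v by simp
  moreover obtain x y where "e = {#x, y#}" using assms(2) e(1) unfolding loopless_def by blast
  ultimately show thesis using that[of x] that[of y] e(1) v by (auto simp: add_mset_commute)
qed

text \<open>Without a positive edge, the nonzero one would be negative and give its end
  \<open>x\<close> a negative degree.\<close>

lemma ex_positive_edge:
  assumes P: "loopless P" and bal: "\<And>v. edeg P D v = 0"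
    and D: "e \<in> P" "D e \<noteq> 0" and fin: "finite P"
  shows "\<exists>x y. {#x, y#} \<in> P \<and> D {#x, y#} > 0"
proof -
  obtain x y where e: "e = {#x, y#}" using P D(1) unfolding loopless_def by blast
  have "\<exists>e'\<in>P. D e' > 0"
  proof (rule ccontr)
    assume "\<not> ?thesis"
    then have nonpos: "D e' \<le> 0" if "e' \<in> P" for e' using that by force
    have "edeg P D x < (\<Sum>e\<in>P. 0)"
      unfolding edeg_def
    proof (rule sum_strict_mono_ex1[OF fin])
      show "\<forall>e\<in>P. D e * int (count e x) \<le> 0" using nonpos by (simp add: mult_nonpos_nonneg)
      have "D e < 0" using nonpos[OF D(1)] D(2) by linarith
      then have "D e * int (count e x) < 0" by (rule mult_neg_pos) (simp add: e)
      then show "\<exists>e\<in>P. D e * int (count e x) < 0" using D(1) by blast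
    qed
    then show False using bal by simp
  qed
  then show ?thesis using P unfolding loopless_def by metis
qed

section \<open>Closed alternating trails in a balanced difference\<close>

text \<open>Greedy construction: as the residual \<open>D - part z {..<k}\<close> is balanced except at the two ends
  of the trail, a trail that has not closed up can be continued.\<close>

definition is_trail :: "'v multiset set \<Rightarrow> ('v multiset \<Rightarrow> int) \<Rightarrow> (nat \<Rightarrow> 'v) \<Rightarrow> nat \<Rightarrow> bool" where
  "is_trail P D z k \<longleftrightarrow> (\<forall>i<k. trail_edge z i \<in> P \<and>
     0 < (-1) ^ i * (D (trail_edge z i) - part z {..<i} (trail_edge z i)))"

lemma part_Suc: "part z {..<Suc k} e = part z {..<k} e + (-1) ^ k * chi (trail_edge z k) e"
  by (simp add: part_def)

lemma part_cong: "(\<And>k. k \<in> K \<Longrightarrow> trail_edge z k = trail_edge z' k) \<Longrightarrow> part z K = part z' K"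
  by (auto simp: part_def fun_eq_iff intro!: sum.cong)

lemma minus_one_power_cases: "((-1::int) ^ k = 1 \<and> even k) \<or> ((-1::int) ^ k = -1 \<and> odd k)"
  by (cases "even k") auto

text \<open>Each step moves one unit towards \<open>D\<close> on an edge where the residual still
  has that sign, so it never overshoots.\<close>

lemma is_trail_conformal:
  assumes "is_trail P D z k"
  shows "conformal (part z {..<k}) D"
  using assms
proof (induction k)
  case 0
  then show ?case by (auto simp: conformal_def part_def)
next
  case (Suc k)
  let ?t = "trail_edge z k"
  have IH: "conformal (part z {..<k}) D" using Suc by (auto simp: is_trail_def)
  have pos: "0 < (-1) ^ k * (D ?t - part z {..<k} ?t)" using Suc.prems by (auto simp: is_trail_def)
  show ?case unfolding conformal_def
  proof
    fix e
    show "0 \<le> part z {..<Suc k} e \<and> part z {..<Suc k} e \<le> D e \<or>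
          D e \<le> part z {..<Suc k} e \<and> part z {..<Suc k} e \<le> 0"
      using IH[unfolded conformal_def, rule_format, of e] pos minus_one_power_cases[of k]
      by (cases "e = ?t") (auto simp: part_Suc chi_def)
  qed
qed

lemma is_trail_sign:
  assumes "is_trail P D z k" "i < k"
  shows "0 < (-1) ^ i * D (trail_edge z i)"
proof -
  let ?t = "trail_edge z i"
  have "is_trail P D z i" using assms by (auto simp: is_trail_def)
  then have "conformal (part z {..<i}) D" by (rule is_trail_conformal)
  then have "0 \<le> part z {..<i} ?t \<and> part z {..<i} ?t \<le> D ?t \<or>
      D ?t \<le> part z {..<i} ?t \<and> part z {..<i} ?t \<le> 0"
    unfolding conformal_def by blast
  moreover have "0 < (-1) ^ i * (D ?t - part z {..<i} ?t)"
    using assms by (auto simp: is_trail_def)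
  ultimately show ?thesis
    using minus_one_power_cases[of i] by auto
qed

text \<open>Every edge of the trail lowers the l1 norm of the residual by exactly one.\<close>

lemma is_trail_length:
  assumes "is_trail P D z k" "finite P"
  shows "int k \<le> (\<Sum>e\<in>P. \<bar>D e\<bar>)"
proof -
  have "(\<Sum>e\<in>P. \<bar>D e - part z {..<k} e\<bar>) = (\<Sum>e\<in>P. \<bar>D e\<bar>) - int k"
    using assms(1)
  proof (induction k)
    case 0
    then show ?case by (simp add: part_def)
  next
    case (Suc k)
    let ?t = "trail_edge z k"
    have t: "?t \<in> P" and pos: "0 < (-1) ^ k * (D ?t - part z {..<k} ?t)"
      and IH: "(\<Sum>e\<in>P. \<bar>D e - part z {..<k} e\<bar>) = (\<Sum>e\<in>P. \<bar>D e\<bar>) - int k"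
      using Suc by (auto simp: is_trail_def)
    have "\<bar>D e - part z {..<Suc k} e\<bar> = \<bar>D e - part z {..<k} e\<bar> - chi ?t e" for e
      using pos minus_one_power_cases[of k] by (auto simp: part_Suc chi_def)
    then have "(\<Sum>e\<in>P. \<bar>D e - part z {..<Suc k} e\<bar>)
        = (\<Sum>e\<in>P. \<bar>D e - part z {..<k} e\<bar>) - (\<Sum>e\<in>P. chi ?t e)"
      by (simp add: sum_subtractf)
    also have "(\<Sum>e\<in>P. chi ?t e) = 1" using t assms(2) by (simp add: chi_def)
    finally show ?case using IH by simp
  qed
  moreover have "(\<Sum>e\<in>P. \<bar>D e - part z {..<k} e\<bar>) \<ge> 0" by (simp add: sum_nonneg)
  ultimately show ?thesis by simp
qed

lemma trail_closes_or_extends: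
  assumes P: "finite P" "loopless P" and bal: "\<And>v. edeg P D v = 0"
    and tr: "is_trail P D z k" and k: "k > 0"
  shows "even k \<and> z k = z 0 \<or> (\<exists>y. is_trail P D (z(Suc k := y)) (Suc k))"
proof (rule disjCI)
  assume "\<not> (\<exists>y. is_trail P D (z(Suc k := y)) (Suc k))"
  let ?R = "\<lambda>e. D e - part z {..<k} e"
  have R: "edeg P ?R v = (-1) ^ k * of_bool (z k = v) - of_bool (z 0 = v)" for v
    using edeg_part[OF P(1), of "{..<k}" z v] tr
      alternating_telescope[of 0 k "\<lambda>k. of_bool (z k = v)"]
    by (simp add: edeg_diff bal is_trail_def atLeast0LessThan)
  \<comment> \<open>By \<open>R\<close> this quantity is
    \<open>1 - (-1) ^ k * of_bool (z 0 = z k)\<close>: it vanishes only on a return to the start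
    after an even number of edges. An odd return leaves 2 and does not block the trail.\<close>
  have "\<not> (-1) ^ k * edeg P ?R (z k) > 0"
  proof
    assume "(-1) ^ k * edeg P ?R (z k) > 0"
    then obtain y where y: "{#z k, y#} \<in> P" "(-1) ^ k * ?R {#z k, y#} > 0"
      using edeg_sign_edge[of "(-1) ^ k" P ?R "z k"] P(2) by blast
    let ?z = "z(Suc k := y)"
    have same: "part ?z {..<i} = part z {..<i}" if "i \<le> k" for i
      using that by (intro part_cong) auto
    have "is_trail P D ?z (Suc k)"
      unfolding is_trail_def
    proof (intro allI impI)
      fix i assume "i < Suc k"
      then consider "i < k" | "i = k" by linarith
      then show "trail_edge ?z i \<in> P \<and>
          0 < (-1) ^ i * (D (trail_edge ?z i) - part ?z {..<i} (trail_edge ?z i))"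
      proof cases
        case 1
        then have "trail_edge ?z i = trail_edge z i" by auto
        then show ?thesis using tr 1 same[of i] by (auto simp: is_trail_def)
      next
        case 2
        then show ?thesis using y same[of k] by auto
      qed
    qed
    then show False using \<open>\<not> (\<exists>y. _ y)\<close> by blast
  qed
  then show "even k \<and> z k = z 0"
    using minus_one_power_cases[of k] by (auto simp: R split: if_splits)
qed

text \<open>If no trail closed, there would be trails of every length, against
  \<open>is_trail_length\<close>.\<close>

lemma ex_closed_trail:
  assumes P: "finite P" "loopless P" and bal: "\<And>v. edeg P D v = 0"
    and D: "e \<in> P" "D e \<noteq> 0"
  shows "\<exists>z k. k > 0 \<and> even k \<and> z k = z 0 \<and> is_trail P D z k"
proof (rule ccontr)
  assume none: "\<not> ?thesis"
  have "\<exists>z. is_trail P D z (Suc k)" for k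
  proof (induction k)
    case 0
    obtain x y where "{#x, y#} \<in> P" "D {#x, y#} > 0"
      using ex_positive_edge[OF P(2) bal D P(1)] by blast
    then show ?case
      by (intro exI[of _ "\<lambda>i. if i = 0 then x else y"]) (auto simp: is_trail_def part_def)
  next
    case (Suc k)
    then obtain z where "is_trail P D z (Suc k)" by blast
    then show ?case using trail_closes_or_extends[OF P bal] none by blast
  qed
  then obtain z where "is_trail P D z (Suc (nat (\<Sum>e\<in>P. \<bar>D e\<bar>)))" by blast
  from is_trail_length[OF this P(1)] show False by linarith
qed

text \<open>Indices are read modulo \<open>n\<close>; as \<open>n\<close> is even, the signs are
  periodic too. Later arguments can thus open a window at any vertex.\<close>

lemma periodic_closed_trail:
  assumes "finite P" "loopless P" "\<And>v. edeg P D v = 0" "e \<in> P" "D e \<noteq> 0"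
  obtains z n where "n > 0" "even n" "\<And>i. z (i + n) = z i" "\<And>i. trail_edge z i \<in> P"
    "\<And>i. 0 < (-1) ^ i * D (trail_edge z i)" "conformal (part z {..<n}) D"
proof -
  obtain z n where n: "n > 0" "even n" and closed: "z n = z 0" and tr: "is_trail P D z n"
    using ex_closed_trail[OF assms] by blast
  let ?z = "\<lambda>i. z (i mod n)"
  have edge: "trail_edge ?z i = trail_edge z (i mod n)" for i
    using closed by (simp add: mod_Suc)
  have lt: "i mod n < n" for i using n by simp
  have par: "(-1::int) ^ i = (-1) ^ (i mod n)" for i
    using minus_one_power_cases[of i] minus_one_power_cases[of "i mod n"] n(2)
    by (auto simp: dvd_mod_iff)
  show thesis
  proof (rule that[of n ?z])
    show "trail_edge ?z i \<in> P" for i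
      unfolding edge using tr lt[of i] by (simp add: is_trail_def)
    show "0 < (-1) ^ i * D (trail_edge ?z i)" for i
      unfolding edge par[of i] using is_trail_sign[OF tr lt] .
    have "part ?z {..<n} = part z {..<n}" by (rule part_cong) (simp only: edge, simp)
    then show "conformal (part ?z {..<n}) D" using is_trail_conformal[OF tr] by simp
  qed (use n in auto)
qed

section \<open>Pairs of multigraphs with nothing between them\<close>

lemma cost_add_chi:
  assumes "finite P" "c \<in> P"
  shows "cost P (\<lambda>e. m e + s * chi c e) = cost P m + (max 0 (m c + s - 1) - max 0 (m c - 1))"
proof -
  have "cost P (\<lambda>e. m e + s * chi c e) - cost P m
      = (\<Sum>e\<in>P. if e = c then max 0 (m c + s - 1) - max 0 (m c - 1) else 0)"
    unfolding cost_def sum_subtractf[symmetric] by (intro sum.cong) (auto simp: chi_def)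
  then show ?thesis using assms by simp
qed

lemma l1dist_nonneg: "0 \<le> l1dist P m m'"
  by (simp add: l1dist_def sum_nonneg)

lemma l1dist_commute: "l1dist P m m' = l1dist P m' m"
  by (simp add: l1dist_def abs_minus_commute)

lemma sum_chi: "finite P \<Longrightarrow> c \<in> P \<Longrightarrow> (\<Sum>e\<in>P. chi c e) = 1"
  by (simp add: chi_def)

text \<open>\<open>no_between\<close> is what minimal distance among unconnected pairs provides: a
  third multigraph nearer to both would connect them. \<open>cost_le\<close> is a choice of roles,
  and \<open>all_pairs\<close> makes chords available.\<close>

locale closest_pair =
  fixes P :: "'v multiset set" and d :: "'v \<Rightarrow> int" and q :: int
    and G H :: "'v multiset \<Rightarrow> int"
  assumes finP: "finite P" and looplessP: "loopless P"
    and all_pairs: "\<And>e f x y. e \<in> P \<Longrightarrow> f \<in> P \<Longrightarrow> x \<in># e \<Longrightarrow> y \<in># f \<Longrightarrow> x \<noteq> y \<Longrightarrow> {#x, y#} \<in> P"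
    and G: "G \<in> gspace P d q" and H: "H \<in> gspace P d q"
    and cost_le: "cost P H \<le> cost P G"
    and no_between: "\<And>K. K \<in> gspace P d q \<Longrightarrow> l1dist P G K < l1dist P G H \<Longrightarrow>
      l1dist P K H < l1dist P G H \<Longrightarrow> False"
begin

definition D :: "'v multiset \<Rightarrow> int" where "D e = G e - H e"

text \<open>The gain in double edges when \<open>p\<close> is removed from \<open>G\<close>. As
  \<open>cost P G\<close> is at most \<open>q\<close>, a candidate excluded for its cost has a
  positive gain, so exclusions become lower bounds on \<open>w\<close>.\<close>

definition w :: "('v multiset \<Rightarrow> int) \<Rightarrow> int" where
  "w p = cost P (\<lambda>e. G e - p e) - cost P G"

lemma GH_bounds: "0 \<le> G e" "G e \<le> 2" "0 \<le> H e" "H e \<le> 2"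
  using G H by (auto simp: gspace_def)

lemma off_P: "e \<notin> P \<Longrightarrow> G e = 0" "e \<notin> P \<Longrightarrow> H e = 0"
  using G H by (auto simp: gspace_def)

lemma edeg_D: "edeg P D v = 0"
  using G H by (simp add: D_def[abs_def] edeg_diff gspace_def)

lemma cost_G: "cost P G \<le> q"
  using G by (simp add: gspace_def)

lemma conformal_bounds:
  assumes "conformal p D"
  shows "0 \<le> G e - p e" "G e - p e \<le> 2" "0 \<le> H e + p e" "H e + p e \<le> 2"
    "e \<notin> P \<Longrightarrow> p e = 0"
proof -
  have c: "0 \<le> p e \<and> p e \<le> D e \<or> D e \<le> p e \<and> p e \<le> 0"
    using assms unfolding conformal_def by blast
  show "0 \<le> G e - p e" "G e - p e \<le> 2" "0 \<le> H e + p e" "H e + p e \<le> 2"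
    using c GH_bounds[of e] unfolding D_def by linarith+
  show "p e = 0" if "e \<notin> P" using c off_P[OF that] by (auto simp: D_def)
qed

lemma conformal_complement:
  assumes "conformal p D" shows "conformal (\<lambda>e. D e - p e) D"
  unfolding conformal_def
proof
  fix e
  have "0 \<le> p e \<and> p e \<le> D e \<or> D e \<le> p e \<and> p e \<le> 0"
    using assms unfolding conformal_def by blast
  then show "0 \<le> D e - p e \<and> D e - p e \<le> D e \<or> D e \<le> D e - p e \<and> D e - p e \<le> 0"
    by linarith
qed

text \<open>On each edge, \<open>G - p\<close> and \<open>H + p\<close> lie between \<open>G\<close>
  and \<open>H\<close> and have the same sum, so by convexity their joint cost is at most that of
  \<open>G\<close> and \<open>H\<close>; \<open>cost_le\<close> does the rest.\<close>

lemma w_convex: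
  assumes "conformal p D"
  shows "w p + w (\<lambda>e. D e - p e) \<le> 0"
proof -
  have "cost P (\<lambda>e. G e - p e) + cost P (\<lambda>e. G e - (D e - p e)) \<le> cost P G + cost P H"
    unfolding cost_def sum.distrib[symmetric]
  proof (rule sum_mono)
    fix e
    have "0 \<le> p e \<and> p e \<le> D e \<or> D e \<le> p e \<and> p e \<le> 0"
      using assms unfolding conformal_def by blast
    then show "max 0 (G e - p e - 1) + max 0 (G e - (D e - p e) - 1)
        \<le> max 0 (G e - 1) + max 0 (H e - 1)"
      unfolding D_def by linarith
  qed
  then show ?thesis using cost_le by (simp add: w_def)
qed

lemma dist_GH: "l1dist P G H = (\<Sum>e\<in>P. \<bar>D e\<bar>)"
  by (simp add: l1dist_def D_def)

lemma conformal_dist: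
  assumes "conformal p D"
  shows "(\<Sum>e\<in>P. \<bar>p e\<bar>) + (\<Sum>e\<in>P. \<bar>D e - p e\<bar>) = l1dist P G H"
  unfolding dist_GH sum.distrib[symmetric] using conformal_abs_sum[OF assms] by simp

lemma shifted_in_gspace:
  assumes "\<And>e. 0 \<le> G e - r e \<and> G e - r e \<le> 2" "\<And>e. e \<notin> P \<Longrightarrow> r e = 0"
    "\<And>v. edeg P r v = 0" "cost P (\<lambda>e. G e - r e) \<le> q"
  shows "(\<lambda>e. G e - r e) \<in> gspace P d q"
  using assms G off_P by (auto simp: gspace_def edeg_diff)

text \<open>Otherwise \<open>G - p\<close> and \<open>G - (D - p)\<close> are both strictly nearer
  to \<open>G\<close> and \<open>H\<close>, hence excluded by cost, and both gains are positive,
  against \<open>w_convex\<close>.\<close>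

lemma conformal_balanced_trivial:
  assumes p: "conformal p D" and bal: "\<And>v. edeg P p v = 0"
  shows "(\<forall>e\<in>P. p e = 0) \<or> (\<forall>e\<in>P. p e = D e)"
proof (rule ccontr)
  assume neg: "\<not> ?thesis"
  let ?s = "\<lambda>e. D e - p e"
  have s: "conformal ?s D" using p by (rule conformal_complement)
  have s_bal: "edeg P ?s v = 0" for v using bal edeg_D by (simp add: edeg_diff)
  have pos: "0 < (\<Sum>e\<in>P. \<bar>p e\<bar>)" "0 < (\<Sum>e\<in>P. \<bar>?s e\<bar>)"
  proof -
    obtain e f where "e \<in> P" "p e \<noteq> 0" "f \<in> P" "D f - p f \<noteq> 0" using neg by auto
    then show "0 < (\<Sum>e\<in>P. \<bar>p e\<bar>)" "0 < (\<Sum>e\<in>P. \<bar>?s e\<bar>)"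
      using finP sum_pos2[of P e "\<lambda>e. \<bar>p e\<bar>"] sum_pos2[of P f "\<lambda>e. \<bar>?s e\<bar>"] by simp_all
  qed
  have excluded: "cost P (\<lambda>e. G e - r e) > q"
    if r: "conformal r D" and r_bal: "\<And>v. edeg P r v = 0"
      and pos: "0 < (\<Sum>e\<in>P. \<bar>r e\<bar>)" "0 < (\<Sum>e\<in>P. \<bar>D e - r e\<bar>)" for r
  proof (rule ccontr)
    assume "\<not> ?thesis"
    then have "(\<lambda>e. G e - r e) \<in> gspace P d q"
      using conformal_bounds[OF r] r_bal by (intro shifted_in_gspace) auto
    moreover have "l1dist P G (\<lambda>e. G e - r e) = (\<Sum>e\<in>P. \<bar>r e\<bar>)"
      by (simp add: l1dist_def)
    moreover have "l1dist P (\<lambda>e. G e - r e) H = (\<Sum>e\<in>P. \<bar>D e - r e\<bar>)"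
      by (simp add: l1dist_def D_def algebra_simps)
    ultimately show False using no_between conformal_dist[OF r] pos by fastforce
  qed
  have "w p > 0" "w ?s > 0"
    using excluded[OF p bal] excluded[OF s s_bal] pos cost_G by (auto simp: w_def)
  then show False using w_convex[OF p] by linarith
qed

text \<open>Closing the two halves of \<^term>\<open>D\<close> with the chord \<open>{#x, y#}\<close> yields two candidates strictly
  between \<open>G\<close> and \<open>H\<close>; that both are forbidden leaves only two cost patterns.\<close>

lemma chord:
  assumes p: "conformal p D"
    and p_deg: "\<And>v. edeg P p v = of_bool (x = v) + of_bool (y = v)"
    and c: "{#x, y#} \<in> P" "D {#x, y#} = 0"
    and long: "2 \<le> (\<Sum>e\<in>P. \<bar>p e\<bar>)" "2 \<le> (\<Sum>e\<in>P. \<bar>D e - p e\<bar>)"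
  shows "w p \<ge> 1 \<and> w (\<lambda>e. D e - p e) \<le> -1 \<or> w p \<le> -2 \<and> w (\<lambda>e. D e - p e) \<ge> 2"
proof -
  let ?c = "{#x, y#}" and ?s = "\<lambda>e. D e - p e"
  have s: "conformal ?s D" using p by (rule conformal_complement)
  have xy: "x \<noteq> y" using looplessP c(1) by (auto simp: loopless_def add_eq_conv_ex)
  have pc: "p ?c = 0" using p c(2) unfolding conformal_def by (metis antisym)
  have chi_deg: "edeg P (chi ?c) v = of_bool (x = v) + of_bool (y = v)" for v
    using edeg_chi[OF finP c(1)] by auto
  have sum_shift: "(\<Sum>e\<in>P. \<bar>r e + t * chi ?c e\<bar>) \<le> (\<Sum>e\<in>P. \<bar>r e\<bar>) + 1"
    if "\<bar>t\<bar> = 1" for r t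
  proof -
    have "(\<Sum>e\<in>P. \<bar>r e + t * chi ?c e\<bar>) \<le> (\<Sum>e\<in>P. \<bar>r e\<bar> + chi ?c e)"
      using that by (intro sum_mono) (auto simp: chi_def)
    then show ?thesis using sum_chi[OF finP c(1)] by (simp add: sum.distrib)
  qed
  \<comment> \<open>The case \<open>t = -1\<close> adds the chord to \<open>G - p\<close>, the case
    \<open>t = 1\<close> removes it from \<open>G - ?s\<close>; either way the degrees left at
    \<open>x\<close> and \<open>y\<close> cancel. As both halves have norm at least two, one extra
    edge still leaves the candidate strictly nearer to both ends.\<close>
  have excluded: "cost P (\<lambda>e. G e - r e) + (max 0 (G ?c - t - 1) - max 0 (G ?c - 1)) > q"
    if r: "r = p \<and> t = -1 \<or> r = ?s \<and> t = 1" and ok: "0 \<le> G ?c - t" "G ?c - t \<le> 2" for r t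
  proof (rule ccontr)
    assume neg: "\<not> ?thesis"
    let ?r = "\<lambda>e. r e + t * chi ?c e"
    have conf: "conformal r D" using r p s by auto
    have rc: "r ?c = 0" using r pc c(2) by auto
    have "(\<lambda>e. G e - ?r e) \<in> gspace P d q"
    proof (rule shifted_in_gspace)
      show "0 \<le> G e - ?r e \<and> G e - ?r e \<le> 2" for e
        using conformal_bounds[OF conf, of e] rc ok by (auto simp: chi_def)
      show "?r e = 0" if "e \<notin> P" for e
        using that c(1) conformal_bounds(5)[OF conf] by (auto simp: chi_def)
      show "edeg P ?r v = 0" for v
        using r p_deg[of v] edeg_D[of v] chi_deg[of v]
        unfolding edeg_add edeg_scale by (auto simp: edeg_diff)
      have "cost P (\<lambda>e. (G e - r e) + (-t) * chi ?c e) \<le> q"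
        using neg rc by (subst cost_add_chi[OF finP c(1)]) simp
      then show "cost P (\<lambda>e. G e - ?r e) \<le> q"
        by (simp add: algebra_simps)
    qed
    moreover have "l1dist P G (\<lambda>e. G e - ?r e) < l1dist P G H"
    proof -
      have "l1dist P G (\<lambda>e. G e - ?r e) = (\<Sum>e\<in>P. \<bar>?r e\<bar>)"
        by (simp add: l1dist_def)
      also have "\<dots> \<le> (\<Sum>e\<in>P. \<bar>r e\<bar>) + 1" using r by (intro sum_shift) auto
      also have "\<dots> < l1dist P G H" using r conformal_dist[OF p] long by auto
      finally show ?thesis .
    qed
    moreover have "l1dist P (\<lambda>e. G e - ?r e) H < l1dist P G H"
    proof -
      have "l1dist P (\<lambda>e. G e - ?r e) H = (\<Sum>e\<in>P. \<bar>(D e - r e) + (-t) * chi ?c e\<bar>)"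
        by (simp add: l1dist_def D_def algebra_simps)
      also have "\<dots> \<le> (\<Sum>e\<in>P. \<bar>D e - r e\<bar>) + 1" using r by (intro sum_shift) auto
      also have "\<dots> < l1dist P G H" using r conformal_dist[OF p] long by auto
      finally show ?thesis .
    qed
    ultimately show False by (rule no_between)
  qed
  have add: "w p + (if G ?c = 1 then 1 else 0) > 0" if "G ?c \<le> 1"
    using excluded[of p "-1"] that GH_bounds[of ?c] cost_G by (auto simp: w_def split: if_splits)
  have remove: "w ?s - (if G ?c = 2 then 1 else 0) > 0" if "G ?c \<ge> 1"
    using excluded[of ?s 1] that GH_bounds[of ?c] cost_G by (auto simp: w_def split: if_splits)
  \<comment> \<open>Multiplicity one admits both candidates, and \<open>w p \<ge> 0\<close> with
    \<open>w ?s \<ge> 1\<close> contradicts \<open>w_convex\<close>. Multiplicity zero gives the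
    first pattern, two gives the second.\<close>
  consider "G ?c = 0" | "G ?c = 1" | "G ?c = 2" using GH_bounds[of ?c] by linarith
  then show ?thesis
    using add remove w_convex[OF p] by cases auto
qed

end

section \<open>Shape of the trail that traverses the whole difference\<close>

locale closed_trail_pair = closest_pair +
  fixes z :: "nat \<Rightarrow> 'a" and n :: nat
  assumes n: "n > 0" "even n" and periodic: "\<And>i. z (i + n) = z i"
    and edge_in: "\<And>i. trail_edge z i \<in> P"
    and edge_sign: "\<And>i. 0 < (-1) ^ i * D (trail_edge z i)"
    and part_D: "part z {..<n} = D"
begin

lemma edge_periodic: "trail_edge z (i + n) = trail_edge z i"
  using periodic[of i] periodic[of "Suc i"] by simp

lemma sign_periodic: "(-1::int) ^ (i + n) = (-1) ^ i"
  using n(2) by (simp add: power_add)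

text \<open>Neighbouring windows differ by an edge and its translate by a period, which agree in
  edge and sign.\<close>

lemma part_window: "part z {i..<i + n} e = D e"
proof (induction i)
  case 0
  then show ?case using part_D by (simp add: atLeast0LessThan)
next
  case (Suc i)
  have "part z {i..<Suc (i + n)} e = part z {i..<i + n} e + (-1) ^ i * chi (trail_edge z i) e"
    by (simp only: part_def sum.atLeastLessThan_Suc le_add1 edge_periodic sign_periodic)
  moreover have "part z {i..<Suc (i + n)} e
      = (-1) ^ i * chi (trail_edge z i) e + part z {Suc i..<Suc (i + n)} e"
    by (simp only: part_def sum.atLeast_Suc_lessThan[of i "Suc (i + n)"] less_Suc_eq_le le_add1)
  ultimately show ?case using Suc by simp
qed

text \<open>All visits to an edge carry the sign of \<open>D\<close> there, so nothing
  cancels.\<close>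

lemma part_eq_card:
  assumes "finite K"
  shows "part z K e = sgn (D e) * int (card {k \<in> K. trail_edge z k = e})"
proof -
  have "(-1) ^ k * chi (trail_edge z k) e = sgn (D e) * of_bool (trail_edge z k = e)" for k
    using edge_sign[of k] minus_one_power_cases[of k] by (auto simp: chi_def)
  then have "part z K e = sgn (D e) * (\<Sum>k\<in>K. of_bool (trail_edge z k = e))"
    by (simp add: part_def sum_distrib_left)
  also have "(\<Sum>k\<in>K. of_bool (trail_edge z k = e)) = int (card {k \<in> K. trail_edge z k = e})"
    using assms by (simp add: sum_of_bool_eq Collect_conj_eq)
  finally show ?thesis .
qed

lemma part_conformal:
  assumes "K \<subseteq> {i..<i + n}"
  shows "conformal (part z K) D"
  unfolding conformal_def
proof
  fix e
  have "card {k \<in> K. trail_edge z k = e} \<le> card {k \<in> {i..<i + n}. trail_edge z k = e}"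
    using assms by (intro card_mono) auto
  then show "0 \<le> part z K e \<and> part z K e \<le> D e \<or> D e \<le> part z K e \<and> part z K e \<le> 0"
    using part_eq_card[of "{i..<i + n}" e] part_eq_card[of K e] finite_subset[OF assms]
    by (auto simp: part_window sgn_if split: if_splits)
qed

lemma part_abs_sum:
  assumes "K \<subseteq> {i..<i + n}"
  shows "(\<Sum>e\<in>P. \<bar>part z K e\<bar>) = int (card K)"
proof -
  have fin: "finite K" using assms finite_subset by blast
  have "\<bar>part z K e\<bar> = int (card {k \<in> K. trail_edge z k = e})" for e
  proof (cases "D e = 0")
    case True
    then have "trail_edge z k \<noteq> e" for k using edge_sign[of k] by auto
    then show ?thesis using part_eq_card[OF fin, of e] True by simp
  qed (simp add: part_eq_card[OF fin] abs_mult)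
  then have "(\<Sum>e\<in>P. \<bar>part z K e\<bar>) = int (\<Sum>e\<in>P. card {k \<in> K. trail_edge z k = e})" by simp
  also have "(\<Sum>e\<in>P. card {k \<in> K. trail_edge z k = e}) = card K"
  proof -
    have "trail_edge z ` K \<subseteq> P" using edge_in by blast
    from sum_fun_comp[OF fin finP this, of "\<lambda>_. 1::nat"] show ?thesis by simp
  qed
  finally show ?thesis .
qed

lemma part_complement:
  assumes "K \<subseteq> {i..<i + n}"
  shows "part z ({i..<i + n} - K) = (\<lambda>e. D e - part z K e)"
proof
  fix e
  have "part z (K \<union> ({i..<i + n} - K)) e = part z K e + part z ({i..<i + n} - K) e"
    using assms by (intro part_union) (auto intro: finite_subset)
  moreover have "K \<union> ({i..<i + n} - K) = {i..<i + n}" using assms by auto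
  ultimately show "part z ({i..<i + n} - K) e = D e - part z K e" by (simp add: part_window)
qed

lemma no_closed_subtrail:
  assumes "K \<subseteq> {i..<i + n}" "\<And>v. edeg P (part z K) v = 0"
  shows "card K = 0 \<or> card K = n"
proof -
  have D_sum: "(\<Sum>e\<in>P. \<bar>D e\<bar>) = int n"
  proof -
    have "{..<n} \<subseteq> {0..<0 + n}" by auto
    from part_abs_sum[OF this] show ?thesis unfolding part_D card_lessThan .
  qed
  have K_sum: "(\<Sum>e\<in>P. \<bar>part z K e\<bar>) = int (card K)"
    using assms(1) by (rule part_abs_sum)
  from conformal_balanced_trivial[OF part_conformal[OF assms(1)] assms(2)] show ?thesis
  proof
    assume "\<forall>e\<in>P. part z K e = 0"
    then have "(\<Sum>e\<in>P. \<bar>part z K e\<bar>) = 0" by (intro sum.neutral) simp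
    then show ?thesis using K_sum by linarith
  next
    assume "\<forall>e\<in>P. part z K e = D e"
    then have "(\<Sum>e\<in>P. \<bar>part z K e\<bar>) = (\<Sum>e\<in>P. \<bar>D e\<bar>)" by (intro sum.cong) simp_all
    then show ?thesis using K_sum D_sum by linarith
  qed
qed

lemma edge_ends: "z i \<noteq> z (Suc i)"
  using looplessP edge_in[of i] by (auto simp: loopless_def add_eq_conv_ex)

text \<open>An even stretch from a vertex back to itself would be a closed alternating
  subtrail.\<close>

lemma revisit_odd:
  assumes "i < j" "j < i + n" "z i = z j"
  shows "odd (j - i)"
proof
  assume "even (j - i)"
  then have "(-1::int) ^ j = (-1) ^ i"
    using assms(1) by (metis le_add_diff_inverse less_imp_le minus_one_power_iff even_add)
  then have "edeg P (part z {i..<j}) v = 0" for v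
    using edeg_part_interval[OF finP, of i j z v] edge_in assms by simp
  then show False using no_closed_subtrail[of "{i..<j}" i] assms by auto
qed

text \<open>As both revisits have odd distance, the ends of \<open>{i..<j}\<close> and
  \<open>{k..<m}\<close> cancel: together they form a closed alternating subtrail that omits
  \<open>{j..<k}\<close>.\<close>

lemma revisits_not_interlaced:
  assumes "i < j" "j < k" "k < m" "m < n" "z i = z k" "z j = z m"
  shows False
proof -
  have sk: "(-1::int) ^ k = - ((-1) ^ i)"
    using revisit_odd[of i k] assms minus_one_power_cases[of k] minus_one_power_cases[of i] by auto
  have sm: "(-1::int) ^ m = - ((-1) ^ j)"
    using revisit_odd[of j m] assms minus_one_power_cases[of m] minus_one_power_cases[of j] by auto
  let ?K = "{i..<j} \<union> {k..<m}"
  have "part z ?K = (\<lambda>e. part z {i..<j} e + part z {k..<m} e)"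
    using assms by (intro ext part_union) auto
  then have "edeg P (part z ?K) v = 0" for v
    using edeg_part_interval[OF finP, of i j z v] edeg_part_interval[OF finP, of k m z v]
      edge_in assms sk sm by (simp add: edeg_add)
  moreover have "card ?K = (j - i) + (m - k)"
    using assms by (subst card_Un_disjoint) auto
  ultimately show False using no_closed_subtrail[of ?K 0] assms by auto
qed

definition once :: "nat \<Rightarrow> bool" where
  "once r \<longleftrightarrow> (\<forall>k. r < k \<and> k < r + n \<longrightarrow> z k \<noteq> z r)"

lemma onceI:
  assumes "r < n" "\<And>k. k < n \<Longrightarrow> k \<noteq> r \<Longrightarrow> z k \<noteq> z r"
  shows "once r"
  unfolding once_def
proof (intro allI impI)
  fix k assume k: "r < k \<and> k < r + n"
  show "z k \<noteq> z r"
  proof (cases "k < n")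
    case False
    then have "z k = z (k - n)" using periodic[of "k - n"] by simp
    moreover have "k - n < n" "k - n \<noteq> r" using k assms(1) False by linarith+
    ultimately show ?thesis using assms(2)[of "k - n"] by simp
  qed (use assms(2) k in auto)
qed

lemma once_if_distinct:
  assumes "\<And>i j. i < j \<Longrightarrow> j < n \<Longrightarrow> z i \<noteq> z j" "r < n"
  shows "once r"
proof (rule onceI)
  show "z k \<noteq> z r" if "k < n" "k \<noteq> r" for k
    using assms(1)[of k r] assms(1)[of r k] assms(2) that by (cases "k < r") auto
qed fact

text \<open>Take a shortest revisit: a second visit to one of its interior vertices would give a
  shorter revisit or interlace with it. Its length is odd and not 1, so there are at least two
  interior vertices.\<close>

lemma ex_adjacent_once:
  assumes "n \<ge> 2"
  shows "\<exists>r. once r \<and> once (Suc r)"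
proof (cases "\<exists>i j. i < j \<and> j < n \<and> z i = z j")
  case False
  then have "once 0" "once (Suc 0)" using assms by (auto intro!: once_if_distinct)
  then show ?thesis by blast
next
  case True
  define Q where "Q l \<longleftrightarrow> (\<exists>i. 0 < l \<and> i + l < n \<and> z i = z (i + l))" for l
  obtain i j where "i < j" "j < n" "z i = z j" using True by blast
  then have "Q (j - i)" unfolding Q_def by (intro exI[of _ i]) auto
  then have Ql: "Q (LEAST l. Q l)" by (rule LeastI)
  define l where "l = (LEAST l. Q l)"
  have least: "\<not> (i < j \<and> j < n \<and> z i = z j)" if "j - i < l" for i j
  proof
    assume ij: "i < j \<and> j < n \<and> z i = z j"
    then have "Q (j - i)" unfolding Q_def by (intro exI[of _ i]) auto
    then show False using that not_less_Least[of "j - i" Q] by (simp add: l_def)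
  qed
  obtain i where i: "0 < l" "i + l < n" "z i = z (i + l)" using Ql by (auto simp: Q_def l_def)
  have "odd l" using revisit_odd[of i "i + l"] i by simp
  moreover have "l \<noteq> 1" using edge_ends[of i] i by auto
  ultimately have l: "l \<ge> 3" by (cases l) (auto elim!: oddE)
  have interior: "once r" if r: "i < r" "r < i + l" for r
  proof (rule onceI)
    fix k assume k: "k < n" "k \<noteq> r"
    show "z k \<noteq> z r"
    proof
      assume eq: "z k = z r"
      consider "k < i" | "i \<le> k" "k < r" | "r < k" "k \<le> i + l" | "i + l < k" using k by linarith
      then show False
      proof cases
        case 1
        then show False using revisits_not_interlaced[of k i r "i + l"] eq i r by simp
      next
        case 2
        then have "r - k < l" "r < n" using i r by linarith+
        then show False using least[of r k] 2 eq by auto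
      next
        case 3
        then have "k - r < l" using r by linarith
        then show False using least[of k r] 3 eq k by auto
      next
        case 4
        then show False using revisits_not_interlaced[of i r "i + l" k] eq i r k by simp
      qed
    qed
  qed (use i r in auto)
  have "once (Suc i)" "once (Suc (Suc i))" using l by (auto intro!: interior)
  then show ?thesis by blast
qed

section \<open>Change of the cost along the trail\<close>

lemma w_insert:
  assumes "finite K" "k \<notin> K"
  shows "w (part z (insert k K)) = w (part z K) +
    (max 0 (G (trail_edge z k) - part z K (trail_edge z k) - (-1) ^ k - 1) -
     max 0 (G (trail_edge z k) - part z K (trail_edge z k) - 1))"
proof -
  have "(\<lambda>e. G e - part z (insert k K) e)
      = (\<lambda>e. (G e - part z K e) + (- ((-1) ^ k)) * chi (trail_edge z k) e)"
    using assms by (auto simp: part_def fun_eq_iff)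
  then show ?thesis
    by (simp only: w_def cost_add_chi[OF finP edge_in])
qed

text \<open>Even positions remove an edge, odd ones add one, so the direction of the change is known
  and its size is at most one.\<close>

lemma w_insert_bounds:
  assumes "finite K" "k \<notin> K"
  shows "even k \<Longrightarrow> w (part z K) - 1 \<le> w (part z (insert k K)) \<and> w (part z (insert k K)) \<le> w (part z K)"
    "odd k \<Longrightarrow> w (part z K) \<le> w (part z (insert k K)) \<and> w (part z (insert k K)) \<le> w (part z K) + 1"
  using w_insert[OF assms] by auto

lemma G_edge:
  shows "even k \<Longrightarrow> G (trail_edge z k) = 1 \<or> G (trail_edge z k) = 2"
    "odd k \<Longrightarrow> G (trail_edge z k) = 0 \<or> G (trail_edge z k) = 1"
  using edge_sign[of k] GH_bounds[of "trail_edge z k"] unfolding D_def by auto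

text \<open>\<open>W\<close> ranges from -2 to 1 for even \<open>k0\<close> and from -1 to 2 for odd
  \<open>k0\<close>. The values tested are the ends of this range, so \<open>k0\<close> and
  \<open>k1\<close> contribute as much as they can; for \<open>k2\<close> the bound of one unit is
  enough.\<close>

lemma w_three:
  assumes k: "even k0 = even k2" "even k0 \<noteq> even k1" "k0 \<noteq> k2"
  defines "W \<equiv> w (part z {k0, k1, k2})"
  shows "even k0 \<Longrightarrow> W \<ge> 1 \<Longrightarrow> G (trail_edge z k0) = 1 \<and> G (trail_edge z k1) = 1"
    "even k0 \<Longrightarrow> W \<le> -2 \<Longrightarrow> G (trail_edge z k0) = 2 \<and> G (trail_edge z k1) = 0"
    "odd k0 \<Longrightarrow> W \<le> -1 \<Longrightarrow> G (trail_edge z k0) = 0 \<and> G (trail_edge z k1) = 2"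
    "odd k0 \<Longrightarrow> W \<ge> 2 \<Longrightarrow> G (trail_edge z k0) = 1 \<and> G (trail_edge z k1) = 1"
proof -
  let ?e0 = "trail_edge z k0" and ?e1 = "trail_edge z k1"
  have ne: "?e1 \<noteq> ?e0"
  proof
    assume eq: "?e1 = ?e0"
    have "0 < (-1) ^ k1 * D ?e0" using edge_sign[of k1] unfolding eq .
    then show False using edge_sign[of k0] k(2) by (cases "even k0") auto
  qed
  have k': "k0 \<noteq> k1" "k2 \<noteq> k1" using k by auto
  have "w (part z {}) = 0" by (simp add: w_def part_def)
  then have w0: "w (part z {k0}) = max 0 (G ?e0 - (-1) ^ k0 - 1) - max 0 (G ?e0 - 1)"
    using w_insert[of "{}" k0] by (simp add: part_def)
  have "part z {k0} ?e1 = 0" using ne by (simp add: part_def chi_def)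
  then have w1: "w (part z {k1, k0}) = w (part z {k0}) + (max 0 (G ?e1 - (-1) ^ k1 - 1) - max 0 (G ?e1 - 1))"
    using w_insert[of "{k0}" k1] k' by simp
  have set_eq: "{k0, k1, k2} = insert k2 {k1, k0}" by auto
  have w2: "even k0 \<Longrightarrow> w (part z {k1, k0}) - 1 \<le> W \<and> W \<le> w (part z {k1, k0})"
    "odd k0 \<Longrightarrow> w (part z {k1, k0}) \<le> W \<and> W \<le> w (part z {k1, k0}) + 1"
    using w_insert_bounds[of "{k1, k0}" k2] k k' unfolding W_def set_eq by auto
  show "G ?e0 = 1 \<and> G ?e1 = 1" if k0: "even k0" and W: "W \<ge> 1"
    using w0 w1 w2(1)[OF k0] W k k0 G_edge(1)[OF k0] G_edge(2)[of k1] by auto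
  show "G ?e0 = 2 \<and> G ?e1 = 0" if k0: "even k0" and W: "W \<le> -2"
    using w0 w1 w2(1)[OF k0] W k k0 G_edge(1)[OF k0] G_edge(2)[of k1] by auto
  show "G ?e0 = 0 \<and> G ?e1 = 2" if k0: "odd k0" and W: "W \<le> -1"
    using w0 w1 w2(2)[OF k0] W k k0 G_edge(2)[OF k0] G_edge(1)[of k1] by auto
  show "G ?e0 = 1 \<and> G ?e1 = 1" if k0: "odd k0" and W: "W \<ge> 2"
    using w0 w1 w2(2)[OF k0] W k k0 G_edge(2)[OF k0] G_edge(1)[of k1] by auto
qed

text \<open>A trail edge equal to the chord would use the only visit to \<open>z r\<close>. Then
  \<open>z (r + j)\<close> would also be the vertex just after or just before \<open>z r\<close>, a
  revisit at even distance.\<close>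

lemma chord_off_D:
  assumes r: "once r" and j: "odd j" "3 \<le> j" "j + 3 \<le> n"
  shows "z r \<noteq> z (r + j)" "{#z r, z (r + j)#} \<in> P" "D {#z r, z (r + j)#} = 0"
proof -
  show ne: "z r \<noteq> z (r + j)" 
  proof -
    have "r < r + j" "r + j < r + n" using j by auto
    then show ?thesis using r unfolding once_def by metis
  qed
  show "{#z r, z (r + j)#} \<in> P"
    using all_pairs[OF edge_in edge_in _ _ ne, of r "r + j"] by simp
  show "D {#z r, z (r + j)#} = 0"
  proof (rule ccontr)
    let ?c = "{#z r, z (r + j)#}"
    assume "D ?c \<noteq> 0"
    then have "part z {r..<r + n} ?c \<noteq> 0" by (simp only: part_window not_False_eq_True)
    then obtain k where k: "k \<in> {r..<r + n}" "chi (trail_edge z k) ?c \<noteq> 0"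
      unfolding part_def by (metis (no_types, lifting) mult_zero_right sum.neutral)
    then have "trail_edge z k = ?c" by (auto simp: chi_def split: if_splits)
    then consider "z k = z r" "z (Suc k) = z (r + j)" | "z (Suc k) = z r" "z k = z (r + j)"
      using ne by (auto simp: add_eq_conv_ex)
    then show False
    proof cases
      case 1
      have "k = r"
      proof (rule ccontr)
        assume "k \<noteq> r"
        then have "r < k" "k < r + n" using k by auto
        then show False using r 1 unfolding once_def by blast
      qed
      then show False using revisit_odd[of "Suc r" "r + j"] 1 j by auto
    next
      case 2
      have "Suc k = r + n"
      proof (rule ccontr)
        assume "Suc k \<noteq> r + n"
        then have "r < Suc k" "Suc k < r + n" using k by auto
        then show False using r 2 unfolding once_def by blast
      qed
      then have "k - (r + j) = n - 1 - j" "r + j < k" "k < r + j + n" using j by linarith+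
      moreover have "even (n - 1 - j)" using j n(2) by simp
      ultimately show False using revisit_odd[of "r + j" k] 2(2)[symmetric] by metis
    qed
  qed
qed

text \<open>Which of the two cost patterns occurs cannot change while the far end of the chord moves along
  the trail, as each move changes the cost by at most one.\<close>

lemma w_prefix_pattern:
  assumes r: "once r" and j: "odd j" "3 \<le> j" "j + 3 \<le> n"
  shows "even r \<Longrightarrow> w (part z {r..<r + j}) \<ge> 1 \<and> w (part z {r + j..<r + n}) \<le> -1 \<or>
      w (part z {r..<r + j}) \<le> -2 \<and> w (part z {r + j..<r + n}) \<ge> 2"
    "odd r \<Longrightarrow> w (part z {r + j..<r + n}) \<ge> 1 \<and> w (part z {r..<r + j}) \<le> -1 \<or>
      w (part z {r + j..<r + n}) \<le> -2 \<and> w (part z {r..<r + j}) \<ge> 2"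
proof -
  let ?p = "part z {r..<r + j}" and ?s = "part z {r + j..<r + n}"
  have sub: "{r..<r + j} \<subseteq> {r..<r + n}" "{r + j..<r + n} \<subseteq> {r..<r + n}" using j by auto
  have "{r..<r + n} - {r..<r + j} = {r + j..<r + n}" using j by auto
  then have s: "?s = (\<lambda>e. D e - ?p e)" using part_complement[OF sub(1)] by metis
  then have p: "?p = (\<lambda>e. D e - ?s e)" by auto
  \<comment> \<open>A stretch of odd length has the same sign at both ends: for even
    \<open>r\<close> the prefix, for odd \<open>r\<close> the suffix takes the place of
    \<open>p\<close> in \<open>chord\<close>.\<close>
  have deg: "edeg P ?p v = (-1) ^ r * (of_bool (z r = v) + of_bool (z (r + j) = v))" for v
    using edeg_part_interval[OF finP, of r "r + j" z v] edge_in j(1) by (simp add: power_add)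
  have deg_s: "edeg P ?s v = - edeg P ?p v" for v
    unfolding s edeg_diff edeg_D by simp
  have long: "2 \<le> (\<Sum>e\<in>P. \<bar>?p e\<bar>)" "2 \<le> (\<Sum>e\<in>P. \<bar>?s e\<bar>)"
    using part_abs_sum[OF sub(1)] part_abs_sum[OF sub(2)] j by auto
  note c = chord_off_D[OF assms]
  show "w ?p \<ge> 1 \<and> w ?s \<le> -1 \<or> w ?p \<le> -2 \<and> w ?s \<ge> 2" if "even r"
  proof -
    have "edeg P ?p v = of_bool (z r = v) + of_bool (z (r + j) = v)" for v
      using deg[of v] that by simp
    moreover have "2 \<le> (\<Sum>e\<in>P. \<bar>D e - ?p e\<bar>)" using long(2) by (simp only: fun_cong[OF s])
    ultimately have "w ?p \<ge> 1 \<and> w (\<lambda>e. D e - ?p e) \<le> -1 \<or> w ?p \<le> -2 \<and> w (\<lambda>e. D e - ?p e) \<ge> 2"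
      by (intro chord[OF part_conformal[OF sub(1)] _ c(2,3) long(1)])
    then show ?thesis
      unfolding s[symmetric] .
  qed
  show "w ?s \<ge> 1 \<and> w ?p \<le> -1 \<or> w ?s \<le> -2 \<and> w ?p \<ge> 2" if "odd r"
  proof -
    have "edeg P ?s v = of_bool (z r = v) + of_bool (z (r + j) = v)" for v
      using deg[of v] deg_s[of v] that by simp
    moreover have "2 \<le> (\<Sum>e\<in>P. \<bar>D e - ?s e\<bar>)" using long(1) by (simp only: fun_cong[OF p])
    ultimately have "w ?s \<ge> 1 \<and> w (\<lambda>e. D e - ?s e) \<le> -1 \<or> w ?s \<le> -2 \<and> w (\<lambda>e. D e - ?s e) \<ge> 2"
      by (intro chord[OF part_conformal[OF sub(2)] _ c(2,3) long(2)])
    then show ?thesis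
      unfolding p[symmetric] .
  qed
qed

text \<open>Of two consecutive positions, one can only lower the count, the other only raise it,
  each by at most one.\<close>

lemma w_prefix_step:
  "\<bar>w (part z {r..<r + (j + 2)}) - w (part z {r..<r + j})\<bar> \<le> 1"
proof -
  have "{r..<r + (j + 2)} = insert (Suc (r + j)) (insert (r + j) {r..<r + j})" by auto
  then show ?thesis
    using w_insert_bounds[of "{r..<r + j}" "r + j"]
      w_insert_bounds[of "insert (r + j) {r..<r + j}" "Suc (r + j)"]
    by (cases "even (r + j)") auto
qed

text \<open>The prefix cost is at least 1 or at most -2 for even \<open>r\<close>, and at least 2 or
  at most -1 for odd \<open>r\<close>; \<open>w_prefix_step\<close> is too small to cross the
  gap.\<close>

lemma w_prefix_constant:
  assumes r: "once r" and "2 * i + 6 \<le> n"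
  shows "w (part z {r..<r + (2 * i + 3)}) \<ge> 1 \<longleftrightarrow> w (part z {r..<r + 3}) \<ge> 1"
  using assms(2)
proof (induction i)
  case 0
  then show ?case by simp
next
  case (Suc i)
  let ?w = "\<lambda>j. w (part z {r..<r + j})"
  have step: "\<bar>?w (2 * Suc i + 3) - ?w (2 * i + 3)\<bar> \<le> 1"
    using w_prefix_step[of r "2 * i + 3"] by (simp add: algebra_simps)
  have j: "odd (2 * l + 3)" "3 \<le> 2 * l + 3" for l :: nat by auto
  have le: "2 * i + 3 + 3 \<le> n" "2 * Suc i + 3 + 3 \<le> n" using Suc.prems by auto
  have "?w (2 * Suc i + 3) \<ge> 1 \<longleftrightarrow> ?w (2 * i + 3) \<ge> 1"
  proof (cases "even r")
    case True
    show ?thesis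
      using w_prefix_pattern(1)[OF r j le(1) True] w_prefix_pattern(1)[OF r j le(2) True] step
      by linarith
  next
    case False
    show ?thesis
      using w_prefix_pattern(2)[OF r j le(1) False] w_prefix_pattern(2)[OF r j le(2) False] step
      by linarith
  qed
  then show ?case using Suc by simp
qed

text \<open>The shortest prefix consists of the three edges after \<open>z r\<close>; the longest
  leaves as suffix the three edges before it. Since both show the same pattern,
  \<open>w_three\<close> reads off both sides of \<open>z r\<close> together.\<close>

lemma once_edges:
  assumes r: "once r" and n6: "6 \<le> n"
  defines "a \<equiv> G (trail_edge z r)" and "b \<equiv> G (trail_edge z (Suc r))"
    and "c \<equiv> G (trail_edge z (r + n - 1))"
  shows "even r \<Longrightarrow> a = 1 \<and> b = 1 \<and> c = 0 \<or> a = 2 \<and> b = 0 \<and> c = 1"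
    "odd r \<Longrightarrow> a = 0 \<and> b = 2 \<and> c = 1 \<or> a = 1 \<and> b = 1 \<and> c = 2"
proof -
  obtain i where i: "n = 2 * i + 6"
  proof -
    obtain l where "n = 2 * l" using n(2) by (auto elim: evenE)
    then show thesis using n6 by (intro that[of "l - 3"]) auto
  qed
  let ?S = "w (part z {r + (n - 3)..<r + n})"
  have const: "w (part z {r..<r + (n - 3)}) \<ge> 1 \<longleftrightarrow> w (part z {r..<r + 3}) \<ge> 1"
    using w_prefix_constant[OF r, of i] by (simp add: i add.commute)
  have first: "{r..<r + 3} = {r, Suc r, Suc (Suc r)}" by auto
  have last: "{r + (n - 3)..<r + n} = {r + n - 1, r + n - 2, r + n - 3}" using n6 by auto
  have par: "even (r + n - 1) \<longleftrightarrow> odd r" "even (r + n - 2) \<longleftrightarrow> even r" "even (r + n - 3) \<longleftrightarrow> odd r"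
    unfolding i by auto
  note three = w_three[of r "Suc (Suc r)" "Suc r", folded first a_def b_def]
    and three' = w_three[of "r + n - 1" "r + n - 3" "r + n - 2", folded last c_def]
  have ne: "r + n - 1 \<noteq> r + n - 3" using n6 by linarith
  show "a = 1 \<and> b = 1 \<and> c = 0 \<or> a = 2 \<and> b = 0 \<and> c = 1" if "even r"
  proof (cases "w (part z {r..<r + 3}) \<ge> 1")
    case True
    then have "?S \<le> -1" using w_prefix_pattern(1)[OF r, of "n - 3"] const that n6 n(2) by auto
    then show ?thesis using three(1) three'(3) True that par ne by simp
  next
    case False
    then have "w (part z {r..<r + 3}) \<le> -2" "?S \<ge> 2"
      using w_prefix_pattern(1)[OF r, of "n - 3"] w_prefix_pattern(1)[OF r, of 3] const that n6 n(2)
      by auto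
    then show ?thesis using three(2) three'(4) that par ne by simp
  qed
  show "a = 0 \<and> b = 2 \<and> c = 1 \<or> a = 1 \<and> b = 1 \<and> c = 2" if "odd r"
  proof (cases "w (part z {r..<r + 3}) \<ge> 1")
    case True
    then have "w (part z {r..<r + 3}) \<ge> 2" "?S \<le> -2"
      using w_prefix_pattern(2)[OF r, of "n - 3"] w_prefix_pattern(2)[OF r, of 3] const that n6 n(2)
      by auto
    then show ?thesis using three(4) three'(2) that par ne by simp
  next
    case False
    then have "w (part z {r..<r + 3}) \<le> -1" "?S \<ge> 1"
      using w_prefix_pattern(2)[OF r, of "n - 3"] w_prefix_pattern(2)[OF r, of 3] const that n6 n(2)
      by auto
    then show ?thesis using three(3) three'(1) that par ne by simp
  qed
qed

lemma trail_length: "n = 4"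
proof (rule ccontr)
  assume "n \<noteq> 4"
  have "n \<noteq> 2"
  proof
    assume "n = 2"
    then have "trail_edge z 1 = trail_edge z 0"
      using periodic[of 0] by (simp add: add_mset_commute numeral_2_eq_2)
    then have "0 < (-1) ^ 1 * D (trail_edge z 0)" using edge_sign[of 1] by (simp only:)
    then show False using edge_sign[of 0] by simp
  qed
  then have n6: "n \<ge> 6" using n \<open>n \<noteq> 4\<close> by (auto elim!: evenE)
  then obtain r where r: "once r" "once (Suc r)" using ex_adjacent_once by auto
  \<comment> \<open>For even \<open>r\<close>, the first vertex forces multiplicities (1,1) or (2,0)
    at positions \<open>r\<close> and \<open>Suc r\<close>, the second forces (1,0) or (2,1). For
    odd \<open>r\<close> it is (0,2) or (1,1) against (0,1) or (1,2).\<close>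
  have "trail_edge z (Suc r + n - 1) = trail_edge z r" using edge_periodic[of r] by simp
  then show False
    using once_edges[OF r(1) n6] once_edges[OF r(2) n6] by (cases "even r") auto
qed

lemma difference_is_swap:
  "G e - H e = chi {#z 0, z 1#} e - chi {#z 1, z 2#} e + chi {#z 2, z 3#} e - chi {#z 3, z 0#} e"
proof -
  have "{..<n} = {0, 1, 2, 3}" using trail_length by auto
  moreover have "z 4 = z 0" using periodic[of 0] trail_length by simp
  ultimately have "part z {..<n} e
      = chi {#z 0, z 1#} e - chi {#z 1, z 2#} e + chi {#z 2, z 3#} e - chi {#z 3, z 0#} e"
    by (simp add: part_def eval_nat_numeral)
  then show ?thesis by (simp add: part_D D_def)
qed

end

section \<open>Connectivity under edge swaps\<close>

lemma (in closest_pair) difference_is_swap: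
  assumes "G \<noteq> H"
  shows "\<exists>x y u v. \<forall>e. G e - H e = chi {#x, y#} e - chi {#y, u#} e + chi {#u, v#} e - chi {#v, x#} e"
proof -
  obtain e where e: "e \<in> P" "D e \<noteq> 0" using assms off_P by (auto simp: D_def fun_eq_iff) metis
  obtain z n where zn: "n > 0" "even n" "\<And>i. z (i + n) = z i" "\<And>i. trail_edge z i \<in> P"
    "\<And>i. 0 < (-1) ^ i * D (trail_edge z i)" and conf: "conformal (part z {..<n}) D"
    using periodic_closed_trail[OF finP looplessP edeg_D e] by metis
  have bal: "edeg P (part z {..<n}) v = 0" for v
    using edeg_part_interval[OF finP, of 0 n z v] zn(2,4) zn(3)[of 0] by (simp add: atLeast0LessThan)
  have "part z {..<n} = D"
  proof -
    let ?t = "trail_edge z 0"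
    have sgn: "0 \<le> (-1) ^ k * chi (trail_edge z k) ?t" for k
    proof (cases "trail_edge z k = ?t")
      case True
      then have "0 < (-1) ^ k * D ?t" using zn(5)[of k] by simp
      then show ?thesis using zn(5)[of 0] minus_one_power_cases[of k] by (auto simp: chi_def)
    qed (auto simp: chi_def)
    have "0 < part z {..<n} ?t"
      unfolding part_def using zn(1) sgn by (intro sum_pos2[of _ 0]) (auto simp: chi_def)
    then have "\<forall>e\<in>P. part z {..<n} e = D e"
      using conformal_balanced_trivial[OF conf bal] zn(4)[of 0] by fastforce
    moreover have "part z {..<n} e = D e" if "e \<notin> P" for e
      using conformal_bounds(5)[OF conf that] off_P[OF that] by (simp add: D_def)
    ultimately show ?thesis by (auto simp: fun_eq_iff)
  qed
  then interpret closed_trail_pair P d q G H z n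
    using zn by unfold_locales auto
  show ?thesis using difference_is_swap by blast
qed

text \<open>The four vertices need not be distinct, so a pair with \<open>G = H\<close> is included;
  \<open>lift_edge_swap\<close> treats it apart.\<close>

definition edge_swap :: "'v multiset set \<Rightarrow> ('v \<Rightarrow> int) \<Rightarrow> int \<Rightarrow> (('v multiset \<Rightarrow> int) \<times> ('v multiset \<Rightarrow> int)) set" where
  "edge_swap P d q = {(G, H). G \<in> gspace P d q \<and> H \<in> gspace P d q \<and>
     (\<exists>x y u v. \<forall>e. G e - H e = chi {#x, y#} e - chi {#y, u#} e + chi {#u, v#} e - chi {#v, x#} e)}"

lemma sym_edge_swap: "sym (edge_swap P d q)"
proof (rule symI)
  fix G H assume "(G, H) \<in> edge_swap P d q"
  then obtain x y u v where GH: "G \<in> gspace P d q" "H \<in> gspace P d q"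
    and eq: "\<And>e. G e - H e = chi {#x, y#} e - chi {#y, u#} e + chi {#u, v#} e - chi {#v, x#} e"
    unfolding edge_swap_def by blast
  have "H e - G e = chi {#y, u#} e - chi {#u, v#} e + chi {#v, x#} e - chi {#x, y#} e" for e
    using eq[of e] by linarith
  then show "(H, G) \<in> edge_swap P d q" using GH unfolding edge_swap_def by blast
qed

theorem edge_swaps_connect:
  assumes P: "finite P" "loopless P"
    "\<And>e f x y. e \<in> P \<Longrightarrow> f \<in> P \<Longrightarrow> x \<in># e \<Longrightarrow> y \<in># f \<Longrightarrow> x \<noteq> y \<Longrightarrow> {#x, y#} \<in> P"
    and "G \<in> gspace P d q" "H \<in> gspace P d q"
  shows "(G, H) \<in> (edge_swap P d q)\<^sup>*"
  using assms(4,5)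
proof (induction "nat (l1dist P G H)" arbitrary: G H rule: less_induct)
  case less
  have sym: "(K, L) \<in> (edge_swap P d q)\<^sup>* \<longleftrightarrow> (L, K) \<in> (edge_swap P d q)\<^sup>*" for K L
    using sym_rtrancl[OF sym_edge_swap] by (metis symE)
  \<comment> \<open>Stated for a separate pair at the same distance, because it is applied in
    whichever order puts the larger cost first.\<close>
  have step: "(G', H') \<in> (edge_swap P d q)\<^sup>*"
    if in_space: "G' \<in> gspace P d q" "H' \<in> gspace P d q" and le: "cost P H' \<le> cost P G'"
      and dist: "l1dist P G' H' = l1dist P G H" for G' H'
  proof (rule ccontr)
    assume unconnected: "(G', H') \<notin> (edge_swap P d q)\<^sup>*"
    interpret closest_pair P d q G' H'
    proof
      fix K assume K: "K \<in> gspace P d q" "l1dist P G' K < l1dist P G' H'" "l1dist P K H' < l1dist P G' H'"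
      moreover have "0 < l1dist P G H" using K(2) l1dist_nonneg[of P G' K] dist by linarith
      ultimately have "(G', K) \<in> (edge_swap P d q)\<^sup>*" "(K, H') \<in> (edge_swap P d q)\<^sup>*"
        using less.hyps[of G' K] less.hyps[of K H'] in_space l1dist_nonneg[of P] dist
        by (simp_all add: zless_nat_conj nat_less_eq_zless)
      then have "(G', H') \<in> (edge_swap P d q)\<^sup>*" by (rule rtrancl_trans)
      then show False using unconnected by contradiction
    qed (use P in_space le in auto)
    have "G' \<noteq> H'" using unconnected by auto
    then have "(G', H') \<in> edge_swap P d q"
      using difference_is_swap in_space unfolding edge_swap_def by blast
    then show False using unconnected by blast
  qed
  show ?case
  proof (cases "cost P H \<le> cost P G")
    case True
    then show ?thesis using step less.prems by blast
  next
    case False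
    then have "(H, G) \<in> (edge_swap P d q)\<^sup>*"
      using step[of H G] less.prems l1dist_commute[of P G H] by simp
    then show ?thesis using sym by blast
  qed
qed

section \<open>Two-coloured simple graphs\<close>

definition cls :: "(bool \<times> 'e) set \<Rightarrow> bool \<Rightarrow> 'e set" where
  "cls A \<kappa> = {e. (\<kappa>, e) \<in> A}"

definition emult :: "(bool \<times> 'e) set \<Rightarrow> 'e \<Rightarrow> int" where
  "emult A e = of_bool ((True, e) \<in> A) + of_bool ((False, e) \<in> A)"

text \<open>The colours stand for the two tail vertices. A set of coloured edges builds in that
  parallel edges differ in colour, that is, the absence of multi-hyperarcs; \<open>N\<close> records
  the out-degrees and \<open>d\<close> the in-degrees.\<close>

definition cspace :: "'v multiset set \<Rightarrow> ('v \<Rightarrow> int) \<Rightarrow> (bool \<Rightarrow> nat) \<Rightarrow> (bool \<times> 'v multiset) set set" where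
  "cspace P d N = {A. snd ` A \<subseteq> P \<and> (\<forall>v. edeg P (emult A) v = d v) \<and> (\<forall>\<kappa>. card (cls A \<kappa>) = N \<kappa>)}"

definition replace_pair ::
  "(bool \<times> 'e) set \<Rightarrow> bool \<times> 'e \<Rightarrow> bool \<times> 'e \<Rightarrow> bool \<times> 'e \<Rightarrow> bool \<times> 'e \<Rightarrow> (bool \<times> 'e) set" where
  "replace_pair A a b a' b' = A - {a, b} \<union> {a', b'}"

text \<open>The trace of a shuffle that keeps the tails and redistributes the heads. Exchanging two
  tails is covered as well, since it amounts to exchanging the two heads.\<close>

definition cmove :: "'v multiset set \<Rightarrow> ('v \<Rightarrow> int) \<Rightarrow> (bool \<Rightarrow> nat) \<Rightarrow>
    ((bool \<times> 'v multiset) set \<times> (bool \<times> 'v multiset) set) set" where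
  "cmove P d N = {(A, B). A \<in> cspace P d N \<and> B \<in> cspace P d N \<and>
     (\<exists>\<kappa> \<mu> e f e' f'. (\<kappa>, e) \<in> A \<and> (\<mu>, f) \<in> A \<and> (\<kappa>, e) \<noteq> (\<mu>, f) \<and> e + f = e' + f' \<and>
        B = replace_pair A (\<kappa>, e) (\<mu>, f) (\<kappa>, e') (\<mu>, f'))}"

definition single :: "(bool \<times> 'e) set \<Rightarrow> bool \<Rightarrow> 'e set" where
  "single A \<kappa> = {e. (\<kappa>, e) \<in> A \<and> (\<not> \<kappa>, e) \<notin> A}"

lemma finite_cls: "finite P \<Longrightarrow> snd ` A \<subseteq> P \<Longrightarrow> finite (cls A \<kappa>)"
  by (rule finite_subset[of _ P]) (auto simp: cls_def)

lemma emult_off: "snd ` A \<subseteq> P \<Longrightarrow> e \<notin> P \<Longrightarrow> emult A e = 0"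
  by (auto simp: emult_def)

lemma emult_single: "e \<in> single A \<kappa> \<Longrightarrow> emult A e = 1"
  by (cases \<kappa>) (auto simp: emult_def single_def)

lemma emult_cases:
  "(emult A e = 0 \<and> (\<forall>\<kappa>. (\<kappa>, e) \<notin> A)) \<or> (emult A e = 1 \<and> (\<exists>\<kappa>. e \<in> single A \<kappa>)) \<or>
   (emult A e = 2 \<and> (\<forall>\<kappa>. (\<kappa>, e) \<in> A))"
  by (auto simp: emult_def single_def all_bool_eq ex_bool_eq)

lemma emult_ge_1_cases:
  assumes "1 \<le> emult A e"
  obtains "e \<in> single A \<kappa>" "e \<notin> single A (\<not> \<kappa>)" "emult A e = 1"
  | "e \<notin> single A \<kappa>" "e \<in> single A (\<not> \<kappa>)" "emult A e = 1"
  | "e \<notin> single A \<kappa>" "e \<notin> single A (\<not> \<kappa>)" "(\<kappa>, e) \<in> A" "(\<not> \<kappa>, e) \<in> A" "emult A e = 2"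
  using assms by (cases \<kappa>; cases "(True, e) \<in> A"; cases "(False, e) \<in> A"; simp add: emult_def single_def)

text \<open>Each class consists of its single edges and all double edges. This ties the bound on
  double edges to the supply of edges that can be recoloured.\<close>

lemma card_single:
  assumes "finite P" "snd ` A \<subseteq> P"
  shows "int (card (cls A \<kappa>)) = int (card (single A \<kappa>)) + cost P (emult A)"
proof -
  let ?B = "{e. (True, e) \<in> A \<and> (False, e) \<in> A}"
  have fin: "finite (single A \<kappa>)" "finite ?B"
    using assms by (auto simp: single_def intro!: finite_subset[of _ P])
  have "cls A \<kappa> = single A \<kappa> \<union> ?B" "single A \<kappa> \<inter> ?B = {}"
    by (cases \<kappa>; auto simp: cls_def single_def)+
  then have "card (cls A \<kappa>) = card (single A \<kappa>) + card ?B"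
    using fin by (simp add: card_Un_disjoint)
  moreover have "cost P (emult A) = int (card ?B)"
  proof -
    have "cost P (emult A) = (\<Sum>e\<in>P. of_bool (e \<in> ?B))"
      unfolding cost_def emult_def by (intro sum.cong) auto
    also have "\<dots> = int (card (P \<inter> ?B))" using assms(1) by (simp add: sum_of_bool_eq)
    also have "P \<inter> ?B = ?B" using assms(2) by auto
    finally show ?thesis .
  qed
  ultimately show ?thesis by simp
qed

lemma card_cls_replace:
  assumes "finite (cls A \<kappa>)" "(\<kappa>, e) \<in> A" "(\<kappa>, e') \<notin> A"
  shows "card (cls (insert (\<kappa>, e') (A - {(\<kappa>, e)})) \<mu>) = card (cls A \<mu>)"
proof (cases "\<mu> = \<kappa>")
  case True
  have "cls (insert (\<kappa>, e') (A - {(\<kappa>, e)})) \<kappa> = insert e' (cls A \<kappa> - {e})"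
    using assms by (auto simp: cls_def)
  moreover have "e \<in> cls A \<kappa>" "e' \<notin> cls A \<kappa>" using assms by (auto simp: cls_def)
  ultimately show ?thesis using assms(1) True card_Suc_Diff1[of "cls A \<kappa>" e] by simp
next
  case False
  then have "cls (insert (\<kappa>, e') (A - {(\<kappa>, e)})) \<mu> = cls A \<mu>" by (auto simp: cls_def)
  then show ?thesis by simp
qed

lemma replace_pair_cmove:
  assumes P: "finite P" and A: "A \<in> cspace P d N"
    and old: "(\<kappa>, e) \<in> A" "(\<mu>, f) \<in> A" "e \<noteq> f" and new: "(\<kappa>, e') \<notin> A" "(\<mu>, f') \<notin> A" "e' \<noteq> f'"
    and sum: "e + f = e' + f'" and in_P: "e' \<in> P" "f' \<in> P"
    and deg: "\<And>v. edeg P (emult (replace_pair A (\<kappa>, e) (\<mu>, f) (\<kappa>, e') (\<mu>, f'))) v = d v"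
  shows "(A, replace_pair A (\<kappa>, e) (\<mu>, f) (\<kappa>, e') (\<mu>, f')) \<in> cmove P d N"
proof -
  let ?A1 = "insert (\<kappa>, e') (A - {(\<kappa>, e)})" and ?B = "replace_pair A (\<kappa>, e) (\<mu>, f) (\<kappa>, e') (\<mu>, f')"
  have AP: "snd ` A \<subseteq> P" using A by (simp add: cspace_def)
  have "?B = insert (\<mu>, f') (?A1 - {(\<mu>, f)})"
    using old new by (auto simp: replace_pair_def)
  moreover have "card (cls ?A1 \<nu>) = card (cls A \<nu>)" for \<nu>
    using finite_cls[OF P AP] old new by (intro card_cls_replace)
  moreover have "card (cls (insert (\<mu>, f') (?A1 - {(\<mu>, f)})) \<nu>) = card (cls ?A1 \<nu>)" for \<nu>
    using old new AP in_P by (intro card_cls_replace finite_cls[OF P]) auto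
  ultimately have "card (cls ?B \<nu>) = N \<nu>" for \<nu> using A by (simp add: cspace_def)
  moreover have "snd ` ?B \<subseteq> P" using AP in_P by (auto simp: replace_pair_def)
  ultimately have "?B \<in> cspace P d N" using deg by (simp add: cspace_def)
  then show ?thesis using A old sum unfolding cmove_def by blast
qed

section \<open>Recolouring with fixed multiplicities\<close>

definition colour_swap :: "(bool \<times> 'e) set \<Rightarrow> bool \<Rightarrow> 'e \<Rightarrow> 'e \<Rightarrow> (bool \<times> 'e) set" where
  "colour_swap A \<kappa> x y = replace_pair A (\<kappa>, x) (\<not> \<kappa>, y) (\<kappa>, y) (\<not> \<kappa>, x)"

lemma
  assumes "x \<in> single A \<kappa>" "y \<in> single A (\<not> \<kappa>)"
  shows emult_colour_swap: "emult (colour_swap A \<kappa> x y) = emult A"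
    and single_colour_swap: "single (colour_swap A \<kappa> x y) \<kappa> = insert y (single A \<kappa> - {x})"
      "single (colour_swap A \<kappa> x y) (\<not> \<kappa>) = insert x (single A (\<not> \<kappa>) - {y})"
    and colour_swap_other: "e \<noteq> x \<Longrightarrow> e \<noteq> y \<Longrightarrow> (\<mu>, e) \<in> colour_swap A \<kappa> x y \<longleftrightarrow> (\<mu>, e) \<in> A"
  using assms
  by (cases \<kappa>; auto simp: emult_def single_def colour_swap_def replace_pair_def fun_eq_iff)+

lemma colour_swap_cmove:
  assumes P: "finite P" and A: "A \<in> cspace P d N"
    and xy: "x \<in> single A \<kappa>" "y \<in> single A (\<not> \<kappa>)"
  shows "(A, colour_swap A \<kappa> x y) \<in> cmove P d N"
  unfolding colour_swap_def
proof (rule replace_pair_cmove[OF P A])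
  have AP: "snd ` A \<subseteq> P" using A by (simp add: cspace_def)
  show "(\<kappa>, x) \<in> A" "(\<not> \<kappa>, y) \<in> A" "x \<noteq> y" "(\<kappa>, y) \<notin> A" "(\<not> \<kappa>, x) \<notin> A" "y \<noteq> x"
    using xy by (auto simp: single_def)
  then show "y \<in> P" "x \<in> P" using AP by force+
  show "edeg P (emult (replace_pair A (\<kappa>, x) (\<not> \<kappa>, y) (\<kappa>, y) (\<not> \<kappa>, x))) v = d v" for v
    using emult_colour_swap[OF xy] A by (simp add: cspace_def colour_swap_def)
qed (simp add: add.commute)

text \<open>Classes of equal size have a surplus edge \<open>x\<close> whenever they lack an edge
  \<open>y\<close>; equal multiplicities make both single, so their colours can be
  exchanged.\<close>

lemma recolour:
  assumes P: "finite P" and "A \<in> cspace P d N" "B \<in> cspace P d N" "emult A = emult B"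
  shows "(A, B) \<in> (cmove P d N)\<^sup>*"
  using assms(2,4)
proof (induction "card (cls A True - cls B True)" arbitrary: A rule: less_induct)
  case less
  note B = \<open>B \<in> cspace P d N\<close> and A = \<open>A \<in> cspace P d N\<close>
  have fin: "finite (cls A \<kappa>)" "finite (cls B \<kappa>)" for \<kappa>
    using A B finite_cls[OF P] by (auto simp: cspace_def)
  have m: "emult A e = emult B e" for e using less by simp
  show ?case
  proof (cases "cls A True \<subseteq> cls B True")
    case True
    then have "cls A True = cls B True"
      using A B fin by (intro card_subset_eq) (auto simp: cspace_def)
    then have t: "(True, e) \<in> A \<longleftrightarrow> (True, e) \<in> B" for e by (auto simp: cls_def)
    then have "(False, e) \<in> A \<longleftrightarrow> (False, e) \<in> B" for e
      using m[of e] by (auto simp: emult_def split: if_splits)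
    with t have "A = B" by (auto simp: set_eq_iff) (metis (full_types))+
    then show ?thesis by simp
  next
    case False
    then obtain x where x: "x \<in> cls A True" "x \<notin> cls B True" by blast
    have "\<not> cls B True \<subseteq> cls A True"
      using card_subset_eq[OF fin(1), of "cls B True" True] A B x by (auto simp: cspace_def)
    then obtain y where y: "y \<in> cls B True" "y \<notin> cls A True" by blast
    have xs: "x \<in> single A True" and ys: "y \<in> single A (\<not> True)"
      using x y m[of x] m[of y] by (auto simp: cls_def single_def emult_def of_bool_def split: if_splits)
    let ?C = "colour_swap A True x y"
    have step: "(A, ?C) \<in> cmove P d N" using colour_swap_cmove[OF P A xs ys] .
    have "cls ?C True = insert y (cls A True - {x})"
      using xs ys by (auto simp: cls_def colour_swap_def replace_pair_def single_def)
    then have "cls ?C True - cls B True = (cls A True - cls B True) - {x}" using y by auto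
    then have "card (cls ?C True - cls B True) < card (cls A True - cls B True)"
      using x fin(1)[of True] by (intro psubset_card_mono) auto
    moreover have "?C \<in> cspace P d N" using step by (simp add: cmove_def)
    ultimately have "(?C, B) \<in> (cmove P d N)\<^sup>*"
      using less.hyps[of ?C] emult_colour_swap[OF xs ys] less.prems by simp
    then show ?thesis using step by (rule converse_rtrancl_into_rtrancl[rotated])
  qed
qed

section \<open>Freeing colours for an edge swap\<close>

text \<open>An edge swap lifts to the coloured graph if the colours of the removed edges \<open>ab\<close>, \<open>cd\<close> are free
  on the added edges \<open>bc\<close>, \<open>da\<close>.\<close>

definition compatible :: "(bool \<times> 'e) set \<Rightarrow> 'e \<Rightarrow> 'e \<Rightarrow> 'e \<Rightarrow> 'e \<Rightarrow> bool" where
  "compatible A ab cd bc da \<longleftrightarrow> (\<exists>\<kappa> \<mu>. (\<kappa>, ab) \<in> A \<and> (\<mu>, cd) \<in> A \<and>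
     ((\<kappa>, bc) \<notin> A \<and> (\<mu>, da) \<notin> A \<or> (\<kappa>, da) \<notin> A \<and> (\<mu>, bc) \<notin> A))"

locale coloured_swap =
  fixes P :: "'v multiset set" and d :: "'v \<Rightarrow> int" and N :: "bool \<Rightarrow> nat" and m :: int
    and ab cd bc da :: "'v multiset"
  assumes finP: "finite P"
    and distinct: "ab \<noteq> cd" "ab \<noteq> bc" "ab \<noteq> da" "cd \<noteq> bc" "cd \<noteq> da" "bc \<noteq> da"
    and N: "\<And>\<kappa>. m \<le> int (N \<kappa>)"
begin

text \<open>The left side of the last inequality is the number of double edges after the swap: an
  added edge becomes double if it was present, a removed edge ceases to be double if its
  multiplicity was two.\<close>

definition admissible :: "(bool \<times> 'v multiset) set \<Rightarrow> bool" where
  "admissible A \<longleftrightarrow> A \<in> cspace P d N \<and> 1 \<le> emult A ab \<and> 1 \<le> emult A cd \<and> emult A bc \<le> 1 \<and> emult A da \<le> 1 \<and>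
     cost P (emult A) + emult A bc + emult A da + 2 - emult A ab - emult A cd \<le> m"

text \<open>The class has at least \<open>m\<close> edges and \<open>m\<close> bounds the double
  edges after the swap; subtracting the present double edges leaves this many single ones.\<close>

lemma single_lower_bound:
  assumes "admissible A"
  shows "emult A bc + emult A da + 2 - emult A ab - emult A cd \<le> int (card (single A \<kappa>))"
  using assms card_single[OF finP, of A \<kappa>] N[of \<kappa>] by (auto simp: admissible_def cspace_def)

lemma admissible_colour_swap:
  assumes "admissible A" "x \<in> single A \<kappa>" "y \<in> single A (\<not> \<kappa>)"
  shows "admissible (colour_swap A \<kappa> x y)" "(A, colour_swap A \<kappa> x y) \<in> cmove P d N"
proof -
  show "(A, colour_swap A \<kappa> x y) \<in> cmove P d N"
    using assms colour_swap_cmove[OF finP] by (simp add: admissible_def)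
  then show "admissible (colour_swap A \<kappa> x y)"
    using assms emult_colour_swap[OF assms(2,3)] by (simp add: admissible_def cmove_def)
qed

lemma not_subset_single:
  assumes "int (card F) < int (card (single A \<kappa>))" "finite F"
  obtains y where "y \<in> single A \<kappa>" "y \<notin> F"
  using assms card_mono[of F "single A \<kappa>"] by force

text \<open>Colour \<open>\<kappa>\<close> is blocked on both added edges, so both removed edges
  must offer the other one. Each that carries only \<open>\<kappa>\<close> exchanges colours with a
  single edge other than \<open>ab\<close> and \<open>cd\<close>.\<close>

lemma compatible_both_same:
  assumes "admissible A" "bc \<in> single A \<kappa>" "da \<in> single A \<kappa>"
  shows "\<exists>B. (A, B) \<in> (cmove P d N)\<^sup>* \<and> emult B = emult A \<and> compatible B ab cd bc da"
  using assms
proof (induction "card ({ab, cd} \<inter> single A \<kappa>)" arbitrary: A rule: less_induct)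
  case less
  have ge: "1 \<le> emult A ab" "1 \<le> emult A cd" using less.prems(1) by (auto simp: admissible_def)
  show ?case
  proof (cases "{ab, cd} \<inter> single A \<kappa> = {}")
    case True
    then have "(\<not> \<kappa>, ab) \<in> A" "(\<not> \<kappa>, cd) \<in> A"
      using ge emult_ge_1_cases[of A _ \<kappa>] by (auto simp: single_def)
    then have "compatible A ab cd bc da"
      using less.prems unfolding compatible_def by (auto simp: single_def)
    then show ?thesis by blast
  next
    case False
    then obtain x where x: "x \<in> {ab, cd}" "x \<in> single A \<kappa>" by blast
    let ?F = "{ab, cd} \<inter> single A (\<not> \<kappa>)"
    have "emult A bc = 1" "emult A da = 1"
      using emult_single[OF less.prems(2)] emult_single[OF less.prems(3)] by simp_all
    then have "int (card ?F) < int (card (single A (\<not> \<kappa>)))"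
      using single_lower_bound[OF less.prems(1), of "\<not> \<kappa>"] x distinct ge
      by (elim emult_ge_1_cases[of A ab \<kappa>] emult_ge_1_cases[of A cd \<kappa>]) (auto simp: Int_insert_left)
    then obtain y where y: "y \<in> single A (\<not> \<kappa>)" "y \<notin> ?F" by (rule not_subset_single) auto
    let ?C = "colour_swap A \<kappa> x y"
    note C = admissible_colour_swap[OF less.prems(1) x(2) y(1)] and sC = single_colour_swap[OF x(2) y(1)]
    have "bc \<noteq> x" "da \<noteq> x" using x distinct by auto
    then have bcda: "bc \<in> single ?C \<kappa>" "da \<in> single ?C \<kappa>" using less.prems sC by auto
    have "{ab, cd} \<inter> single ?C \<kappa> = ({ab, cd} \<inter> single A \<kappa>) - {x}" using sC x y by auto
    then have "card ({ab, cd} \<inter> single ?C \<kappa>) < card ({ab, cd} \<inter> single A \<kappa>)"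
      using x by (intro psubset_card_mono) auto
    from less.hyps[OF this C(1) bcda] show ?thesis
      using C(2) emult_colour_swap[OF x(2) y(1)] by (metis converse_rtrancl_into_rtrancl)
  qed
qed

text \<open>Exchanging colours with \<open>y\<close> makes \<open>ab\<close> and \<open>cd\<close>
  differ in colour. \<open>F\<close> holds the edges that \<open>y\<close> must avoid so that
  \<open>bc\<close> and \<open>da\<close> keep their colours.\<close>

lemma compatible_after_one_swap:
  assumes A: "admissible A" and ab: "ab \<in> single A \<kappa>" and cd: "cd \<in> single A \<kappa>"
    and F: "single A (\<not> \<kappa>) \<inter> {bc, da} \<subseteq> F" "finite F" "int (card F) < int (card (single A (\<not> \<kappa>)))"
    and ok: "(\<not> \<kappa>, bc) \<notin> A \<and> (\<kappa>, da) \<notin> A \<or> (\<not> \<kappa>, da) \<notin> A \<and> (\<kappa>, bc) \<notin> A"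
  shows "\<exists>B. (A, B) \<in> (cmove P d N)\<^sup>* \<and> emult B = emult A \<and> compatible B ab cd bc da"
proof -
  obtain y where y: "y \<in> single A (\<not> \<kappa>)" "y \<notin> F" using not_subset_single[OF F(3,2)] .
  let ?C = "colour_swap A \<kappa> ab y"
  have ne: "y \<noteq> ab" "y \<noteq> cd" "y \<noteq> bc" "y \<noteq> da"
    using y ab cd F(1) by (auto simp: single_def)
  have "(\<not> \<kappa>, ab) \<in> ?C" using single_colour_swap(2)[OF ab y(1)] by (auto simp: single_def)
  moreover have "(\<kappa>, cd) \<in> ?C" "\<And>\<mu>. (\<mu>, bc) \<in> ?C \<longleftrightarrow> (\<mu>, bc) \<in> A" "\<And>\<mu>. (\<mu>, da) \<in> ?C \<longleftrightarrow> (\<mu>, da) \<in> A"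
    using colour_swap_other[OF ab y(1)] ne distinct cd by (auto simp: single_def)
  ultimately have "compatible ?C ab cd bc da" using ok unfolding compatible_def by metis
  then show ?thesis
    using admissible_colour_swap(2)[OF A ab y(1)] emult_colour_swap[OF ab y(1)] by blast
qed

text \<open>Unless \<open>bc\<close> and \<open>da\<close> carry the same colour, incompatibility
  forces \<open>ab\<close> and \<open>cd\<close> to be single of one common colour;
  \<open>single_lower_bound\<close> then supplies an edge of the other colour for an
  exchange.\<close>

lemma ex_compatible:
  assumes A: "admissible A"
  shows "\<exists>B. (A, B) \<in> (cmove P d N)\<^sup>* \<and> emult B = emult A \<and> compatible B ab cd bc da"
proof (cases "compatible A ab cd bc da")
  case False
  have in_A: "e \<in> single A \<kappa> \<or> (\<not> \<kappa>, e) \<in> A" if "1 \<le> emult A e" for e \<kappa>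
    using that emult_ge_1_cases[of A e \<kappa>] by (auto simp: single_def)
  have ge: "1 \<le> emult A ab" "1 \<le> emult A cd" using A by (auto simp: admissible_def)
  consider (none) "\<forall>\<kappa>. (\<kappa>, bc) \<notin> A \<and> (\<kappa>, da) \<notin> A"
    | (left) \<kappa> where "bc \<in> single A \<kappa>" "\<forall>\<mu>. (\<mu>, da) \<notin> A"
    | (right) \<kappa> where "da \<in> single A \<kappa>" "\<forall>\<mu>. (\<mu>, bc) \<notin> A"
    | (same) \<kappa> where "bc \<in> single A \<kappa>" "da \<in> single A \<kappa>"
    | (opposite) \<kappa> where "bc \<in> single A \<kappa>" "da \<in> single A (\<not> \<kappa>)"
    using A emult_cases[of A bc] emult_cases[of A da] unfolding admissible_def by (smt (verit, best))
  then show ?thesis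
  proof cases
    case none
    then have False using False in_A[OF ge(1)] in_A[OF ge(2)] unfolding compatible_def single_def by blast
    then show ?thesis ..
  next
    case left
    then have s: "ab \<in> single A \<kappa>" "cd \<in> single A \<kappa>"
      using False in_A[OF ge(1)] in_A[OF ge(2)] unfolding compatible_def single_def by blast+
    have "emult A bc = 1" "emult A da = 0" "emult A ab = 1" "emult A cd = 1"
      using left s emult_single by (auto simp: emult_def[of A da])
    then have "int (card {}) < int (card (single A (\<not> \<kappa>)))"
      using single_lower_bound[OF A, of "\<not> \<kappa>"] by simp
    then show ?thesis
      using left by (intro compatible_after_one_swap[OF A s, of "{}"]) (auto simp: single_def)
  next
    case right
    then have s: "ab \<in> single A \<kappa>" "cd \<in> single A \<kappa>"
      using False in_A[OF ge(1)] in_A[OF ge(2)] unfolding compatible_def single_def by blast+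
    have "emult A da = 1" "emult A bc = 0" "emult A ab = 1" "emult A cd = 1"
      using right s emult_single by (auto simp: emult_def[of A bc])
    then have "int (card {}) < int (card (single A (\<not> \<kappa>)))"
      using single_lower_bound[OF A, of "\<not> \<kappa>"] by simp
    then show ?thesis
      using right by (intro compatible_after_one_swap[OF A s, of "{}"]) (auto simp: single_def)
  next
    case same
    then show ?thesis using compatible_both_same[OF A] by blast
  next
    case opposite
    have "\<not> ((\<kappa>, ab) \<in> A \<and> (\<not> \<kappa>, cd) \<in> A)" "\<not> ((\<not> \<kappa>, ab) \<in> A \<and> (\<kappa>, cd) \<in> A)"
      using False opposite unfolding compatible_def single_def by auto
    moreover have "(\<kappa>, e) \<in> A \<or> (\<not> \<kappa>, e) \<in> A" if "1 \<le> emult A e" for e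
      using in_A[OF that, of \<kappa>] by (auto simp: single_def)
    ultimately have "(ab \<in> single A \<kappa> \<and> cd \<in> single A \<kappa>) \<or> (ab \<in> single A (\<not> \<kappa>) \<and> cd \<in> single A (\<not> \<kappa>))"
      using ge unfolding single_def by (metis (mono_tags, lifting) mem_Collect_eq)
    then obtain \<nu> where s: "ab \<in> single A \<nu>" "cd \<in> single A \<nu>" by blast
    have "emult A bc = 1" "emult A da = 1" "emult A ab = 1" "emult A cd = 1"
      using emult_single[OF opposite(1)] emult_single[OF opposite(2)] emult_single[OF s(1)]
        emult_single[OF s(2)] by simp_all
    then have two: "1 < int (card (single A (\<not> \<nu>)))"
      using single_lower_bound[OF A, of "\<not> \<nu>"] by simp
    show ?thesis
    proof (cases "\<nu> = \<kappa>")
      case True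
      then show ?thesis using opposite two
        by (intro compatible_after_one_swap[OF A s, of "{da}"]) (auto simp: single_def)
    next
      case False
      then show ?thesis using opposite two
        by (intro compatible_after_one_swap[OF A s, of "{bc}"]) (auto simp: single_def)
    qed
  qed
qed blast

end

section \<open>Lifting edge swaps to coloured graphs\<close>

lemma emult_in_gspace:
  assumes P: "finite P" and A: "A \<in> cspace P d N"
  shows "emult A \<in> gspace P d (min (int (N True)) (int (N False)))"
  using card_single[OF P, of A True] card_single[OF P, of A False] A emult_off[of A P]
  by (auto simp: gspace_def cspace_def emult_def)

lemma lift_edge_swap:
  assumes P: "finite P" "loopless P" and A: "A \<in> cspace P d N"
    and swap: "(emult A, h) \<in> edge_swap P d m" and m: "\<And>\<kappa>. m \<le> int (N \<kappa>)"
  shows "\<exists>B. (A, B) \<in> (cmove P d N)\<^sup>* \<and> emult B = h"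
proof (cases "emult A = h")
  case False
  obtain x y u v where diff: "\<And>e. emult A e - h e =
      chi {#x, y#} e - chi {#y, u#} e + chi {#u, v#} e - chi {#v, x#} e"
    using swap unfolding edge_swap_def by blast
  have h: "h \<in> gspace P d m" using swap by (simp add: edge_swap_def)
  have h_bounds: "0 \<le> h e" "h e \<le> 2" "e \<notin> P \<Longrightarrow> h e = 0" for e
    using h by (auto simp: gspace_def)
  have A_bounds: "0 \<le> emult A e" "emult A e \<le> 2" for e by (auto simp: emult_def)
  have AP: "snd ` A \<subseteq> P" using A by (simp add: cspace_def)
  let ?ab = "{#x, y#}" and ?bc = "{#y, u#}" and ?cd = "{#u, v#}" and ?da = "{#v, x#}"
  \<comment> \<open>If opposite corners coincided, the four terms would cancel and
    \<open>emult A\<close> would equal \<open>h\<close>.\<close>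
  have "x \<noteq> u" "y \<noteq> v"
    using False diff by (auto simp: fun_eq_iff add_mset_commute)
  then have ne: "?ab \<noteq> ?bc" "?ab \<noteq> ?da" "?cd \<noteq> ?bc" "?cd \<noteq> ?da"
    by (auto simp: add_eq_conv_ex)
  have in_P: "?ab \<in> P" "?cd \<in> P" "?bc \<in> P" "?da \<in> P"
  proof -
    have "0 < emult A ?ab" "0 < emult A ?cd"
      using diff[of ?ab] diff[of ?cd] h_bounds(1)[of ?ab] h_bounds(1)[of ?cd] ne
      by (auto simp: chi_def split: if_splits)
    then show "?ab \<in> P" "?cd \<in> P" using emult_off[OF AP] by (metis less_irrefl)+
    have "0 < h ?bc" "0 < h ?da"
      using diff[of ?bc] diff[of ?da] A_bounds(1)[of ?bc] A_bounds(1)[of ?da] ne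
      by (auto simp: chi_def split: if_splits)
    then show "?bc \<in> P" "?da \<in> P" using h_bounds(3) by (metis less_irrefl)+
  qed
  have "v \<noteq> x" "y \<noteq> u" "x \<noteq> y" using in_P P(2) by (auto simp: loopless_def add_eq_conv_ex)
  then have ne': "?ab \<noteq> ?cd" "?bc \<noteq> ?da"
    using \<open>x \<noteq> u\<close> \<open>y \<noteq> v\<close> by (auto simp: add_eq_conv_ex)
  interpret coloured_swap P d N m ?ab ?cd ?bc ?da
    using P(1) ne ne' m by unfold_locales auto
  have vals: "emult A ?ab = h ?ab + 1" "emult A ?cd = h ?cd + 1" "h ?bc = emult A ?bc + 1" "h ?da = emult A ?da + 1"
    using diff[of ?ab] diff[of ?cd] diff[of ?bc] diff[of ?da] ne ne' by (auto simp: chi_def)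
  have other: "h e = emult A e" if "e \<notin> {?ab, ?cd, ?bc, ?da}" for e
    using diff[of e] that by (auto simp: chi_def)
  have h_eq: "h = (\<lambda>e. emult A e + (-1) * chi ?ab e + (-1) * chi ?cd e + 1 * chi ?bc e + 1 * chi ?da e)"
    using diff by (auto simp: fun_eq_iff algebra_simps)
  have "cost P h = cost P (emult A) + (max 0 (emult A ?ab - 2) - max 0 (emult A ?ab - 1))
      + (max 0 (emult A ?cd - 2) - max 0 (emult A ?cd - 1)) + (max 0 (emult A ?bc) - max 0 (emult A ?bc - 1))
      + (max 0 (emult A ?da) - max 0 (emult A ?da - 1))"
    unfolding h_eq using in_P ne ne'
    by (simp only: cost_add_chi[OF P(1)]) (simp add: chi_def)
  then have cost_h: "cost P h = cost P (emult A) + emult A ?bc + emult A ?da + 2 - emult A ?ab - emult A ?cd"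
    using vals h_bounds(1)[of ?ab] h_bounds(1)[of ?cd] h_bounds(2)[of ?bc] h_bounds(2)[of ?da]
      A_bounds[of ?ab] A_bounds[of ?cd] A_bounds[of ?bc] A_bounds[of ?da] by linarith
  have "admissible A"
    using A vals h h_bounds(1)[of ?ab] h_bounds(1)[of ?cd] h_bounds(2)[of ?bc] h_bounds(2)[of ?da] cost_h
    by (simp add: admissible_def gspace_def)
  then obtain B where B: "(A, B) \<in> (cmove P d N)\<^sup>*" "emult B = emult A"
    and compat: "compatible B ?ab ?cd ?bc ?da" using ex_compatible by blast
  have BS: "B \<in> cspace P d N" using B(1) A by (induction rule: rtrancl_induct) (auto simp: cmove_def)
  obtain \<kappa> \<mu> e' f' where old: "(\<kappa>, ?ab) \<in> B" "(\<mu>, ?cd) \<in> B"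
    and new: "(\<kappa>, e') \<notin> B" "(\<mu>, f') \<notin> B" and ef: "e' = ?bc \<and> f' = ?da \<or> e' = ?da \<and> f' = ?bc"
    using compat unfolding compatible_def by blast
  let ?C = "replace_pair B (\<kappa>, ?ab) (\<mu>, ?cd) (\<kappa>, e') (\<mu>, f')"
  have "emult ?C e = h e" for e
  proof (cases "e \<in> {?ab, ?cd, ?bc, ?da}")
    case False
    then have "emult ?C e = emult B e" using ef by (auto simp: emult_def replace_pair_def)
    then show ?thesis using other[OF False] B(2) by simp
  next
    case True
    have C: "(\<nu>, ?ab) \<in> ?C \<longleftrightarrow> (\<nu>, ?ab) \<in> B \<and> \<nu> \<noteq> \<kappa>" "(\<nu>, ?cd) \<in> ?C \<longleftrightarrow> (\<nu>, ?cd) \<in> B \<and> \<nu> \<noteq> \<mu>"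
      "(\<nu>, e') \<in> ?C \<longleftrightarrow> (\<nu>, e') \<in> B \<or> \<nu> = \<kappa>" "(\<nu>, f') \<in> ?C \<longleftrightarrow> (\<nu>, f') \<in> B \<or> \<nu> = \<mu>" for \<nu>
      using ef ne ne' by (auto simp: replace_pair_def)
    have "emult ?C ?ab = emult B ?ab - 1" "emult ?C ?cd = emult B ?cd - 1"
      "emult ?C e' = emult B e' + 1" "emult ?C f' = emult B f' + 1"
      unfolding emult_def C using old new by (cases \<kappa>; cases \<mu>; simp)+
    then show ?thesis using True ef vals B(2) by auto
  qed
  then have C: "emult ?C = h" by blast
  have "(B, ?C) \<in> cmove P d N"
  proof (rule replace_pair_cmove[OF P(1) BS old _ new])
    show "edeg P (emult ?C) w = d w" for w using h unfolding C by (simp add: gspace_def)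
  qed (use ef ne' in_P in \<open>auto simp: add_mset_commute\<close>)
  then have "(A, ?C) \<in> (cmove P d N)\<^sup>*" using B(1) by (rule rtrancl_into_rtrancl[rotated])
  then show ?thesis using C by blast
qed blast

text \<open>Lifting swap by swap reaches some colouring with the right multiplicities;
  \<open>recolour\<close> leads on to \<open>B\<close>.\<close>

theorem cmoves_connect:
  assumes P: "finite P" "loopless P"
    "\<And>e f x y. e \<in> P \<Longrightarrow> f \<in> P \<Longrightarrow> x \<in># e \<Longrightarrow> y \<in># f \<Longrightarrow> x \<noteq> y \<Longrightarrow> {#x, y#} \<in> P"
    and A: "A \<in> cspace P d N" and B: "B \<in> cspace P d N"
  shows "(A, B) \<in> (cmove P d N)\<^sup>*"
proof -
  let ?m = "min (int (N True)) (int (N False))"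
  have m: "?m \<le> int (N \<kappa>)" for \<kappa> by (cases \<kappa>) auto
  have "(emult A, emult B) \<in> (edge_swap P d ?m)\<^sup>*"
  proof (rule edge_swaps_connect[OF P(1,2)])
    show "{#x, y#} \<in> P" if "e \<in> P" "f \<in> P" "x \<in># e" "y \<in># f" "x \<noteq> y" for e f x y
      using P(3) that .
  qed (use emult_in_gspace[OF P(1)] A B in blast)+
  then have "\<exists>C. (A, C) \<in> (cmove P d N)\<^sup>* \<and> emult C = emult B"
  proof (induction rule: rtrancl_induct)
    case (step g h)
    then obtain C where C: "(A, C) \<in> (cmove P d N)\<^sup>*" "emult C = g" by blast
    then have "C \<in> cspace P d N" using A by (induction rule: rtrancl_induct) (auto simp: cmove_def)
    from lift_edge_swap[OF P(1,2) this, of h ?m] step(2) C m show ?case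
      by (metis rtrancl_trans)
  qed blast
  then obtain C where C: "(A, C) \<in> (cmove P d N)\<^sup>*" "emult C = emult B" by blast
  have "C \<in> cspace P d N" using C(1) A by (induction rule: rtrancl_induct) (auto simp: cmove_def)
  from recolour[OF P(1) this B C(2)] show ?thesis using C(1) by simp
qed

section \<open>Finite symmetric Markov chains\<close>

text \<open>Symmetry makes the uniform distribution stationary, and \<open>lazy\<close> rules out
  periodicity.\<close>

locale symmetric_chain =
  fixes S :: "'a set" and K :: "'a \<Rightarrow> 'a pmf"
  assumes finS: "finite S"
    and closed: "\<And>x. x \<in> S \<Longrightarrow> set_pmf (K x) \<subseteq> S"
    and symmetric: "\<And>x y. x \<in> S \<Longrightarrow> y \<in> S \<Longrightarrow> pmf (K x) y = pmf (K y) x"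
    and lazy: "\<And>x. x \<in> S \<Longrightarrow> x \<in> set_pmf (K x)"
    and irreducible: "\<And>x y. x \<in> S \<Longrightarrow> y \<in> S \<Longrightarrow> (x, y) \<in> {(x, y). x \<in> S \<and> y \<in> set_pmf (K x)}\<^sup>*"
begin

text \<open>The Markov operator acts on functions, since convergence in distribution is tested by
  expectations of functions.\<close>

definition T :: "('a \<Rightarrow> real) \<Rightarrow> 'a \<Rightarrow> real" where
  "T f x = (\<Sum>y\<in>S. pmf (K x) y * f y)"

definition osc :: "('a \<Rightarrow> real) \<Rightarrow> real" where
  "osc f = Max (f ` S) - Min (f ` S)"

lemma row_sum: "x \<in> S \<Longrightarrow> (\<Sum>y\<in>S. pmf (K x) y) = 1"
  using sum_pmf_eq_1[OF finS closed] .

lemma col_sum: "y \<in> S \<Longrightarrow> (\<Sum>x\<in>S. pmf (K x) y) = 1"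
  using row_sum[of y] symmetric[of _ y] by simp

text \<open>By symmetry the columns of the kernel sum to one as well; this invariant identifies the
  limit as the average.\<close>

lemma sum_T: "(\<Sum>x\<in>S. T f x) = (\<Sum>x\<in>S. f x)"
proof -
  have "(\<Sum>x\<in>S. T f x) = (\<Sum>y\<in>S. (\<Sum>x\<in>S. pmf (K x) y) * f y)"
    unfolding T_def sum_distrib_right by (rule sum.swap)
  then show ?thesis by (simp add: col_sum)
qed

lemma sum_funpow_T: "(\<Sum>x\<in>S. (T ^^ n) f x) = (\<Sum>x\<in>S. f x)"
  by (induction n) (simp_all add: sum_T)

text \<open>As rows sum to one, \<open>T\<close> commutes with reflecting a function, so upper
  bounds follow from lower ones.\<close>

lemma T_affine: "x \<in> S \<Longrightarrow> (\<And>y. y \<in> S \<Longrightarrow> g y = c - f y) \<Longrightarrow> T g x = c - T f x"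
proof -
  assume x: "x \<in> S" and g: "\<And>y. y \<in> S \<Longrightarrow> g y = c - f y"
  have "T g x = (\<Sum>y\<in>S. pmf (K x) y * c - pmf (K x) y * f y)"
    unfolding T_def using g by (intro sum.cong) (auto simp: right_diff_distrib)
  then show ?thesis by (simp add: T_def sum_subtractf row_sum[OF x] flip: sum_distrib_right)
qed

lemma funpow_T_affine: "x \<in> S \<Longrightarrow> (T ^^ n) (\<lambda>y. c - f y) x = c - (T ^^ n) f x"
  by (induction n arbitrary: x) (simp_all add: T_affine)

lemma T_nonneg: "(\<And>y. y \<in> S \<Longrightarrow> 0 \<le> f y) \<Longrightarrow> 0 \<le> T f x"
  unfolding T_def by (intro sum_nonneg) auto

lemma funpow_T_nonneg: "(\<And>y. y \<in> S \<Longrightarrow> 0 \<le> f y) \<Longrightarrow> x \<in> S \<Longrightarrow> 0 \<le> (T ^^ n) f x"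
  by (induction n arbitrary: x) (simp_all add: T_nonneg)

lemma T_ge: "(\<And>y. y \<in> S \<Longrightarrow> 0 \<le> f y) \<Longrightarrow> y \<in> S \<Longrightarrow> pmf (K x) y * f y \<le> T f x"
  unfolding T_def using finS by (intro member_le_sum) auto

section \<open>Minorisation and decay of the oscillation\<close>

text \<open>A lower bound on the \<open>n\<close>-step probability from \<open>x\<close> to
  \<open>z\<close>, phrased by \<open>T\<close> to avoid powers of the kernel.\<close>

definition minorises :: "'a \<Rightarrow> 'a \<Rightarrow> nat \<Rightarrow> real \<Rightarrow> bool" where
  "minorises x z n \<delta> \<longleftrightarrow> (\<forall>f. (\<forall>y\<in>S. 0 \<le> f y) \<longrightarrow> \<delta> * f z \<le> (T ^^ n) f x)"

lemma minorises_step: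
  assumes m: "minorises x y n \<delta>" and \<delta>: "0 < \<delta>" and S: "y \<in> S" "z \<in> S"
  shows "minorises x z (Suc n) (\<delta> * pmf (K y) z)"
  unfolding minorises_def
proof (intro allI impI)
  fix f :: "'a \<Rightarrow> real" assume f: "\<forall>y\<in>S. 0 \<le> f y"
  have "\<delta> * (pmf (K y) z * f z) \<le> \<delta> * T f y"
    using T_ge[of f z y] f S(2) \<delta> by (intro mult_left_mono) auto
  also have "\<dots> \<le> (T ^^ n) (T f) x"
    using m f T_nonneg[of f] by (auto simp: minorises_def)
  also have "\<dots> = (T ^^ Suc n) f x" by (simp add: funpow_swap1)
  finally show "\<delta> * pmf (K y) z * f z \<le> (T ^^ Suc n) f x" by (simp add: mult.assoc)
qed

text \<open>A path to \<open>z\<close> gives one length, and waiting at \<open>z\<close> gives all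
  greater ones, so finitely many pairs can share a length.\<close>

lemma eventually_minorises:
  assumes "x \<in> S" "z \<in> S"
  shows "\<forall>\<^sub>F n in sequentially. \<exists>\<delta>>0. minorises x z n \<delta>"
proof -
  have lift: "\<exists>\<delta>>0. minorises x z (Suc n) \<delta>"
    if "\<exists>\<delta>>0. minorises x y n \<delta>" "y \<in> S" "z \<in> S" "z \<in> set_pmf (K y)" for y z n
    using that minorises_step pmf_positive_iff by (metis mult_pos_pos)
  have "z \<in> S \<longrightarrow> (\<exists>n. \<exists>\<delta>>0. minorises x z n \<delta>)" using irreducible[OF assms]
  proof (induction rule: rtrancl_induct)
    case base
    have "minorises x x 0 1" by (simp add: minorises_def)
    then show ?case by (metis zero_less_one)
  next
    case (step y z)
    then show ?case using lift[of y _ z] by blast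
  qed
  then obtain n0 where n0: "\<exists>\<delta>>0. minorises x z n0 \<delta>" using assms by blast
  have "\<exists>\<delta>>0. minorises x z n \<delta>" if "n0 \<le> n" for n
    using that by (induction rule: dec_induct) (use n0 lift[of z _ z] assms lazy in auto)
  then show ?thesis by (auto simp: eventually_sequentially)
qed

lemma ex_uniform_minorisation:
  assumes "S \<noteq> {}"
  shows "\<exists>N. \<exists>\<delta>>0. \<forall>x\<in>S. \<forall>z\<in>S. minorises x z N \<delta>"
proof -
  have "\<forall>\<^sub>F n in sequentially. \<forall>x\<in>S. \<forall>z\<in>S. \<exists>\<delta>>0. minorises x z n \<delta>"
    by (intro eventually_ball_finite ballI finS eventually_minorises)
  then obtain N where "\<forall>xz\<in>S \<times> S. \<exists>\<delta>>0. minorises (fst xz) (snd xz) N \<delta>"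
    by (auto simp: eventually_sequentially)
  then obtain \<delta> where \<delta>: "\<And>xz. xz \<in> S \<times> S \<Longrightarrow> 0 < \<delta> xz \<and> minorises (fst xz) (snd xz) N (\<delta> xz)"
    by metis
  define \<epsilon> where "\<epsilon> = Min (\<delta> ` (S \<times> S))"
  have "0 < \<epsilon>" unfolding \<epsilon>_def using assms finS \<delta> by (subst Min_gr_iff) auto
  moreover have "minorises x z N \<epsilon>" if S: "x \<in> S" "z \<in> S" for x z
    unfolding minorises_def
  proof (intro allI impI)
    fix f :: "'a \<Rightarrow> real" assume f: "\<forall>y\<in>S. 0 \<le> f y"
    have "\<epsilon> * f z \<le> \<delta> (x, z) * f z"
      unfolding \<epsilon>_def using f S finS by (intro mult_right_mono Min_le) auto
    also have "\<dots> \<le> (T ^^ N) f x" using \<delta>[of "(x, z)"] S f by (simp add: minorises_def)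
    finally show "\<epsilon> * f z \<le> (T ^^ N) f x" .
  qed
  ultimately show ?thesis by blast
qed

lemma osc_bounds:
  assumes "x \<in> S" "y \<in> S"
  shows "f x - f y \<le> osc f"
  unfolding osc_def using assms finS by (intro diff_mono Max_ge Min_le) auto

lemma osc_le:
  assumes "S \<noteq> {}" "\<And>x y. x \<in> S \<Longrightarrow> y \<in> S \<Longrightarrow> f x - f y \<le> c"
  shows "osc f \<le> c"
proof -
  have "Max (f ` S) \<in> f ` S" "Min (f ` S) \<in> f ` S" using assms(1) finS by auto
  then show ?thesis unfolding osc_def using assms(2) by auto
qed

text \<open>Doeblin's argument: each value of \<open>(T ^^ N) f\<close> is an average of \<open>f\<close> that gives weight at least \<open>\<delta>\<close>
  to a minimiser of \<open>f\<close>.\<close>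

lemma osc_contracts:
  assumes "S \<noteq> {}" "\<And>x z. x \<in> S \<Longrightarrow> z \<in> S \<Longrightarrow> minorises x z N \<delta>"
  shows "osc ((T ^^ N) f) \<le> (1 - \<delta>) * osc f"
proof (rule osc_le)
  fix x y assume S: "x \<in> S" "y \<in> S"
  have "Min (f ` S) \<in> f ` S" using assms(1) finS by (intro Min_in) auto
  then obtain z where z: "z \<in> S" "f z = Min (f ` S)" by (metis imageE)
  define M where "M = Max (f ` S)"
  have bounds: "f z \<le> f u" "f u \<le> M" if "u \<in> S" for u
    using that finS z(2) by (auto simp: M_def)
  have "\<delta> * (M - f z) \<le> (T ^^ N) (\<lambda>u. M - f u) x"
    using assms(2)[OF S(1) z(1), unfolded minorises_def, rule_format, of "\<lambda>u. M - f u"] bounds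
    by simp
  also have "\<dots> = M - (T ^^ N) f x" using S by (simp add: funpow_T_affine)
  finally have "(T ^^ N) f x \<le> M - \<delta> * (M - f z)" by simp
  \<comment> \<open>The nonnegative function \<open>f u - f z\<close> is written as two reflections
    so that \<open>funpow_T_affine\<close> applies.\<close>
  moreover have "f z \<le> (T ^^ N) f y"
    using funpow_T_nonneg[of "\<lambda>u. - f z - - f u" y N] bounds S
      funpow_T_affine[of y N "- f z" "\<lambda>u. - f u"] funpow_T_affine[of y N 0 f] by simp
  ultimately have "(T ^^ N) f x - (T ^^ N) f y \<le> (1 - \<delta>) * (M - f z)" by (simp add: algebra_simps)
  moreover have "M - f z = osc f" by (simp add: osc_def M_def z(2))
  ultimately show "(T ^^ N) f x - (T ^^ N) f y \<le> (1 - \<delta>) * osc f"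
    by simp
qed fact

text \<open>The decay is geometric along multiples of \<open>N\<close>, and monotone in between,
  which is the contraction with weight zero.\<close>

lemma osc_funpow_tendsto:
  assumes ne: "S \<noteq> {}"
  shows "(\<lambda>n. osc ((T ^^ n) f)) \<longlonglongrightarrow> 0"
proof -
  obtain N \<delta> where \<delta>: "0 < \<delta>" "\<And>x z. x \<in> S \<Longrightarrow> z \<in> S \<Longrightarrow> minorises x z N \<delta>"
    using ex_uniform_minorisation[OF ne] by metis
  have nonneg: "0 \<le> osc g" for g
  proof -
    obtain x where "x \<in> S" using ne by blast
    then show ?thesis using osc_bounds[of x x g] by simp
  qed
  \<comment> \<open>Tested on the constant function one, written \<open>1 - 0\<close> to match
    \<open>funpow_T_affine\<close>.\<close>
  have "\<delta> \<le> 1"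
  proof -
    obtain x where "x \<in> S" using ne by blast
    then have "\<delta> * 1 \<le> (T ^^ N) (\<lambda>_. 1 - 0) x"
      using \<delta>(2)[of x x, unfolded minorises_def, rule_format, of "\<lambda>_. 1 - 0"] by simp
    also have "(T ^^ N) (\<lambda>_. 1 - 0) x \<le> 1"
      using funpow_T_affine[of x N 1 "\<lambda>_. 0"] funpow_T_nonneg[of "\<lambda>_. 0" x N] \<open>x \<in> S\<close> by simp
    finally show ?thesis by simp
  qed
  have zero: "minorises x z n 0" if "x \<in> S" for x z n
    using funpow_T_nonneg[OF _ that] by (simp add: minorises_def)
  have mono: "osc ((T ^^ (n + m)) g) \<le> osc ((T ^^ m) g)" for n m g
    using osc_contracts[OF ne, of n 0 "(T ^^ m) g"] zero by (simp add: funpow_add)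
  have geometric: "osc ((T ^^ (k * N)) g) \<le> (1 - \<delta>) ^ k * osc g" for k g
  proof (induction k)
    case (Suc k)
    have "osc ((T ^^ (Suc k * N)) g) \<le> (1 - \<delta>) * osc ((T ^^ (k * N)) g)"
      using osc_contracts[OF ne \<delta>(2), of "(T ^^ (k * N)) g"] by (simp add: funpow_add)
    also have "\<dots> \<le> (1 - \<delta>) * ((1 - \<delta>) ^ k * osc g)"
      using Suc \<open>\<delta> \<le> 1\<close> by (intro mult_left_mono) auto
    finally show ?case by (simp add: mult.assoc)
  qed simp
  show ?thesis
  proof (rule LIMSEQ_I)
    fix e :: real assume "0 < e"
    have "(\<lambda>k. (1 - \<delta>) ^ k * osc f) \<longlonglongrightarrow> 0 * osc f"
      using \<delta>(1) \<open>\<delta> \<le> 1\<close> by (intro tendsto_mult LIMSEQ_realpow_zero tendsto_const) auto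
    then have "\<forall>\<^sub>F k in sequentially. (1 - \<delta>) ^ k * osc f < e"
      using \<open>0 < e\<close> by (intro order_tendstoD(2)[of _ "0 * osc f"]) auto
    then obtain k where k: "(1 - \<delta>) ^ k * osc f < e"
      unfolding eventually_sequentially by blast
    have "norm (osc ((T ^^ n) f) - 0) < e" if "k * N \<le> n" for n
      using mono[of "n - k * N" "k * N" f] geometric[of k f] k that nonneg by simp
    then show "\<exists>no. \<forall>n\<ge>no. norm (osc ((T ^^ n) f) - 0) < e" by blast
  qed
qed

section \<open>Convergence to the uniform distribution\<close>

text \<open>The last transition is absorbed into the test function: \<open>f\<close> after
  \<open>Suc k\<close> steps has the expectation of \<open>T f\<close> after \<open>k\<close>
  steps.\<close>

lemma expectation_iterate:
  assumes p: "p 0 = return_pmf x" "\<And>k. p (Suc k) = bind_pmf (p k) K" and x: "x \<in> S"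
  shows "measure_pmf.expectation (p k) f = (T ^^ k) f x"
proof -
  have supp: "set_pmf (p k) \<subseteq> S" for k
    by (induction k) (use p x closed in \<open>auto simp: set_bind_pmf\<close>)
  have E: "measure_pmf.expectation (p k) g = (\<Sum>y\<in>S. pmf (p k) y * g y)" for k g
    using integral_measure_pmf[OF finS, of "p k" g] supp[of k] by auto
  have step: "pmf (p (Suc k)) y = (\<Sum>x\<in>S. pmf (p k) x * pmf (K x) y)" for k y
    by (simp add: p(2) pmf_bind E)
  have "(\<Sum>y\<in>S. pmf (p k) y * f y) = (T ^^ k) f x"
  proof (induction k arbitrary: f)
    case 0
    then show ?case using x finS by (simp add: p(1) indicator_def of_bool_def[symmetric] if_distrib cong: if_cong)
  next
    case (Suc k)
    have "(\<Sum>y\<in>S. pmf (p (Suc k)) y * f y) = (\<Sum>x\<in>S. pmf (p k) x * T f x)"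
      unfolding step sum_distrib_right T_def sum_distrib_left
      by (subst sum.swap) (simp add: mult.assoc)
    then show ?case using Suc[of "T f"] by (simp add: funpow_swap1)
  qed
  then show ?thesis using E by simp
qed

text \<open>The average of \<open>f\<close> is invariant and stays between the extremes of
  \<open>(T ^^ k) f\<close>, whose gap tends to zero.\<close>

theorem converges_to_uniform:
  assumes p: "p 0 = return_pmf x" "\<And>k. p (Suc k) = bind_pmf (p k) K" and x: "x \<in> S"
  shows "converges_in_distribution p (pmf_of_set S)"
  unfolding converges_in_distribution_def
proof (intro allI impI)
  fix f :: "'a \<Rightarrow> real"
  have ne: "S \<noteq> {}" using x by blast
  define avg where "avg = (\<Sum>y\<in>S. f y) / card S"
  have "\<bar>(T ^^ k) f x - avg\<bar> \<le> osc ((T ^^ k) f)" for k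
  proof -
    let ?g = "(T ^^ k) f"
    have card: "0 < real (card S)" using ne finS by (simp add: card_gt_0_iff)
    have "(\<Sum>y\<in>S. ?g x - ?g y) = card S * (?g x - avg)"
      using card by (simp add: sum_subtractf sum_funpow_T avg_def field_simps)
    then have "card S * \<bar>?g x - avg\<bar> = \<bar>\<Sum>y\<in>S. ?g x - ?g y\<bar>" by (simp add: abs_mult)
    also have "\<dots> \<le> (\<Sum>y\<in>S. \<bar>?g x - ?g y\<bar>)" by (rule sum_abs)
    also have "\<dots> \<le> (\<Sum>y\<in>S. osc ?g)"
      using osc_bounds[of x _ ?g] osc_bounds[of _ x ?g] x by (intro sum_mono) (auto simp: abs_le_iff)
    finally show ?thesis using card by simp
  qed
  then have "(\<lambda>k. (T ^^ k) f x - avg) \<longlonglongrightarrow> 0"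
    by (intro Lim_null_comparison[OF _ osc_funpow_tendsto[OF ne, of f]]) simp
  then have "(\<lambda>k. (T ^^ k) f x) \<longlonglongrightarrow> avg" by (rule LIM_zero_cancel)
  moreover have "measure_pmf.expectation (pmf_of_set S) f = avg"
    using integral_pmf_of_set[OF ne finS] by (simp add: avg_def)
  ultimately show "(\<lambda>k. measure_pmf.expectation (p k) f) \<longlonglongrightarrow>
      measure_pmf.expectation (pmf_of_set S) f"
    by (simp add: expectation_iterate[OF assms])
qed

end

section \<open>The transition kernel of the shuffling method\<close>

lemma shuffle_set_refl: "(a, b) \<in> shuffle_set a b"
  by (simp add: shuffle_set_def)

lemma shuffle_set_eq:
  "(a', b') \<in> shuffle_set a b \<Longrightarrow> shuffle_set a' b' = shuffle_set a b"
  by (auto simp: shuffle_set_def)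

lemma shuffle_set_sym: "(a', b') \<in> shuffle_set a b \<longleftrightarrow> (a, b) \<in> shuffle_set a' b'"
  by (auto simp: shuffle_set_def)

lemma shuffle_step_eq:
  "shuffle_step S G = bind_pmf (pmf_of_set (arc_pairs G)) (\<lambda>P.
     map_pmf (\<lambda>G'. if G' \<in> S then G' else G) (case SOME (a, b). P = {a, b} of (a, b) \<Rightarrow> shuffle a b G))"
  by (simp add: shuffle_step_def map_pmf_def Let_def case_prod_unfold)

lemma some_pair_shuffle:
  "(case SOME (x, y). {a, b} = {x, y} of (x, y) \<Rightarrow> shuffle x y G) = shuffle a b G"
proof -
  have "case SOME (x, y). {a, b} = {x, y} of (x, y) \<Rightarrow> {a, b} = {x, y}"
    by (rule someI2[of _ "(a, b)"]) auto
  then show ?thesis by (auto simp: doubleton_eq_iff shuffle_commute split: prod.splits)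
qed

text \<open>Ordered pairs remove the choice of an order and let the double sums of the symmetry
  proof be interchanged; each unordered pair is counted twice.\<close>

definition ordered_pairs :: "'a hyperarc multiset \<Rightarrow> ('a hyperarc \<times> 'a hyperarc) set" where
  "ordered_pairs G = {(a, b). a \<in># G \<and> b \<in># G \<and> a \<noteq> b}"

definition replace_arcs ::
  "'a hyperarc multiset \<Rightarrow> 'a hyperarc \<times> 'a hyperarc \<Rightarrow> 'a hyperarc \<times> 'a hyperarc \<Rightarrow> 'a hyperarc multiset" where
  "replace_arcs G p q = G - {#fst p, snd p#} + {#fst q, snd q#}"

definition arc_pair_of :: "'a hyperarc \<times> 'a hyperarc \<Rightarrow> 'a hyperarc set" where
  "arc_pair_of p = {fst p, snd p}"

lemma finite_arc_pairs: "finite (arc_pairs G)"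
  unfolding arc_pairs_def by (rule finite_subset[of _ "Pow (set_mset G)"]) auto

lemma finite_ordered_pairs: "finite (ordered_pairs G)"
  by (rule finite_subset[of _ "set_mset G \<times> set_mset G"]) (auto simp: ordered_pairs_def)

lemma arc_pair_of_ordered: "arc_pair_of ` ordered_pairs G = arc_pairs G"
  by (force simp: arc_pair_of_def ordered_pairs_def arc_pairs_def card_2_iff image_iff)

lemma ordered_pairs_subset: "(a, b) \<in> ordered_pairs G \<Longrightarrow> {#a, b#} \<subseteq># G"
  by (auto simp: ordered_pairs_def insert_subset_eq_iff in_diff_count)

lemma sum_arc_pairs:
  fixes f :: "'a hyperarc set \<Rightarrow> real"
  shows "(\<Sum>P\<in>arc_pairs G. f P) = (\<Sum>p\<in>ordered_pairs G. f (arc_pair_of p)) / 2"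
proof -
  have "(\<Sum>p\<in>ordered_pairs G. f (arc_pair_of p))
      = (\<Sum>P\<in>arc_pairs G. \<Sum>p\<in>{p \<in> ordered_pairs G. arc_pair_of p = P}. f (arc_pair_of p))"
    by (rule sum.group[symmetric]) (simp_all add: finite_ordered_pairs finite_arc_pairs arc_pair_of_ordered)
  also have "\<dots> = (\<Sum>P\<in>arc_pairs G. 2 * f P)"
  proof (rule sum.cong)
    fix P assume "P \<in> arc_pairs G"
    then obtain a b where ab: "P = {a, b}" "a \<noteq> b" "a \<in># G" "b \<in># G"
      by (auto simp: arc_pairs_def card_2_iff)
    then have "{p \<in> ordered_pairs G. arc_pair_of p = P} = {(a, b), (b, a)}"
      by (auto simp: ordered_pairs_def arc_pair_of_def doubleton_eq_iff)
    then show "(\<Sum>p\<in>{p \<in> ordered_pairs G. arc_pair_of p = P}. f (arc_pair_of p)) = 2 * f P"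
      using ab by (simp add: arc_pair_of_def insert_commute)
  qed simp
  finally show ?thesis by (simp flip: sum_distrib_left)
qed

lemma set_shuffle_step:
  assumes p: "(a, b) \<in> ordered_pairs G" and q: "q \<in> shuffle_set a b"
  shows "(if replace_arcs G (a, b) q \<in> S then replace_arcs G (a, b) q else G) \<in> set_pmf (shuffle_step S G)"
proof -
  have P: "{a, b} \<in> arc_pairs G" using p by (auto simp: ordered_pairs_def arc_pairs_def)
  then have pairs: "set_pmf (pmf_of_set (arc_pairs G)) = arc_pairs G"
    using finite_arc_pairs by (intro set_pmf_of_set) auto
  have "replace_arcs G (a, b) q \<in> set_pmf (shuffle a b G)"
    using q finite_shuffle_set[of a b] shuffle_set_nonempty[of a b]
    by (cases q) (force simp: shuffle_def replace_arcs_def set_pmf_of_set)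
  then show ?thesis
    unfolding shuffle_step_eq using P
    by (auto simp: set_bind_pmf pairs some_pair_shuffle intro!: bexI[of _ "{a, b}"] image_eqI)
qed

lemma pmf_shuffle:
  "pmf (shuffle a b G) G' =
     (\<Sum>q\<in>shuffle_set a b. of_bool (replace_arcs G (a, b) q = G')) / card (shuffle_set a b)"
proof -
  have "pmf (shuffle a b G) G' = measure (measure_pmf (pmf_of_set (shuffle_set a b)))
      ((\<lambda>q. replace_arcs G (a, b) q) -` {G'})"
    by (simp add: shuffle_def pmf_map replace_arcs_def case_prod_unfold)
  also have "\<dots> = card (shuffle_set a b \<inter> (\<lambda>q. replace_arcs G (a, b) q) -` {G'}) / card (shuffle_set a b)"
    by (rule measure_pmf_of_set[OF shuffle_set_nonempty finite_shuffle_set])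
  also have "real (card (shuffle_set a b \<inter> (\<lambda>q. replace_arcs G (a, b) q) -` {G'}))
      = (\<Sum>q\<in>shuffle_set a b. of_bool (replace_arcs G (a, b) q = G'))"
    by (simp add: sum_of_bool_eq finite_shuffle_set vimage_def)
  finally show ?thesis .
qed

text \<open>A rejected proposal ends in \<open>G\<close>, so any other \<open>G'\<close> in
  \<open>S\<close> is reached exactly when it is proposed.\<close>

lemma pmf_shuffle_step:
  assumes ne: "arc_pairs G \<noteq> {}" and G': "G' \<in> S" "G' \<noteq> G"
  shows "pmf (shuffle_step S G) G' =
    (\<Sum>p\<in>ordered_pairs G. pmf (shuffle (fst p) (snd p) G) G') / (2 * card (arc_pairs G))"
proof -
  let ?h = "\<lambda>G'. if G' \<in> S then G' else G"
  let ?f = "\<lambda>P. pmf (map_pmf ?h (case SOME (a, b). P = {a, b} of (a, b) \<Rightarrow> shuffle a b G)) G'"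
  have h: "pmf (map_pmf ?h M) G' = pmf M G'" for M
  proof -
    have "?h -` {G'} = {G'}" using G' by auto
    then show ?thesis by (simp add: pmf_map measure_pmf_single)
  qed
  have "pmf (shuffle_step S G) G' = (\<Sum>P\<in>arc_pairs G. ?f P) / card (arc_pairs G)"
    unfolding shuffle_step_eq pmf_bind using ne finite_arc_pairs by (rule integral_pmf_of_set)
  also have "(\<Sum>P\<in>arc_pairs G. ?f P) = (\<Sum>p\<in>ordered_pairs G. pmf (shuffle (fst p) (snd p) G) G') / 2"
    unfolding sum_arc_pairs h by (simp add: arc_pair_of_def some_pair_shuffle)
  finally show ?thesis by simp
qed

lemma card_set_mset_simple:
  assumes "\<And>a. count L a \<le> 1"
  shows "card (set_mset L) = size L"
proof -
  have "size L = (\<Sum>a\<in>set_mset L. count L a)" by (simp add: size_multiset_overloaded_eq)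
  also have "\<dots> = (\<Sum>a\<in>set_mset L. 1)"
    using assms by (intro sum.cong refl) (metis One_nat_def Suc_leI count_greater_zero_iff le_antisym)
  finally show ?thesis by simp
qed

text \<open>A replacement is undone by picking the new pair and drawing the old one, from the same
  shuffle set and hence with the same probability. The common size \<open>m\<close> makes the number
  of pairs equal on both sides.\<close>

lemma shuffle_step_symmetric:
  assumes simple: "\<And>G a. G \<in> S \<Longrightarrow> count G a \<le> 1"
    and size: "\<And>G. G \<in> S \<Longrightarrow> size G = m" and m: "2 \<le> m"
    and G: "G \<in> S" "G' \<in> S"
  shows "pmf (shuffle_step S G) G' = pmf (shuffle_step S G') G"
proof (cases "G = G'")
  case False
  have card_set: "card (set_mset L) = m" if "L \<in> S" for L
    using card_set_mset_simple simple size that by metis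
  have card_pairs: "card (arc_pairs L) = m choose 2" if "L \<in> S" for L
    unfolding arc_pairs_def using n_subsets[of "set_mset L" 2] card_set[OF that] by simp
  then have ne: "arc_pairs L \<noteq> {}" if "L \<in> S" for L
    using that m by (metis card.empty zero_less_binomial_iff less_irrefl)
  let ?I = "\<lambda>L L' p q. q \<in> shuffle_set (fst p) (snd p) \<and> replace_arcs L p q = L'"
  have expand: "(\<Sum>p\<in>ordered_pairs L. pmf (shuffle (fst p) (snd p) L) L') =
      (\<Sum>p\<in>ordered_pairs L. \<Sum>q\<in>ordered_pairs L'. of_bool (?I L L' p q) / card (shuffle_set (fst p) (snd p)))"
    if L: "L \<in> S" "L' \<in> S" for L L'
  proof (rule sum.cong)
    fix p
    \<comment> \<open>\<open>L'\<close> has no repeated element, so the two new hyperarcs are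
      distinct.\<close>
    have target: "q \<in> ordered_pairs L'" if "?I L L' p q" for q
    proof -
      obtain a b where q: "q = (a, b)" by (rule prod.exhaust)
      have "{#a, b#} \<subseteq># L'" using that q by (auto simp: replace_arcs_def)
      then have "a \<in># L'" "b \<in># L'" "count {#a, b#} a \<le> count L' a"
        using mset_subset_eqD[of "{#a, b#}" L'] mset_subset_eq_count[of "{#a, b#}" L' a] by simp_all
      then show ?thesis using simple[OF L(2), of a] q by (auto simp: ordered_pairs_def)
    qed
    have "(\<Sum>q\<in>shuffle_set (fst p) (snd p). of_bool (replace_arcs L p q = L'))
        = (\<Sum>q\<in>ordered_pairs L'. of_bool (?I L L' p q) :: real)"
      by (rule sum.mono_neutral_cong)
        (use target in \<open>auto simp: finite_ordered_pairs finite_shuffle_set\<close>)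
    then show "pmf (shuffle (fst p) (snd p) L) L' =
        (\<Sum>q\<in>ordered_pairs L'. of_bool (?I L L' p q) / card (shuffle_set (fst p) (snd p)))"
      by (simp add: pmf_shuffle sum_divide_distrib)
  qed simp
  have swap: "?I L' L q p" "shuffle_set (fst p) (snd p) = shuffle_set (fst q) (snd q)"
    if p: "p \<in> ordered_pairs L" and I: "?I L L' p q" for L L' p q
  proof -
    have q: "(fst q, snd q) \<in> shuffle_set (fst p) (snd p)" using I by simp
    have "{#fst p, snd p#} \<subseteq># L" using ordered_pairs_subset[of "fst p" "snd p" L] p by simp
    moreover have "replace_arcs L' q p = L - {#fst p, snd p#} + {#fst p, snd p#}"
      using I unfolding replace_arcs_def by (metis add_diff_cancel_right')
    ultimately have "replace_arcs L' q p = L" by (simp only: subset_mset.diff_add)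
    then show "?I L' L q p" using q shuffle_set_sym[of "fst q" "snd q"] by simp
    show "shuffle_set (fst p) (snd p) = shuffle_set (fst q) (snd q)"
      using shuffle_set_eq[OF q] by simp
  qed
  have terms: "of_bool (?I G G' p q) / real (card (shuffle_set (fst p) (snd p))) =
      of_bool (?I G' G q p) / real (card (shuffle_set (fst q) (snd q)))"
    if "p \<in> ordered_pairs G" "q \<in> ordered_pairs G'" for p q
  proof (cases "?I G G' p q")
    case True
    then show ?thesis using swap[OF that(1) True] by simp
  next
    case False
    then have "\<not> ?I G' G q p" using swap(1)[OF that(2)] by blast
    with False have "(of_bool (?I G G' p q) :: real) = 0" "(of_bool (?I G' G q p) :: real) = 0" by (simp_all only: of_bool_eq_0_iff not_False_eq_True)
    then show ?thesis by (simp only: div_0)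
  qed
  have "(\<Sum>p\<in>ordered_pairs G. pmf (shuffle (fst p) (snd p) G) G')
      = (\<Sum>q\<in>ordered_pairs G'. pmf (shuffle (fst q) (snd q) G') G)"
    unfolding expand[OF G] expand[OF G(2,1)]
    by (subst sum.swap) (intro sum.cong refl terms)
  then show ?thesis
    using pmf_shuffle_step[OF ne G(2)] pmf_shuffle_step[OF ne G(1)] G False card_pairs by simp
qed simp

section \<open>Stub-labeled hypergraphs\<close>

lemma sum_mset_of_bool: "(\<Sum>a\<in>#G. of_bool (Q a)) = size (filter_mset Q G)"
  by (induction G) auto

lemma count_sum_image_mset: "count (\<Sum>a\<in>#G. f a) x = (\<Sum>a\<in>#G. count (f a) x)"
  by (induction G) auto

text \<open>This turns the partition of the stubs into one multiset equation, which a shuffle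
  visibly preserves.\<close>

lemma set_like_sum_iff:
  assumes "finite X"
  shows "(\<forall>a\<in>#G. is_set_mset (f a) \<and> set_mset (f a) \<subseteq> X) \<and>
      (\<forall>s\<in>X. size (filter_mset (\<lambda>a. s \<in># f a) G) = 1) \<longleftrightarrow> (\<Sum>a\<in>#G. f a) = mset_set X"
    (is "?L \<longleftrightarrow> ?R")
proof -
  have size: "size (filter_mset (\<lambda>a. s \<in># f a) G) = count (\<Sum>a\<in>#G. f a) s"
    if "\<And>a. a \<in># G \<Longrightarrow> is_set_mset (f a)" for s
  proof -
    have "count (f a) s = of_bool (s \<in># f a)" if "a \<in># G" for a
      using \<open>\<And>a. a \<in># G \<Longrightarrow> is_set_mset (f a)\<close>[OF that, unfolded is_set_mset_def, rule_format, of s]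
      by (cases "s \<in># f a") (auto simp: not_in_iff order_antisym Suc_le_eq)
    then have "count (\<Sum>a\<in>#G. f a) s = (\<Sum>a\<in>#G. of_bool (s \<in># f a))"
      unfolding count_sum_image_mset by (intro arg_cong[of _ _ sum_mset] image_mset_cong) auto
    then show ?thesis by (simp add: sum_mset_of_bool)
  qed
  show ?thesis
  proof
    assume L: ?L
    show ?R
    proof (rule multiset_eqI)
      fix s
      have "count (\<Sum>a\<in>#G. f a) s = 0" if "s \<notin> X"
      proof -
        have "s \<notin># (\<Sum>a\<in>#G. f a)" using L that by auto
        then show ?thesis by (simp only: not_in_iff)
      qed
      then show "count (\<Sum>a\<in>#G. f a) s = count (mset_set X) s"
        using L size[of s] assms by (cases "s \<in> X") auto
    qed
  next
    assume R: ?R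
    have sub: "f a \<subseteq># mset_set X" if "a \<in># G" for a
    proof -
      have "f a \<subseteq># (\<Sum>a\<in>#G. f a)" using that by (auto dest!: multi_member_split)
      then show ?thesis using R by simp
    qed
    have "is_set_mset (f a) \<and> set_mset (f a) \<subseteq> X" if "a \<in># G" for a
    proof
      have "count (mset_set X) x \<le> 1" for x by (simp add: count_mset_set')
      then show "is_set_mset (f a)"
        unfolding is_set_mset_def using mset_subset_eq_count[OF sub[OF that]] le_trans by blast
      show "set_mset (f a) \<subseteq> X" using set_mset_mono[OF sub[OF that]] assms by simp
    qed
    then show ?L using size R assms by auto
  qed
qed

lemma sum_mset_set_unique:
  assumes "(\<Sum>a\<in>#G. f a) = mset_set X" "a \<in># G" "b \<in># G" "x \<in># f a" "x \<in># f b"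
  shows "a = b"
proof (rule ccontr)
  assume "a \<noteq> b"
  then have "b \<in># G - {#a#}" using assms(3) by (simp add: in_diff_count)
  then obtain R where "G = R + {#a, b#}" using assms(2) by (metis add_mset_add_single insert_DiffM multi_member_split union_mset_add_mset_left union_mset_add_mset_right)
  then have "count (\<Sum>a\<in>#G. f a) x = count (\<Sum>a\<in>#R. f a) x + count (f a) x + count (f b) x" by simp
  moreover have "count (f a) x \<ge> 1" "count (f b) x \<ge> 1" using assms(4,5) by (simp_all add: Suc_le_eq)
  moreover have "count (mset_set X) x \<le> 1" by (simp add: count_mset_set')
  ultimately show False using assms(1) by simp
qed

lemma sum_mset_set_member:
  assumes "(\<Sum>a\<in>#G. f a) = mset_set X" "finite X"
  shows "x \<in> X \<Longrightarrow> \<exists>a\<in>#G. x \<in># f a" "a \<in># G \<Longrightarrow> set_mset (f a) \<subseteq> X"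
    "a \<in># G \<Longrightarrow> f a = mset_set (set_mset (f a))"
proof -
  show "\<exists>a\<in>#G. x \<in># f a" if "x \<in> X"
  proof -
    have "x \<in># (\<Sum>a\<in>#G. f a)" using assms that by simp
    then show ?thesis by auto
  qed
  have set_like: "is_set_mset (f a) \<and> set_mset (f a) \<subseteq> X" if "a \<in># G" for a
    using assms set_like_sum_iff[OF assms(2), of G f] that by blast
  then show "a \<in># G \<Longrightarrow> set_mset (f a) \<subseteq> X" by blast
  show "f a = mset_set (set_mset (f a))" if "a \<in># G"
  proof (rule multiset_eqI)
    fix y
    show "count (f a) y = count (mset_set (set_mset (f a))) y"
      using set_like[OF that] unfolding is_set_mset_def
      by (cases "y \<in># f a") (auto simp: count_mset_set' not_in_iff order_antisym Suc_le_eq)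
  qed
qed

section \<open>Permutations of stubs within their vertices\<close>

text \<open>The two stubs lie in different sets, whose union the transposition maps to itself; all
  other sets contain neither stub.\<close>

lemma transposition_affects_two:
  assumes X: "(\<Sum>a\<in>#G. f a) = mset_set X" "finite X" and xy: "x \<in> X" "y \<in> X"
    and apart: "\<And>a. a \<in># G \<Longrightarrow> \<not> (x \<in># f a \<and> y \<in># f a)"
  defines "\<tau> \<equiv> Transposition.transpose x y"
  obtains a b R where "G = add_mset a (add_mset b R)" "a \<noteq> b"
    "image_mset \<tau> (f a) + image_mset \<tau> (f b) = f a + f b" "\<And>c. c \<in># R \<Longrightarrow> image_mset \<tau> (f c) = f c"
proof -
  obtain a b where a: "a \<in># G" "x \<in># f a" and b: "b \<in># G" "y \<in># f b"
    using sum_mset_set_member(1)[OF X] xy by metis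
  have ne: "a \<noteq> b" using apart a b by blast
  obtain R where G: "G = add_mset a (add_mset b R)"
    using a(1) b(1) ne by (metis insert_noteq_member multi_member_split)
  have fixed: "image_mset \<tau> (f c) = f c" if c: "c \<in># R" for c
  proof -
    have cnt: "count (mset_set X) z \<ge> count (f c) z + count (f a) z + count (f b) z" for z
    proof -
      obtain R' where "R = add_mset c R'" using c by (metis multi_member_split)
      then show ?thesis unfolding X(1)[symmetric] G by simp
    qed
    have "count (mset_set X) z \<le> 1" for z by (simp add: count_mset_set')
    then have "count (f c) x = 0" "count (f c) y = 0"
      using cnt[of x] cnt[of y] a(2) b(2)
      by (smt (verit) count_greater_zero_iff add_is_0 le_trans less_one not_less le_add1 trans_less_add2 add.commute add_le_same_cancel1 le_antisym One_nat_def Suc_leI add_le_mono)+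
    then have "x \<notin># f c" "y \<notin># f c" by (simp_all add: not_in_iff)
    then have "image_mset \<tau> (f c) = image_mset id (f c)"
      by (intro image_mset_cong) (auto simp: \<tau>_def Transposition.transpose_def)
    then show ?thesis by simp
  qed
  define Y where "Y = set_mset (f a) \<union> set_mset (f b)"
  have disj: "set_mset (f a) \<inter> set_mset (f b) = {}"
    using sum_mset_set_unique[OF X(1) a(1) b(1)] ne by blast
  have Y: "f a + f b = mset_set Y"
    using sum_mset_set_member(3)[OF X a(1)] sum_mset_set_member(3)[OF X b(1)]
    unfolding Y_def by (metis disj finite_set_mset mset_set_Union)
  have "\<tau> ` Y = Y"
    using a(2) b(2) unfolding \<tau>_def Y_def by (intro transpose_image_eq) auto
  then have "image_mset \<tau> (mset_set Y) = mset_set Y"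
    by (metis \<tau>_def image_mset_mset_set inj_on_subset inj_transpose subset_UNIV)
  then have "image_mset \<tau> (f a) + image_mset \<tau> (f b) = f a + f b"
    unfolding Y[symmetric] by simp
  then show thesis using that G ne fixed by blast
qed

text \<open>Each element of \<open>f a\<close> is matched with the element of \<open>g a\<close> in
  its fibre, unique by injectivity of \<open>p\<close>. As both families partition \<open>X\<close>,
  the matchings combine to a permutation.\<close>

lemma fibrewise_permutation:
  assumes X: "finite X" "(\<Sum>a\<in>#G. f a) = mset_set X" "(\<Sum>a\<in>#G. g a) = mset_set X"
    and same: "\<And>a. a \<in># G \<Longrightarrow> image_mset p (f a) = image_mset p (g a)"
    and inj: "\<And>a. a \<in># G \<Longrightarrow> inj_on p (set_mset (f a))"
  shows "\<exists>\<rho>. \<rho> permutes X \<and> (\<forall>x. p (\<rho> x) = p x) \<and> (\<forall>a\<in>#G. image_mset \<rho> (f a) = g a)"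
proof -
  note fX = X(2,1) and gX = X(3,1)
  have card_eq: "card (set_mset (f a)) = card (set_mset (g a))" if "a \<in># G" for a
  proof -
    have "size (f a) = size (g a)" using same[OF that] by (metis size_image_mset)
    moreover have "size (f a) = card (set_mset (f a))" "size (g a) = card (set_mset (g a))"
      using sum_mset_set_member(3)[OF fX that] sum_mset_set_member(3)[OF gX that]
      by (metis size_mset_set)+
    ultimately show ?thesis by simp
  qed
  have img: "p ` set_mset (f a) = p ` set_mset (g a)" if "a \<in># G" for a
    using same[OF that] by (metis set_image_mset)
  have inj_g: "inj_on p (set_mset (g a))" if "a \<in># G" for a
    using inj[OF that] img[OF that] card_eq[OF that] by (metis card_image eq_card_imp_inj_on finite_set_mset)
  define Rel where "Rel x t \<longleftrightarrow> (\<exists>a\<in>#G. x \<in># f a \<and> t \<in># g a \<and> p t = p x)" for x t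
  have ex: "\<exists>t. Rel x t" if x: "x \<in> X" for x
  proof -
    obtain a where a: "a \<in># G" "x \<in># f a" using sum_mset_set_member(1)[OF fX x] by blast
    then have "p x \<in> p ` set_mset (g a)" using img by blast
    then show ?thesis using a unfolding Rel_def by force
  qed
  have rel_inj: "x = x'" if r: "Rel x t" "Rel x' t" for x x' t
  proof -
    obtain a a' where a: "a \<in># G" "x \<in># f a" "t \<in># g a" "p t = p x"
      and a': "a' \<in># G" "x' \<in># f a'" "t \<in># g a'" "p t = p x'" using r unfolding Rel_def by blast
    have "a = a'" using sum_mset_set_unique[OF X(3)] a a' by blast
    then show ?thesis using inj[OF a(1)] a a' by (auto dest: inj_onD)
  qed
  obtain r where r: "\<And>x. x \<in> X \<Longrightarrow> Rel x (r x)" using ex by metis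
  define \<rho> where "\<rho> x = (if x \<in> X then r x else x)" for x
  have rho_X: "\<rho> x \<in> X" if "x \<in> X" for x
    using r[OF that] sum_mset_set_member(2)[OF gX] that unfolding Rel_def \<rho>_def by auto
  have inj_rho: "inj_on \<rho> X"
    unfolding inj_on_def \<rho>_def using r rel_inj by metis
  have "\<rho> ` X = X" using inj_rho rho_X X(1) by (intro endo_inj_surj) auto
  then have perm: "\<rho> permutes X"
    using inj_rho by (intro bij_imp_permutes) (auto simp: bij_betw_def \<rho>_def)
  have fib: "p (\<rho> x) = p x" for x
    using r[of x] by (auto simp: \<rho>_def Rel_def)
  have "image_mset \<rho> (f a) = g a" if a: "a \<in># G" for a
  proof -
    have fa: "set_mset (f a) \<subseteq> X" using sum_mset_set_member(2)[OF fX a] .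
    have "\<rho> x \<in># g a" if x: "x \<in># f a" for x
    proof -
      obtain a' where a': "a' \<in># G" "x \<in># f a'" "r x \<in># g a'"
        using r[of x] x fa unfolding Rel_def by blast
      then have "a' = a" using sum_mset_set_unique[OF X(2) _ a _ x] by blast
      then show ?thesis using a' x fa by (auto simp: \<rho>_def)
    qed
    then have "\<rho> ` set_mset (f a) \<subseteq> set_mset (g a)" by blast
    moreover have "card (\<rho> ` set_mset (f a)) = card (set_mset (g a))"
      using card_image[OF inj_on_subset[OF inj_rho fa]] card_eq[OF a] by simp
    ultimately have "\<rho> ` set_mset (f a) = set_mset (g a)" by (intro card_subset_eq) auto
    moreover have "image_mset \<rho> (mset_set (set_mset (f a))) = mset_set (\<rho> ` set_mset (f a))"
      by (intro image_mset_mset_set inj_on_subset[OF inj_rho fa])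
    ultimately show ?thesis
      using sum_mset_set_member(3)[OF fX a] sum_mset_set_member(3)[OF gX a] by metis
  qed
  then show ?thesis using perm fib by blast
qed

text \<open>Composing \<open>\<rho>\<close> with the transposition of \<open>x\<close> and
  \<open>\<rho> x\<close> fixes \<open>x\<close> and moves no new point. The action is abstract so
  that tails and heads share the proof.\<close>

lemma fibrewise_permutation_reachable:
  fixes p :: "'s \<Rightarrow> 'v" and act :: "('s \<Rightarrow> 's) \<Rightarrow> 'g \<Rightarrow> 'g"
  assumes X: "finite X"
    and ident: "\<And>G. act id G = G" and comp: "\<And>f g G. act (f \<circ> g) G = act f (act g G)"
    and closed: "\<And>G H. (G, H) \<in> R \<Longrightarrow> H \<in> S"
    and step: "\<And>G x y. G \<in> S \<Longrightarrow> x \<in> X \<Longrightarrow> y \<in> X \<Longrightarrow> p x = p y \<Longrightarrow>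
      (G, act (Transposition.transpose x y) G) \<in> R\<^sup>*"
    and "\<rho> permutes X" "\<And>x. p (\<rho> x) = p x" "G \<in> S"
  shows "(G, act \<rho> G) \<in> R\<^sup>*"
  using assms(6-)
proof (induction "card {x. \<rho> x \<noteq> x}" arbitrary: \<rho> rule: less_induct)
  case less
  show ?case
  proof (cases "\<rho> = id")
    case True
    then show ?thesis by (simp add: ident)
  next
    case False
    then obtain x where x: "\<rho> x \<noteq> x" by (auto simp: fun_eq_iff)
    let ?y = "\<rho> x"
    let ?\<tau> = "Transposition.transpose x ?y"
    let ?\<rho> = "?\<tau> \<circ> \<rho>"
    have xX: "x \<in> X" "?y \<in> X"
      using x less.prems(1) permutes_not_in permutes_in_image by metis+
    have perm: "?\<rho> permutes X"
      using less.prems(1) xX by (intro permutes_compose permutes_swap_id)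
    have fib: "p (?\<rho> z) = p z" for z
      using less.prems(2)[of z] less.prems(2)[of x] by (auto simp: Transposition.transpose_def)
    have inj: "inj \<rho>" using less.prems(1) by (rule permutes_inj)
    have "{z. ?\<rho> z \<noteq> z} \<subset> {z. \<rho> z \<noteq> z}"
    proof
      show "{z. ?\<rho> z \<noteq> z} \<subseteq> {z. \<rho> z \<noteq> z}"
        using x inj by (auto simp: Transposition.transpose_def dest: injD split: if_splits)
      have "x \<notin> {z. ?\<rho> z \<noteq> z}" "x \<in> {z. \<rho> z \<noteq> z}" using x by simp_all
      then show "{z. ?\<rho> z \<noteq> z} \<noteq> {z. \<rho> z \<noteq> z}" by blast
    qed
    moreover have "finite {z. \<rho> z \<noteq> z}"
      using X less.prems(1) by (auto intro!: finite_subset[of _ X] simp: permutes_not_in) (metis permutes_not_in)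
    ultimately have "card {z. ?\<rho> z \<noteq> z} < card {z. \<rho> z \<noteq> z}" by (intro psubset_card_mono)
    from less.hyps[OF this perm fib less.prems(3)] have reach: "(G, act ?\<rho> G) \<in> R\<^sup>*" .
    then have "act ?\<rho> G \<in> S" using less.prems(3) closed by (induction rule: rtrancl_induct) auto
    from step[OF this xX less.prems(2)[of x, symmetric]]
    have "(act ?\<rho> G, act ?\<tau> (act ?\<rho> G)) \<in> R\<^sup>*" .
    moreover have "act ?\<tau> (act ?\<rho> G) = act \<rho> G"
      unfolding comp[symmetric] by (simp add: comp_assoc[symmetric])
    ultimately show ?thesis using reach by simp
  qed
qed

lemma degree_sum: "(\<Sum>a\<in>#G. count (image_mset g (f a)) v) = count (image_mset g (\<Sum>a\<in>#G. f a)) v"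
  by (induction G) auto

lemma stub_labeled_iff:
  assumes "finite (out_stubs d)" "finite (in_stubs d)"
  shows "stub_labeled d G \<longleftrightarrow>
    (\<Sum>a\<in>#G. tail a) = mset_set (out_stubs d) \<and> (\<Sum>a\<in>#G. head a) = mset_set (in_stubs d)"
  unfolding stub_labeled_def set_like_sum_iff[OF assms(1), symmetric] set_like_sum_iff[OF assms(2), symmetric]
  by blast

lemma sum_replace_arcs:
  assumes "{#a, b#} \<subseteq># G" "f a + f b = f a' + f b'"
  shows "(\<Sum>x\<in>#replace_arcs G (a, b) (a', b'). f x) = (\<Sum>x\<in>#G. f x)"
proof -
  obtain R where "G = {#a, b#} + R" using assms(1) by (metis subset_mset.add_diff_inverse)
  then show ?thesis using assms(2) by (simp add: replace_arcs_def add.assoc[symmetric])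
qed

lemma image_replace_arcs:
  assumes "{#a, b#} \<subseteq># G"
  shows "image_mset f (replace_arcs G (a, b) (a', b')) = image_mset f G - {#f a, f b#} + {#f a', f b'#}"
proof -
  obtain R where "G = {#a, b#} + R" using assms(1) by (metis subset_mset.add_diff_inverse)
  then show ?thesis by (simp add: replace_arcs_def)
qed

lemma arc_degree_unlabel: "arc_degree (unlabel_arc a) = arc_degree a"
  by (simp add: arc_degree_def unlabel_arc_def)

text \<open>Two permutations are needed because out-stubs and in-stubs share one
  representation.\<close>

definition act :: "('s \<Rightarrow> 's) \<Rightarrow> ('s \<Rightarrow> 's) \<Rightarrow> 's hyperarc \<Rightarrow> 's hyperarc" where
  "act \<pi> \<rho> a = (image_mset \<pi> (tail a), image_mset \<rho> (head a))"

lemma unlabel_act: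
  "(\<And>x. fst (\<pi> x) = fst x) \<Longrightarrow> (\<And>x. fst (\<rho> x) = fst x) \<Longrightarrow> unlabel_arc (act \<pi> \<rho> a) = unlabel_arc a"
  by (simp add: unlabel_arc_def act_def multiset.map_comp comp_def)

lemma arc_degree_act: "arc_degree (act \<pi> \<rho> a) = arc_degree a"
  by (simp add: arc_degree_def act_def)

lemma act_comp: "act (f \<circ> g) (h \<circ> k) = act f h \<circ> act g k"
  by (simp add: fun_eq_iff act_def multiset.map_comp)

locale two_tail_vertices =
  fixes d :: "'v degree_seq" and u w :: 'v
  assumes deg_seq: "is_degree_seq d"
    and arc_degs: "\<forall>(\<delta>t, \<delta>h) \<in># arc_degs d. \<delta>t = 1 \<and> \<delta>h = 2"
    and tails: "{v \<in> vset d. dout d v > 0} = {u, w}" and uw: "u \<noteq> w"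
begin

abbreviation "S \<equiv> H_stub_s d"

lemma fin: "finite (vset d)" "finite (out_stubs d)" "finite (in_stubs d)"
proof -
  show "finite (vset d)"
    using deg_seq by (auto simp: is_degree_seq_def wf_dihypergraph_def degree_seq_of_def)
  moreover have "out_stubs d = Sigma (vset d) (\<lambda>v. {..<dout d v})"
    and "in_stubs d = Sigma (vset d) (\<lambda>v. {..<din d v})"
    by (auto simp: out_stubs_def in_stubs_def)
  ultimately show "finite (out_stubs d)" "finite (in_stubs d)" by auto
qed

lemma sum_tails: "G \<in> S \<Longrightarrow> (\<Sum>a\<in>#G. tail a) = mset_set (out_stubs d)"
  and sum_heads: "G \<in> S \<Longrightarrow> (\<Sum>a\<in>#G. head a) = mset_set (in_stubs d)"
  using stub_labeled_iff[OF fin(2,3)] by (auto simp: H_stub_s_def)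

lemma arc_sizes:
  assumes "G \<in> S" "a \<in># G"
  shows "size (tail a) = 1" "size (head a) = 2"
proof -
  have "arc_degs d = image_mset arc_degree (image_mset unlabel_arc G)"
    using assms(1) by (auto simp: H_stub_s_def degree_seq_of_def unlabel_def dest!: arg_cong[of _ _ arc_degs])
  then have "arc_degree (unlabel_arc a) \<in># arc_degs d" using assms(2) by simp
  then have "arc_degree a \<in># arc_degs d" by (simp only: arc_degree_unlabel)
  then show "size (tail a) = 1" "size (head a) = 2"
    using arc_degs by (auto simp: arc_degree_def)
qed

lemma nondegenerate: "G \<in> S \<Longrightarrow> a \<in># G \<Longrightarrow> \<not> degenerate (unlabel_arc a)"
  by (auto simp: H_stub_s_def unlabel_def)

lemma unlabeled_simple:
  assumes "G \<in> S" shows "count (image_mset unlabel_arc G) x \<le> 1"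
proof -
  have "\<not> 2 \<le> count (arcs (unlabel d G)) x"
    using assms unfolding H_stub_s_def has_multi_hyperarcs_def by blast
  then show ?thesis by (simp add: unlabel_def)
qed

text \<open>Vertex degrees are read off from the sums of tails and heads, so these sums and the arc
  degrees determine the degree sequence.\<close>

lemma in_S_transfer:
  assumes G: "G \<in> S"
    and sums: "(\<Sum>a\<in>#G'. tail a) = (\<Sum>a\<in>#G. tail a)" "(\<Sum>a\<in>#G'. head a) = (\<Sum>a\<in>#G. head a)"
    and degs: "image_mset arc_degree G' = image_mset arc_degree G"
    and nondeg: "\<And>a. a \<in># G' \<Longrightarrow> \<not> degenerate (unlabel_arc a)"
    and simple: "\<And>x. count (image_mset unlabel_arc G') x \<le> 1"
  shows "G' \<in> S"
proof -
  have deg: "in_degree (unlabel d L) = (\<lambda>v. count (image_mset fst (\<Sum>a\<in>#L. head a)) v)"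
    "out_degree (unlabel d L) = (\<lambda>v. count (image_mset fst (\<Sum>a\<in>#L. tail a)) v)" for L
    by (auto simp: in_degree_def out_degree_def unlabel_def unlabel_arc_def multiset.map_comp comp_def
        degree_sum fun_eq_iff)
  have "degree_seq_of (unlabel d G') = degree_seq_of (unlabel d G)"
    using degs unfolding degree_seq_of_def deg sums
    by (simp add: unlabel_def multiset.map_comp comp_def arc_degree_unlabel)
  moreover have "stub_labeled d G'"
    using G sums stub_labeled_iff[OF fin(2,3)] by (simp add: H_stub_s_def)
  moreover have "\<not> has_multi_hyperarcs (unlabel d G')"
  proof -
    have "\<not> 2 \<le> count (image_mset unlabel_arc G') x" for x using simple[of x] by linarith
    then show ?thesis by (simp add: has_multi_hyperarcs_def unlabel_def)
  qed
  ultimately show ?thesis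
    using G nondeg by (auto simp: H_stub_s_def unlabel_def)
qed

section \<open>Accepted shuffles and the relabelling of stubs\<close>

definition sstep :: "('v stub hyperarc multiset \<times> 'v stub hyperarc multiset) set" where
  "sstep = {(G, G'). G \<in> S \<and> G' \<in> S \<and>
     (\<exists>p\<in>ordered_pairs G. \<exists>q\<in>shuffle_set (fst p) (snd p). G' = replace_arcs G p q)}"

lemma sstepI:
  assumes "G \<in> S" "a \<in># G" "b \<in># G" "a \<noteq> b" "(a', b') \<in> shuffle_set a b" "replace_arcs G (a, b) (a', b') \<in> S"
  shows "(G, replace_arcs G (a, b) (a', b')) \<in> sstep"
proof -
  have p: "(a, b) \<in> ordered_pairs G" using assms by (simp add: ordered_pairs_def)
  have "\<exists>p\<in>ordered_pairs G. \<exists>q\<in>shuffle_set (fst p) (snd p). replace_arcs G (a, b) (a', b') = replace_arcs G p q"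
    by (rule bexI[OF _ p], rule bexI[of _ "(a', b')"]) (simp_all add: assms(5))
  then show ?thesis using assms(1,6) by (simp add: sstep_def)
qed

lemma replace_arcs_in_S:
  assumes G: "G \<in> S" and ab: "{#a, b#} \<subseteq># G" "(a', b') \<in> shuffle_set a b"
    and nondeg: "\<not> degenerate (unlabel_arc a')" "\<not> degenerate (unlabel_arc b')"
    and simple: "\<And>x. count (image_mset unlabel_arc (replace_arcs G (a, b) (a', b'))) x \<le> 1"
  shows "replace_arcs G (a, b) (a', b') \<in> S"
proof (rule in_S_transfer[OF G])
  have sums: "tail a + tail b = tail a' + tail b'" "head a + head b = head a' + head b'"
    using ab(2) by (simp_all add: shuffle_set_def)
  show "(\<Sum>x\<in>#replace_arcs G (a, b) (a', b'). tail x) = (\<Sum>x\<in>#G. tail x)"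
    by (rule sum_replace_arcs[OF ab(1) sums(1)])
  show "(\<Sum>x\<in>#replace_arcs G (a, b) (a', b'). head x) = (\<Sum>x\<in>#G. head x)"
    by (rule sum_replace_arcs[OF ab(1) sums(2)])
  have "{#arc_degree a, arc_degree b#} \<subseteq># image_mset arc_degree G"
    using image_mset_subseteq_mono[OF ab(1), of arc_degree] by simp
  moreover have "arc_degree a' = arc_degree a" "arc_degree b' = arc_degree b"
    using ab(2) by (auto simp: shuffle_set_def)
  ultimately show "image_mset arc_degree (replace_arcs G (a, b) (a', b')) = image_mset arc_degree G"
    by (simp only: image_replace_arcs[OF ab(1)] subset_mset.diff_add)
  show "\<not> degenerate (unlabel_arc x)" if "x \<in># replace_arcs G (a, b) (a', b')" for x
  proof -
    have "x = a' \<or> x = b' \<or> x \<in># G - {#a, b#}" using that by (auto simp: replace_arcs_def)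
    then show ?thesis using nondeg nondegenerate[OF G] in_diffD by metis
  qed
qed (use simple in auto)

text \<open>Permuting the stubs of a vertex does not change the underlying hypergraph, and a transposition
  of two stubs is a shuffle of the two hyperarcs that contain them.\<close>

lemma act_two_arcs:
  assumes G: "G \<in> S" "G = add_mset a (add_mset b R)" "a \<noteq> b"
    and fib: "\<And>x. fst (\<pi> x) = fst x" "\<And>x. fst (\<rho> x) = fst x"
    and sums: "tail a + tail b = tail (act \<pi> \<rho> a) + tail (act \<pi> \<rho> b)"
      "head a + head b = head (act \<pi> \<rho> a) + head (act \<pi> \<rho> b)"
    and fixed: "\<And>c. c \<in># R \<Longrightarrow> act \<pi> \<rho> c = c"
  shows "(G, image_mset (act \<pi> \<rho>) G) \<in> sstep"
proof -
  have "image_mset (act \<pi> \<rho>) R = image_mset id R" using fixed by (intro image_mset_cong) auto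
  then have eq: "image_mset (act \<pi> \<rho>) G = replace_arcs G (a, b) (act \<pi> \<rho> a, act \<pi> \<rho> b)"
    by (simp add: G(2) replace_arcs_def)
  have q: "(act \<pi> \<rho> a, act \<pi> \<rho> b) \<in> shuffle_set a b"
    using sums by (simp add: shuffle_set_def arc_degree_act)
  have un: "image_mset unlabel_arc (image_mset (act \<pi> \<rho>) G) = image_mset unlabel_arc G"
    using unlabel_act[of \<pi> \<rho>] fib by (simp add: multiset.map_comp comp_def)
  have ab: "a \<in># G" "b \<in># G" "{#a, b#} \<subseteq># G" using G(2) by simp_all
  have "replace_arcs G (a, b) (act \<pi> \<rho> a, act \<pi> \<rho> b) \<in> S"
  proof (rule replace_arcs_in_S[OF G(1) ab(3) q])
    show "count (image_mset unlabel_arc (replace_arcs G (a, b) (act \<pi> \<rho> a, act \<pi> \<rho> b))) x \<le> 1" for x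
      using unlabeled_simple[OF G(1)] un unfolding eq by metis
  qed (simp_all only: unlabel_act[OF fib] nondegenerate[OF G(1) ab(1)] nondegenerate[OF G(1) ab(2)]
        not_False_eq_True)
  from sstepI[OF G(1) _ _ G(3) q this] show ?thesis unfolding eq using ab by blast
qed

lemma fst_transpose: "fst x = fst y \<Longrightarrow> fst (Transposition.transpose x y z) = fst z"
  by (auto simp: Transposition.transpose_def)

text \<open>Two stubs of one vertex in the same tail or head would make the hyperarc
  degenerate.\<close>

lemma stubs_apart:
  assumes "G \<in> S" "a \<in># G" "x \<noteq> y" "fst x = fst y"
  shows "\<not> (x \<in># tail a \<and> y \<in># tail a)" "\<not> (x \<in># head a \<and> y \<in># head a)"
proof -
  have two: "2 \<le> count (image_mset fst M) (fst x)" if "x \<in># M" "y \<in># M" for M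
  proof -
    have "{#x, y#} \<subseteq># M"
      using that assms(3) by (auto simp: insert_subset_eq_iff in_diff_count)
    from mset_subset_eq_count[OF image_mset_subseteq_mono[OF this, of fst], of "fst x"]
    show ?thesis using assms(4) by simp
  qed
  show "\<not> (x \<in># tail a \<and> y \<in># tail a)" "\<not> (x \<in># head a \<and> y \<in># head a)"
    using nondegenerate[OF assms(1,2)] two[of "tail a"] two[of "head a"]
    unfolding degenerate_def unlabel_arc_def by (metis fst_conv, metis snd_conv)
qed

lemma act_id: "act id id = id"
  by (simp add: act_def fun_eq_iff prod_eq_iff)

lemma head_transposition_reachable:
  assumes G: "G \<in> S" and xy: "x \<in> in_stubs d" "y \<in> in_stubs d" "fst x = fst y"
  shows "(G, image_mset (act id (Transposition.transpose x y)) G) \<in> sstep\<^sup>*"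
proof (cases "x = y")
  case False
  let ?\<tau> = "Transposition.transpose x y"
  obtain a b R where R: "G = add_mset a (add_mset b R)" "a \<noteq> b"
    "image_mset ?\<tau> (head a) + image_mset ?\<tau> (head b) = head a + head b"
    "\<And>c. c \<in># R \<Longrightarrow> image_mset ?\<tau> (head c) = head c"
  proof (rule transposition_affects_two[OF sum_heads[OF G] fin(3) xy(1,2)])
    show "\<not> (x \<in># head a \<and> y \<in># head a)" if "a \<in># G" for a
      using stubs_apart(2)[OF G that False xy(3)] .
  qed (rule that)
  have "(G, image_mset (act id ?\<tau>) G) \<in> sstep"
  proof (rule act_two_arcs[OF G R(1,2)])
    show "head a + head b = head (act id ?\<tau> a) + head (act id ?\<tau> b)" using R(3) by (simp add: act_def)
    show "act id ?\<tau> c = c" if "c \<in># R" for c using R(4)[OF that] by (simp add: act_def prod_eq_iff)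
  qed (simp_all add: act_def fst_transpose[OF xy(3)])
  then show ?thesis by (rule r_into_rtrancl)
qed (simp add: act_id)

lemma tail_transposition_reachable:
  assumes G: "G \<in> S" and xy: "x \<in> out_stubs d" "y \<in> out_stubs d" "fst x = fst y"
  shows "(G, image_mset (act (Transposition.transpose x y) id) G) \<in> sstep\<^sup>*"
proof (cases "x = y")
  case False
  let ?\<tau> = "Transposition.transpose x y"
  obtain a b R where R: "G = add_mset a (add_mset b R)" "a \<noteq> b"
    "image_mset ?\<tau> (tail a) + image_mset ?\<tau> (tail b) = tail a + tail b"
    "\<And>c. c \<in># R \<Longrightarrow> image_mset ?\<tau> (tail c) = tail c"
  proof (rule transposition_affects_two[OF sum_tails[OF G] fin(2) xy(1,2)])
    show "\<not> (x \<in># tail a \<and> y \<in># tail a)" if "a \<in># G" for a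
      using stubs_apart(1)[OF G that False xy(3)] .
  qed (rule that)
  have "(G, image_mset (act ?\<tau> id) G) \<in> sstep"
  proof (rule act_two_arcs[OF G R(1,2)])
    show "tail a + tail b = tail (act ?\<tau> id a) + tail (act ?\<tau> id b)" using R(3) by (simp add: act_def)
    show "act ?\<tau> id c = c" if "c \<in># R" for c using R(4)[OF that] by (simp add: act_def prod_eq_iff)
  qed (simp_all add: act_def fst_transpose[OF xy(3)])
  then show ?thesis by (rule r_into_rtrancl)
qed (simp add: act_id)

lemma sstep_closed: "(G, H) \<in> sstep \<Longrightarrow> H \<in> S"
  by (simp add: sstep_def)

lemma sstep_rtrancl_closed: "(G, H) \<in> sstep\<^sup>* \<Longrightarrow> G \<in> S \<Longrightarrow> H \<in> S"
  by (induction rule: rtrancl_induct) (auto simp: sstep_def)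

lemma relabelling_reachable:
  assumes G: "G \<in> S" and \<pi>: "\<pi> permutes out_stubs d" "\<And>x. fst (\<pi> x) = fst x"
    and \<rho>: "\<rho> permutes in_stubs d" "\<And>x. fst (\<rho> x) = fst x"
  shows "(G, image_mset (act \<pi> \<rho>) G) \<in> sstep\<^sup>*"
proof -
  have 1: "(G, image_mset (act \<pi> id) G) \<in> sstep\<^sup>*"
  proof (rule fibrewise_permutation_reachable[where p = fst and S = S and X = "out_stubs d"
        and act = "\<lambda>\<pi>. image_mset (act \<pi> id)"])
    show "image_mset (act (f \<circ> g) id) L = image_mset (act f id) (image_mset (act g id) L)" for f g and L :: "'v stub hyperarc multiset"
      using act_comp[of f g id id] by (simp add: multiset.map_comp)
  qed (simp_all add: act_id fin sstep_closed tail_transposition_reachable \<pi> G)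
  have "(image_mset (act \<pi> id) G, image_mset (act id \<rho>) (image_mset (act \<pi> id) G)) \<in> sstep\<^sup>*"
  proof (rule fibrewise_permutation_reachable[where p = fst and S = S and X = "in_stubs d"
        and act = "\<lambda>\<rho>. image_mset (act id \<rho>)"])
    show "image_mset (act id (f \<circ> g)) L = image_mset (act id f) (image_mset (act id g) L)" for f g and L :: "'v stub hyperarc multiset"
      using act_comp[of id id f g] by (simp add: multiset.map_comp)
  qed (simp_all add: act_id fin sstep_closed head_transposition_reachable \<rho> sstep_rtrancl_closed[OF 1 G])
  moreover have "image_mset (act id \<rho>) (image_mset (act \<pi> id) G) = image_mset (act \<pi> \<rho>) G"
    using act_comp[of id \<pi> \<rho> id] by (simp add: multiset.map_comp)
  ultimately show ?thesis using 1 by simp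
qed

lemma simple_mset_eq: "(\<And>a. count M a \<le> 1) \<Longrightarrow> M = mset_set (set_mset M)"
proof (rule multiset_eqI)
  fix x assume "\<And>a. count M a \<le> 1"
  from this[of x] show "count M x = count (mset_set (set_mset M)) x"
    by (cases "x \<in># M") (auto simp: count_mset_set' not_in_iff order_antisym Suc_le_eq)
qed

text \<open>Without multi-hyperarcs, the underlying hyperarc identifies the labeled one. This
  matches the hyperarcs of \<open>G\<close> and \<open>H\<close>, and
  \<open>fibrewise_permutation\<close> turns the matching into permutations of stubs.\<close>

lemma same_unlabeled_reachable:
  assumes G: "G \<in> S" and H: "H \<in> S" and same: "unlabel_arc ` set_mset G = unlabel_arc ` set_mset H"
  shows "(G, H) \<in> sstep\<^sup>*"
proof -
  have simple: "L = mset_set (set_mset L)" if "L \<in> S" for L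
    using no_repeated_hyperarcs[OF that] by (rule simple_mset_eq)
  have inj: "inj_on unlabel_arc (set_mset L)" if L: "L \<in> S" for L
  proof (rule inj_onI)
    fix a b assume ab: "a \<in># L" "b \<in># L" "unlabel_arc a = unlabel_arc b"
    show "a = b"
    proof (rule ccontr)
      assume "a \<noteq> b"
      then obtain R where "L = add_mset a (add_mset b R)"
        using ab by (metis insert_noteq_member multi_member_split)
      then have "count (image_mset unlabel_arc L) (unlabel_arc a) \<ge> 2" using ab(3) by simp
      then show False using unlabeled_simple[OF L, of "unlabel_arc a"] by simp
    qed
  qed
  define \<phi> where "\<phi> a = inv_into (set_mset H) unlabel_arc (unlabel_arc a)" for a
  have phi: "\<phi> a \<in># H" "unlabel_arc (\<phi> a) = unlabel_arc a" if "a \<in># G" for a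
  proof -
    have "unlabel_arc a \<in> unlabel_arc ` set_mset H" using same that by blast
    then show "\<phi> a \<in># H" "unlabel_arc (\<phi> a) = unlabel_arc a"
      unfolding \<phi>_def by (rule inv_into_into, rule f_inv_into_f)
  qed
  have "inj_on \<phi> (set_mset G)"
    using inj[OF G] phi(2) by (metis (no_types, lifting) inj_on_def)
  moreover have "\<phi> ` set_mset G = set_mset H"
  proof
    show "\<phi> ` set_mset G \<subseteq> set_mset H" using phi(1) by blast
    show "set_mset H \<subseteq> \<phi> ` set_mset G"
    proof
      fix b assume b: "b \<in># H"
      then obtain a where a: "a \<in># G" "unlabel_arc a = unlabel_arc b" using same by (metis imageE imageI)
      then have "\<phi> a = b" using phi[OF a(1)] inj[OF H] b by (auto dest: inj_onD)
      then show "b \<in> \<phi> ` set_mset G" using a(1) by blast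
    qed
  qed
  ultimately have phi_G: "image_mset \<phi> G = H"
    using simple[OF G] simple[OF H] image_mset_mset_set by metis
  have inj_fst: "inj_on fst (set_mset (tail a))" "inj_on fst (set_mset (head a))" if "a \<in># G" for a
    using stubs_apart[OF G that] by (meson inj_onI)+
  have un: "image_mset fst (tail a) = image_mset fst (tail (\<phi> a))"
    "image_mset fst (head a) = image_mset fst (head (\<phi> a))" if "a \<in># G" for a
    using phi(2)[OF that] by (auto simp: unlabel_arc_def)
  have "(\<Sum>a\<in>#G. tail (\<phi> a)) = mset_set (out_stubs d)" "(\<Sum>a\<in>#G. head (\<phi> a)) = mset_set (in_stubs d)"
    using sum_tails[OF H] sum_heads[OF H] by (simp_all add: phi_G[symmetric] multiset.map_comp comp_def)
  then obtain \<pi> \<rho> where \<pi>: "\<pi> permutes out_stubs d" "\<And>x. fst (\<pi> x) = fst x" "\<And>a. a \<in># G \<Longrightarrow> image_mset \<pi> (tail a) = tail (\<phi> a)"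
    and \<rho>: "\<rho> permutes in_stubs d" "\<And>x. fst (\<rho> x) = fst x" "\<And>a. a \<in># G \<Longrightarrow> image_mset \<rho> (head a) = head (\<phi> a)"
    using fibrewise_permutation[OF fin(2) sum_tails[OF G] _ un(1) inj_fst(1)]
      fibrewise_permutation[OF fin(3) sum_heads[OF G] _ un(2) inj_fst(2)] by metis
  have "image_mset (act \<pi> \<rho>) G = image_mset \<phi> G"
    using \<pi>(3) \<rho>(3) by (intro image_mset_cong) (simp add: act_def)
  then show ?thesis using relabelling_reachable[OF G \<pi>(1,2) \<rho>(1,2)] phi_G by simp
qed

end

section \<open>From hypergraphs to two-coloured graphs\<close>

lemma size_2_pair:
  assumes "size M = 2" obtains x y where "M = {#x, y#}"
proof -
  obtain x N where N: "M = add_mset x N"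
    using assms size_eq_Suc_imp_eq_union[of M 1] by (auto simp: numeral_2_eq_2)
  then have "size N = 1" using assms by simp
  then obtain y where "N = {#y#}" using size_1_singleton_mset by blast
  then show thesis using that N by simp
qed

lemma sum_over_colours:
  fixes f :: "'e \<Rightarrow> int"
  assumes P: "finite P" and A: "snd ` A \<subseteq> P"
  shows "(\<Sum>p\<in>A. f (snd p)) = (\<Sum>e\<in>P. emult A e * f e)"
proof -
  have fin: "finite (cls A \<kappa>)" for \<kappa> using finite_cls[OF P A] .
  have A_eq: "A = Pair True ` cls A True \<union> Pair False ` cls A False"
    by (auto simp: cls_def image_iff) (metis (full_types))+
  have "(\<Sum>p\<in>A. f (snd p)) = (\<Sum>p\<in>Pair True ` cls A True. f (snd p)) + (\<Sum>p\<in>Pair False ` cls A False. f (snd p))"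
    by (subst A_eq, rule sum.union_disjoint) (use fin in auto)
  also have "\<dots> = (\<Sum>e\<in>cls A True. f e) + (\<Sum>e\<in>cls A False. f e)"
    by (simp add: sum.reindex inj_on_def)
  also have "\<dots> = (\<Sum>e\<in>P. of_bool ((True, e) \<in> A) * f e) + (\<Sum>e\<in>P. of_bool ((False, e) \<in> A) * f e)"
  proof -
    have "(\<Sum>e\<in>cls A \<kappa>. f e) = (\<Sum>e\<in>P. of_bool ((\<kappa>, e) \<in> A) * f e)" for \<kappa>
      using A P by (intro sum.mono_neutral_cong_left) (auto simp: cls_def)
    then show ?thesis by simp
  qed
  finally show ?thesis by (simp add: emult_def distrib_right sum.distrib)
qed

context two_tail_vertices
begin

text \<open>Every pair of distinct vertices is an edge, so all chords are available; a loop would be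
  a degenerate head.\<close>

definition P :: "'v multiset set" where
  "P = {{#x, y#} |x y. x \<in> vset d \<and> y \<in> vset d \<and> x \<noteq> y}"

definition colour :: "bool \<Rightarrow> 'v" where "colour \<kappa> = (if \<kappa> then u else w)"

definition enc :: "bool \<times> 'v multiset \<Rightarrow> 'v hyperarc" where
  "enc p = ({#colour (fst p)#}, snd p)"

definition colset :: "'v stub hyperarc multiset \<Rightarrow> (bool \<times> 'v multiset) set" where
  "colset G = {p. enc p \<in> unlabel_arc ` set_mset G}"

abbreviation "colourings \<equiv> cspace P (\<lambda>v. int (din d v)) (\<lambda>\<kappa>. dout d (colour \<kappa>))"
abbreviation "moves \<equiv> cmove P (\<lambda>v. int (din d v)) (\<lambda>\<kappa>. dout d (colour \<kappa>))"

lemma pair_in_P: "x \<in> vset d \<Longrightarrow> y \<in> vset d \<Longrightarrow> x \<noteq> y \<Longrightarrow> {#x, y#} \<in> P"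
  unfolding P_def by blast

lemma P_members: "e \<in> P \<Longrightarrow> x \<in># e \<Longrightarrow> x \<in> vset d"
  by (auto simp: P_def)

lemma P_props: "finite P" "loopless P"
  "e \<in> P \<Longrightarrow> f \<in> P \<Longrightarrow> x \<in># e \<Longrightarrow> y \<in># f \<Longrightarrow> x \<noteq> y \<Longrightarrow> {#x, y#} \<in> P"
proof -
  have "P \<subseteq> (\<lambda>(x, y). {#x, y#}) ` (vset d \<times> vset d)" by (auto simp: P_def)
  then show "finite P" by (rule finite_subset) (simp add: fin(1))
  show "loopless P" by (auto simp: P_def loopless_def)
  show "e \<in> P \<Longrightarrow> f \<in> P \<Longrightarrow> x \<in># e \<Longrightarrow> y \<in># f \<Longrightarrow> x \<noteq> y \<Longrightarrow> {#x, y#} \<in> P"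
    by (intro pair_in_P P_members)
qed

lemma colour_eq_iff: "colour \<kappa> = colour \<mu> \<longleftrightarrow> \<kappa> = \<mu>"
  using uw by (auto simp: colour_def)

lemma inj_enc: "inj enc"
  by (auto simp: inj_def enc_def colour_eq_iff)

lemma enc_nondegenerate: "snd p \<in> P \<Longrightarrow> \<not> degenerate (enc p)"
  by (auto simp: degenerate_def enc_def P_def split: if_splits)

lemma unlabel_eq_enc:
  assumes G: "G \<in> S" and a: "a \<in># G"
  obtains p where "unlabel_arc a = enc p" "snd p \<in> P"
proof -
  obtain s where s: "tail a = {#s#}" using arc_sizes(1)[OF G a] size_1_singleton_mset by blast
  obtain x y where xy: "head a = {#x, y#}" using arc_sizes(2)[OF G a] by (rule size_2_pair)
  have "s \<in> out_stubs d" using sum_mset_set_member(2)[OF sum_tails[OF G] fin(2) a] s by simp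
  then have "fst s \<in> {v \<in> vset d. dout d v > 0}" by (auto simp: out_stubs_def)
  then have "fst s \<in> {u, w}" using tails by simp
  then obtain \<kappa> where \<kappa>: "fst s = colour \<kappa>"
    by (metis colour_def insertE singletonD)
  have "x \<in> in_stubs d" "y \<in> in_stubs d"
    using sum_mset_set_member(2)[OF sum_heads[OF G] fin(3) a] xy by auto
  moreover have "fst x \<noteq> fst y"
  proof
    assume "fst x = fst y"
    then have "2 \<le> count (image_mset fst (head a)) (fst x)" using xy by simp
    then show False using nondegenerate[OF G a] unfolding degenerate_def unlabel_arc_def by auto
  qed
  ultimately have "{#fst x, fst y#} \<in> P" by (intro pair_in_P) (auto simp: in_stubs_def)
  then show thesis
    using that[of "(\<kappa>, {#fst x, fst y#})"] s xy \<kappa> by (simp add: unlabel_arc_def enc_def)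
qed

lemma enc_colset:
  assumes G: "G \<in> S"
  shows "enc ` colset G = unlabel_arc ` set_mset G"
proof
  show "enc ` colset G \<subseteq> unlabel_arc ` set_mset G" by (auto simp: colset_def)
  show "unlabel_arc ` set_mset G \<subseteq> enc ` colset G"
  proof
    fix b assume b: "b \<in> unlabel_arc ` set_mset G"
    then obtain a where a: "a \<in># G" "b = unlabel_arc a" by blast
    obtain p where "unlabel_arc a = enc p" using unlabel_eq_enc[OF G a(1)] .
    then show "b \<in> enc ` colset G" using a b by (auto simp: colset_def)
  qed
qed

lemma unlabeled_mset: "G \<in> S \<Longrightarrow> image_mset unlabel_arc G = mset_set (enc ` colset G)"
  using simple_mset_eq[OF unlabeled_simple[of G]] by (simp add: enc_colset)

lemma sum_colset:
  assumes "G \<in> S"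
  shows "(\<Sum>p\<in>colset G. f (enc p)) = (\<Sum>a\<in>#G. f (unlabel_arc a) :: nat)"
proof -
  have "(\<Sum>a\<in>#G. f (unlabel_arc a)) = (\<Sum>x\<in>#image_mset unlabel_arc G. f x)"
    by (simp add: multiset.map_comp comp_def)
  also have "\<dots> = (\<Sum>x\<in>enc ` colset G. f x)"
    unfolding unlabeled_mset[OF assms] by (simp add: sum_unfold_sum_mset)
  also have "\<dots> = (\<Sum>p\<in>colset G. f (enc p))"
    using inj_enc by (simp add: sum.reindex inj_on_subset)
  finally show ?thesis by simp
qed

lemma colset_in_P: "G \<in> S \<Longrightarrow> snd ` colset G \<subseteq> P"
proof
  fix e assume G: "G \<in> S" and "e \<in> snd ` colset G"
  then obtain p a where p: "e = snd p" "a \<in># G" "enc p = unlabel_arc a" by (auto simp: colset_def)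
  obtain p' where "unlabel_arc a = enc p'" "snd p' \<in> P" using unlabel_eq_enc[OF G p(2)] .
  then show "e \<in> P" using p inj_enc by (metis injD)
qed

lemma finite_colset: "G \<in> S \<Longrightarrow> finite (colset G)"
  by (rule finite_imageD[of enc]) (simp_all add: enc_colset inj_on_subset[OF inj_enc])

lemma degrees:
  assumes "G \<in> S"
  shows "(\<Sum>p\<in>colset G. count (head (enc p)) v) = din d v"
    "(\<Sum>p\<in>colset G. count (tail (enc p)) v) = dout d v"
proof -
  have "degree_seq_of (unlabel d G) = d" using assms by (simp add: H_stub_s_def)
  then have "din d v = in_degree (unlabel d G) v" "dout d v = out_degree (unlabel d G) v"
    unfolding degree_seq_of_def by (metis degree_seq.select_convs)+
  then show "(\<Sum>p\<in>colset G. count (head (enc p)) v) = din d v"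
    "(\<Sum>p\<in>colset G. count (tail (enc p)) v) = dout d v"
    using sum_colset[OF assms, of "\<lambda>a. count (head a) v"] sum_colset[OF assms, of "\<lambda>a. count (tail a) v"]
    by (simp_all add: in_degree_def out_degree_def unlabel_def multiset.map_comp comp_def)
qed

lemma colset_in_colourings:
  assumes G: "G \<in> S"
  shows "colset G \<in> colourings"
  unfolding cspace_def
proof (intro CollectI conjI allI)
  show sub: "snd ` colset G \<subseteq> P" using colset_in_P[OF G] .
  show "edeg P (emult (colset G)) v = int (din d v)" for v
  proof -
    have "edeg P (emult (colset G)) v = (\<Sum>p\<in>colset G. int (count (snd p) v))"
      using sum_over_colours[OF P_props(1) sub, of "\<lambda>e. int (count e v)"] by (simp add: edeg_def)
    also have "\<dots> = int (\<Sum>p\<in>colset G. count (head (enc p)) v)" by (simp add: enc_def)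
    finally show ?thesis by (simp only: degrees[OF G])
  qed
  show "card (cls (colset G) \<kappa>) = dout d (colour \<kappa>)" for \<kappa>
  proof -
    have "(\<Sum>p\<in>colset G. count (tail (enc p)) (colour \<kappa>)) = (\<Sum>p\<in>colset G. of_bool (fst p = \<kappa>))"
      by (intro sum.cong) (auto simp: enc_def colour_eq_iff)
    also have "\<dots> = card (colset G \<inter> {p. fst p = \<kappa>})"
      using finite_colset[OF G] by (simp add: sum_of_bool_eq)
    also have "colset G \<inter> {p. fst p = \<kappa>} = Pair \<kappa> ` cls (colset G) \<kappa>"
      by (auto simp: cls_def)
    also have "card (Pair \<kappa> ` cls (colset G) \<kappa>) = card (cls (colset G) \<kappa>)"
      by (simp add: card_image inj_on_def)
    finally show ?thesis using degrees(2)[OF G, of "colour \<kappa>"] by simp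
  qed
qed

lemma colouring_card:
  assumes "A \<in> colourings"
  shows "card A = dout d u + dout d w" "finite A"
proof -
  have sub: "snd ` A \<subseteq> P" using assms by (simp add: cspace_def)
  have fin: "finite (cls A \<kappa>)" for \<kappa> using finite_cls[OF P_props(1) sub] .
  have A_eq: "A = Pair True ` cls A True \<union> Pair False ` cls A False"
    by (auto simp: cls_def image_iff) (metis (full_types))+
  then show "finite A" using fin by (metis finite_UnI finite_imageI)
  have "card A = card (Pair True ` cls A True) + card (Pair False ` cls A False)"
    by (subst A_eq, rule card_Un_disjoint) (use fin in auto)
  then show "card A = dout d u + dout d w"
    using assms by (simp add: card_image inj_on_def cspace_def colour_def)
qed

text \<open>The tails are kept and the head stubs of both hyperarcs are redistributed following
  \<open>e + f = e' + f'\<close>.\<close>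

lemma lift_move:
  assumes G: "G \<in> S" and move: "(colset G, B) \<in> moves"
  shows "\<exists>G'. (G, G') \<in> sstep \<and> colset G' = B"
proof -
  let ?A = "colset G"
  obtain \<kappa> e \<mu> f e' f' where old: "(\<kappa>, e) \<in> ?A" "(\<mu>, f) \<in> ?A" "(\<kappa>, e) \<noteq> (\<mu>, f)"
    and sum: "e + f = e' + f'" and B: "B = replace_pair ?A (\<kappa>, e) (\<mu>, f) (\<kappa>, e') (\<mu>, f')"
    and AB: "?A \<in> colourings" "B \<in> colourings"
    using move unfolding cmove_def by blast
  let ?p1 = "(\<kappa>, e)" and ?p2 = "(\<mu>, f)" and ?q1 = "(\<kappa>, e')" and ?q2 = "(\<mu>, f')"
  let ?R = "?A - {?p1, ?p2}"
  have inP: "e' \<in> P" "f' \<in> P" using AB(2) by (auto simp: cspace_def B replace_pair_def)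
  obtain a where a: "a \<in># G" "unlabel_arc a = enc ?p1"
    using old(1) unfolding colset_def by (metis imageE mem_Collect_eq)
  obtain b where b: "b \<in># G" "unlabel_arc b = enc ?p2"
    using old(2) unfolding colset_def by (metis imageE mem_Collect_eq)
  have ne: "a \<noteq> b" using a b old(3) inj_enc by (metis injD)
  have ab: "{#a, b#} \<subseteq># G" using a(1) b(1) ne by (auto simp: insert_subset_eq_iff in_diff_count)
  have un_a: "image_mset fst (tail a) = {#colour \<kappa>#}" "image_mset fst (head a) = e"
    and un_b: "image_mset fst (tail b) = {#colour \<mu>#}" "image_mset fst (head b) = f"
    using a(2) b(2) by (simp_all add: unlabel_arc_def enc_def)
  have "image_mset fst (head a + head b) = e' + f'" using un_a un_b sum by simp
  then obtain h1 h2 where h: "head a + head b = h1 + h2" "e' = image_mset fst h1" "f' = image_mset fst h2"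
    using image_mset_eq_plusD by metis
  have two: "size e' = 2" "size f' = 2" using inP by (auto simp: P_def)
  let ?a' = "(tail a, h1)" and ?b' = "(tail b, h2)"
  have q: "(?a', ?b') \<in> shuffle_set a b"
    using h two arc_sizes[OF G a(1)] arc_sizes[OF G b(1)]
    by (simp add: shuffle_set_def arc_degree_def)
  have un': "unlabel_arc ?a' = enc ?q1" "unlabel_arc ?b' = enc ?q2"
    using un_a un_b h by (simp_all add: unlabel_arc_def enc_def)
  have finA: "finite ?A" using AB(1) colouring_card(2) by blast
  have cardR: "card ?R + 2 = card ?A"
  proof -
    have sub: "{?p1, ?p2} \<subseteq> ?A" using old by simp
    have "card ?R = card ?A - card {?p1, ?p2}" by (rule card_Diff_subset[OF _ sub]) simp
    moreover have "card {?p1, ?p2} = 2" using old(3) by simp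
    moreover have "card {?p1, ?p2} \<le> card ?A" by (rule card_mono[OF finA sub])
    ultimately show ?thesis by linarith
  qed
  \<comment> \<open>Both colourings have the same size, so the new coloured edges differ from each
    other and from the remaining ones: no multi-hyperarc arises.\<close>
  have "card (insert ?q1 (insert ?q2 ?R)) = card ?R + 2"
    using colouring_card(1)[OF AB(1)] colouring_card(1)[OF AB(2)] cardR
    by (simp add: B replace_pair_def Un_commute insert_commute)
  then have fresh: "?q1 \<notin> insert ?q2 ?R" "?q2 \<notin> ?R"
    using finA by (auto simp: card_insert_if split: if_splits)
  let ?G' = "replace_arcs G (a, b) (?a', ?b')"
  have "image_mset unlabel_arc ?G' = mset_set (enc ` ?A) - {#enc ?p1, enc ?p2#} + {#enc ?q1, enc ?q2#}"
    unfolding image_replace_arcs[OF ab] unlabeled_mset[OF G] a(2) b(2) un' ..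
  also have "mset_set (enc ` ?A) - {#enc ?p1, enc ?p2#} = mset_set (enc ` ?R)"
  proof -
    have "?A = insert ?p1 (insert ?p2 ?R)" using old by auto
    then have "mset_set (enc ` ?A) = mset_set (insert (enc ?p1) (insert (enc ?p2) (enc ` ?R)))"
      by (metis image_insert)
    also have "\<dots> = {#enc ?p1, enc ?p2#} + mset_set (enc ` ?R)"
      using finA old(3) by (auto simp: inj_image_mem_iff[OF inj_enc] inj_eq[OF inj_enc])
    finally show ?thesis by (simp only: add_diff_cancel_left')
  qed
  also have "mset_set (enc ` ?R) + {#enc ?q1, enc ?q2#} = mset_set (enc ` B)"
  proof -
    have "B = insert ?q1 (insert ?q2 ?R)" by (auto simp: B replace_pair_def)
    then have "mset_set (enc ` B) = mset_set (insert (enc ?q1) (insert (enc ?q2) (enc ` ?R)))"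
      by (metis image_insert)
    also have "\<dots> = {#enc ?q1, enc ?q2#} + mset_set (enc ` ?R)"
      using finA fresh by (auto simp: inj_image_mem_iff[OF inj_enc] inj_eq[OF inj_enc])
    finally show ?thesis by (simp add: add.commute)
  qed
  finally have un_G': "image_mset unlabel_arc ?G' = mset_set (enc ` B)" .
  have G': "?G' \<in> S"
  proof (rule replace_arcs_in_S[OF G ab q])
    show "\<not> degenerate (unlabel_arc ?a')" "\<not> degenerate (unlabel_arc ?b')"
      unfolding un' using inP by (auto intro!: enc_nondegenerate)
    show "count (image_mset unlabel_arc ?G') x \<le> 1" for x
      unfolding un_G' by (simp add: count_mset_set')
  qed
  have finB: "finite (enc ` B)" using colouring_card(2)[OF AB(2)] by simp
  have "enc ` colset ?G' = enc ` B"
    using enc_colset[OF G'] arg_cong[OF un_G', of set_mset] finB by simp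
  then have "colset ?G' = B" using inj_enc by (simp add: inj_image_eq_iff)
  then show ?thesis using sstepI[OF G a(1) b(1) ne q G'] by blast
qed

theorem shuffles_connect:
  assumes G: "G \<in> S" and H: "H \<in> S"
  shows "(G, H) \<in> sstep\<^sup>*"
proof -
  have "(colset G, colset H) \<in> moves\<^sup>*"
    using cmoves_connect[OF P_props(1,2) _ colset_in_colourings[OF G] colset_in_colourings[OF H]]
      P_props(3) by metis
  then have "\<exists>G'. (G, G') \<in> sstep\<^sup>* \<and> colset G' = colset H"
  proof (induction rule: rtrancl_induct)
    case (step A B)
    then obtain G' where G': "(G, G') \<in> sstep\<^sup>*" "colset G' = A" by blast
    then obtain G'' where "(G', G'') \<in> sstep" "colset G'' = B"
      using lift_move[of G' B] step(2) sstep_rtrancl_closed[OF G'(1) G] by blast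
    then show ?case using G'(1) rtrancl_into_rtrancl by metis
  qed blast
  then obtain G' where G': "(G, G') \<in> sstep\<^sup>*" "colset G' = colset H" by blast
  have S: "G' \<in> S" using sstep_rtrancl_closed[OF G'(1) G] .
  have "unlabel_arc ` set_mset G' = unlabel_arc ` set_mset H"
    using enc_colset[OF S] enc_colset[OF H] G'(2) by simp
  from same_unlabeled_reachable[OF S H this] show ?thesis using G'(1) by simp
qed

section \<open>Verification of the Markov chain hypotheses\<close>

text \<open>Each tail holds one out-stub, and the two tail vertices supply at least two, so there is
  a pair to pick in every step.\<close>

lemma size_in_S:
  assumes G: "G \<in> S"
  shows "size G = card (out_stubs d)" "2 \<le> card (out_stubs d)"
proof -
  have "size (\<Sum>a\<in>#G. tail a) = (\<Sum>a\<in>#G. size (tail a))" by (induction G) auto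
  also have "\<dots> = (\<Sum>a\<in>#G. 1)"
    using arc_sizes(1)[OF G] by (intro arg_cong[of _ _ sum_mset] image_mset_cong) auto
  finally show "size G = card (out_stubs d)" using sum_tails[OF G] by simp
  have "{u, w} = {v \<in> vset d. dout d v > 0}" using tails by simp
  then have "{(u, 0), (w, 0)} \<subseteq> out_stubs d" by (auto simp: out_stubs_def)
  then have "card {(u, 0::nat), (w, 0)} \<le> card (out_stubs d)" using fin(2) by (rule card_mono[rotated])
  then show "2 \<le> card (out_stubs d)" using uw by simp
qed

lemma sstep_support: "(G, G') \<in> sstep \<Longrightarrow> G' \<in> set_pmf (shuffle_step S G)"
proof -
  assume "(G, G') \<in> sstep"
  then obtain p q where p: "p \<in> ordered_pairs G" "q \<in> shuffle_set (fst p) (snd p)"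
    and G': "G' = replace_arcs G p q" "G' \<in> S" unfolding sstep_def by blast
  have "(fst p, snd p) \<in> ordered_pairs G" using p(1) by simp
  from set_shuffle_step[OF this p(2), of S] show ?thesis using G' by simp
qed

text \<open>The shuffle set of a pair contains the pair itself.\<close>

lemma self_support:
  assumes G: "G \<in> S"
  shows "G \<in> set_pmf (shuffle_step S G)"
proof -
  have "2 \<le> card (set_mset G)"
    using card_set_mset_simple[OF no_repeated_hyperarcs[OF G]] size_in_S[OF G] by simp
  then obtain Q where "Q \<subseteq> set_mset G" "card Q = 2" by (rule obtain_subset_with_card_n)
  then obtain a b where ab: "a \<in># G" "b \<in># G" "a \<noteq> b" by (auto simp: card_2_iff)
  then have p: "(a, b) \<in> ordered_pairs G" by (simp add: ordered_pairs_def)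
  have "replace_arcs G (a, b) (a, b) = G"
    using ordered_pairs_subset[OF p] by (simp only: replace_arcs_def fst_conv snd_conv subset_mset.diff_add)
  then show ?thesis using set_shuffle_step[OF p shuffle_set_refl, of S] G by simp
qed

lemma symmetric_chain_shuffle_step: "symmetric_chain S (shuffle_step S)"
proof
  show "finite S" using finite_H_stub_s[OF deg_seq] .
  show "set_pmf (shuffle_step S G) \<subseteq> S" if "G \<in> S" for G
    using that by (auto simp: shuffle_step_eq set_bind_pmf)
  show "pmf (shuffle_step S G) H = pmf (shuffle_step S H) G" if "G \<in> S" "H \<in> S" for G H
    by (rule shuffle_step_symmetric[where m = "card (out_stubs d)"])
      (use that no_repeated_hyperarcs size_in_S in auto)
  show "G \<in> set_pmf (shuffle_step S G)" if "G \<in> S" for G using self_support[OF that] .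
  have "sstep \<subseteq> {(x, y). x \<in> S \<and> y \<in> set_pmf (shuffle_step S x)}"
    using sstep_support by (auto simp: sstep_def)
  then show "(G, H) \<in> {(x, y). x \<in> S \<and> y \<in> set_pmf (shuffle_step S x)}\<^sup>*" if "G \<in> S" "H \<in> S" for G H
    using shuffles_connect[OF that] rtrancl_mono by blast
qed

end

theorem theorem2:
  fixes d :: "'v degree_seq" and H\<^sub>0 :: "'v stub hyperarc multiset"
  assumes "is_degree_seq d"
    and "\<forall>(\<delta>t, \<delta>h) \<in># arc_degs d. \<delta>t = 1 \<and> \<delta>h = 2"
    and "card {v \<in> vset d. dout d v > 0} = 2"
    and "H\<^sub>0 \<in> H_stub_s d"
  shows "converges_in_distribution
    (\<lambda>k. shuffling_method (H_stub_s d) k H\<^sub>0) (pmf_of_set (H_stub_s d))"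
proof -
  obtain u w where "{v \<in> vset d. dout d v > 0} = {u, w}" "u \<noteq> w"
    using assms(3) by (auto simp: card_2_iff)
  then interpret two_tail_vertices d u w
    using assms by unfold_locales auto
  interpret symmetric_chain "H_stub_s d" "shuffle_step (H_stub_s d)"
    by (rule symmetric_chain_shuffle_step)
  show ?thesis by (rule converges_to_uniform) (use assms(4) in simp_all)
qed

end
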